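(* (Reliability.) There exist constants $c_{\mathrm{rel}},c_{\mathrm{osc}}>0$, depending only on the chunkiness $\omega_0>0$, such that for every $h>0$ and every $v\in K$, $$\rho_h^2(v)\le c_{\mathrm{rel}}\,\eta_h^2(v)+c_{\mathrm{osc}}\,\mathrm{osc}_h^2(f).$$
   Context: Setting: $d\in\mathbb{N}$; $\Omega\subseteq\mathbb{R}^d$ is a bounded polyhedral Lipschitz domain whose boundary is the disjoint union of a closed Dirichlet part $\Gamma_D$ with $|\Gamma_D|>0$ (($d-1$)-dimensional Hausdorff measure) and a Neumann part $\Gamma_N$. $(\cdot,\cdot)_\omega$ and $\|\cdot\|_\omega$ are the $L^2(\omega)$ inner product and norm (scalar or vector valued). $H^1_D(\Omega)=\{v\in H^1(\Omega): v=0 \text{ a.e. on }\Gamma_D\}$ (traces); $\langle\cdot,\cdot\rangle_\Omega$ is the duality pairing of $(H^1_D(\Omega))^*$ and $H^1_D(\Omega)$, and $\|\Phi\|_{*,\Omega}=\sup\{\langle\Phi,v\rangle_\Omega: v\in H^1_D(\Omega),\ \|v\|_\Omega+\|\nabla v\|_\Omega\le1\}$. Mesh: $\{\mathcal{T}_h\}_{h>0}$ is a family of conforming simplicial triangulations of $\Omega$; $h_T=\mathrm{diam}(T)$, $\rho_T=\sup\{r>0:\exists x\in T,\ B_r(x)\subseteq T\}$, and the family is shape regular, i.e. $\max_{T\in\mathcal{T}_h}h_T/\rho_T\le\omega_0$ for all $h$, where $\omega_0$ (the smallest such constant) is called the chunkiness. $h_{\mathcal{T}}|_T=h_T$. Every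 boundary side is contained in $\Gamma_D$ or in $\overline{\Gamma_N}$. $x_S$ is the barycenter of a side (facet) $S$. $\mathcal{L}^k(\mathcal{T}_h)$ is the space of element-wise polynomials of degree $\le k$. $\Pi_h$ is the $L^2$-projection onto element-wise constant functions. $\nabla_h$ is the element-wise gradient. $\mathcal{S}^{1,cr}_D(\mathcal{T}_h)$ is the Crouzeix--Raviart space of $v_h\in\mathcal{L}^1(\mathcal{T}_h)$ continuous at $x_S$ for all interior sides $S$ and with $v_h(x_S)=0$ for all sides $S\subseteq\Gamma_D$. Obstacle problem: $f\in L^2(\Omega)$, $\chi\in H^1(\Omega)$ with $\chi\le0$ a.e. on $\Gamma_D$, $K=\{v\in H^1_D(\Omega): v\ge\chi\text{ a.e. in }\Omega\}$; $u\in K$ is the unique minimizer of $\frac12\|\nabla v\|_\Omega^2-(f,v)_\Omega$ over $v\in K$; the Lagrange multiplier $\Lambda\in(H^1_D(\Omega))^*$ is given by $\langle\Lambda,v\rangle_\Omega=(f,v)_\Omega-(\nabla u,\nabla v)_\Omega$ for all $v\in H^1_D(\Omega)$. Discrete obstacle problem: $f_h=\Pi_hf$, $\chi_h\in\mathcal{L}^0(\mathcal{T}_h)$ is an approximation of $\chi$, $K_h^{cr}=\{v_h\in\mathcal{S}^{1,cr}_D(\mathcal{T}_h):\Pi_hv_h\ge\chi_h\text{ a.e. in }\Omega\}$; $u_h^{cr}\in K_h^{cr}$ is the unique minimizer of $\frac12\|\nabla_hv_h\|_\Omega^2-(f_h,\Pi_hv_h)_\Omega$ over $v_h\in K_h^{cr}$.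 The discrete Lagrange multiplier $\overline{\lambda}_h^{cr}\in\Pi_h(\mathcal{S}^{1,cr}_D(\mathcal{T}_h))$ is the unique element with $\overline{\lambda}_h^{cr}\le0$ a.e. in $\Omega$ and $(\overline{\lambda}_h^{cr},\Pi_hv_h)_\Omega=(f_h,\Pi_hv_h)_\Omega-(\nabla_hu_h^{cr},\nabla_hv_h)_\Omega$ for all $v_h\in\mathcal{S}^{1,cr}_D(\mathcal{T}_h)$; $\overline{\Lambda}_h^{cr}\in(H^1_D(\Omega))^*$ is given by $\langle\overline{\Lambda}_h^{cr},v\rangle_\Omega=(\overline{\lambda}_h^{cr},\Pi_hv)_\Omega$. Estimator and error measure, for $v\in H^1_D(\Omega)$: $\eta_h^2(v)=\eta_{A,h}^2(v)+\eta_{B,h}^2(v)+\eta_{C,h}^2$ with $\eta_{A,h}^2(v)=\|\nabla v-\nabla_hu_h^{cr}\|_\Omega^2$, $\eta_{B,h}^2(v)=(-\overline{\lambda}_h^{cr},\Pi_h(v-\chi))_\Omega$, $\eta_{C,h}^2=\frac1{d^2}\|h_{\mathcal{T}}(f_h-\overline{\lambda}_h^{cr})\|_\Omega^2$; $\mathrm{osc}_h^2(f)=\|h_{\mathcal{T}}(f_h-f)\|_\Omega^2$; and $$\rho_h^2(v)=\tfrac12\|\nabla v-\nabla u\|_\Omega^2+\langle-\Lambda,v-u\rangle_\Omega+\|\nabla u-\nabla_hu_h^{cr}\|_\Omega^2+(-\overline{\lambda}_h^{cr},\Pi_h(u-\chi))_\Omega+\|\overline{\Lambda}_h^{cr}-\Lambda\|_{*,\Omega}^2.$$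 *)

theory Defs
  imports "HOL-Analysis.Analysis"
begin

section \<open>Square-integrable functions\<close>

text \<open>Elements of Lebesgue and Sobolev spaces are represented by functions on the whole type, of
  which only the values on the domain, up to null sets, are relevant.\<close>

definition L2 :: "'a measure \<Rightarrow> ('a \<Rightarrow> 'b::euclidean_space) set" where
  "L2 M = {f \<in> borel_measurable M. integrable M (\<lambda>x. (norm (f x))\<^sup>2)}"

definition L2_inner :: "'a measure \<Rightarrow> ('a \<Rightarrow> 'b::euclidean_space) \<Rightarrow> ('a \<Rightarrow> 'b) \<Rightarrow> real" where
  "L2_inner M f g = (\<integral>x. f x \<bullet> g x \<partial>M)"

definition L2_norm :: "'a measure \<Rightarrow> ('a \<Rightarrow> 'b::euclidean_space) \<Rightarrow> real" where
  "L2_norm M f = sqrt (L2_inner M f f)"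

definition L2_tendsto ::
  "'a measure \<Rightarrow> (nat \<Rightarrow> 'a \<Rightarrow> 'b::euclidean_space) \<Rightarrow> ('a \<Rightarrow> 'b) \<Rightarrow> bool" where
  "L2_tendsto M F f \<longleftrightarrow>
     (\<forall>n. (\<lambda>x. F n x - f x) \<in> L2 M) \<and> (\<lambda>n. L2_norm M (\<lambda>x. F n x - f x)) \<longlonglongrightarrow> 0"

section \<open>Hausdorff measure\<close>

text \<open>The empty set contributes nothing to a cover, also for \<open>s = 0\<close>, where a nonempty set
  contributes \<open>1\<close>. The diameter of the library is only meaningful for bounded sets.\<close>

definition hausdorff_premeasure :: "nat \<Rightarrow> real \<Rightarrow> 'a::metric_space set \<Rightarrow> ennreal" where
  "hausdorff_premeasure s \<delta> A =
     (INF C \<in> {C :: nat \<Rightarrow> 'a set. A \<subseteq> (\<Union>i. C i) \<and> (\<forall>i. bounded (C i) \<and> diameter (C i) \<le> \<delta>)}.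
        \<Sum>i. if C i = {} then 0
             else ennreal (unit_ball_vol (real s) / 2 ^ s * diameter (C i) ^ s))"

definition hausdorff_outer :: "nat \<Rightarrow> 'a::metric_space set \<Rightarrow> ennreal" where
  "hausdorff_outer s A = (SUP \<delta>\<in>{0<..}. hausdorff_premeasure s \<delta> A)"

text \<open>\<open>hausdorff_outer\<close> is a metric outer measure, hence countably additive on Borel sets.\<close>

definition hausdorff_measure :: "nat \<Rightarrow> 'a::metric_space measure" where
  "hausdorff_measure s = measure_of UNIV (sets borel) (hausdorff_outer s)"

definition boundary_measure :: "'a::euclidean_space set \<Rightarrow> 'a measure" where
  "boundary_measure \<Omega> = restrict_space (hausdorff_measure (DIM('a) - 1)) (frontier \<Omega>)"

section \<open>Polyhedral Lipschitz domains\<close>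

text \<open>Near every boundary point the domain is the strict epigraph of a Lipschitz function, with
  respect to some unit vector \<open>e\<close> as vertical direction and its orthogonal complement as
  horizontal hyperplane.\<close>

definition lipschitz_domain :: "'a::euclidean_space set \<Rightarrow> bool" where
  "lipschitz_domain \<Omega> \<longleftrightarrow>
     open \<Omega> \<and> connected \<Omega> \<and> bounded \<Omega> \<and> \<Omega> \<noteq> {} \<and>
     (\<forall>x\<in>frontier \<Omega>. \<exists>e r L \<gamma>. norm e = 1 \<and> r > 0 \<and> L-lipschitz_on {z. e \<bullet> z = 0} \<gamma> \<and>
        \<Omega> \<inter> ball x r = {y \<in> ball x r. \<gamma> (y - (e \<bullet> y) *\<^sub>R e) < e \<bullet> y})"

definition polyhedral :: "'a::euclidean_space set \<Rightarrow> bool" where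
  "polyhedral \<Omega> \<longleftrightarrow> (\<exists>\<P>. finite \<P> \<and> (\<forall>P\<in>\<P>. polytope P) \<and> closure \<Omega> = \<Union>\<P>)"

definition boundary_partition ::
  "'a::euclidean_space set \<Rightarrow> 'a set \<Rightarrow> 'a set \<Rightarrow> bool" where
  "boundary_partition \<Omega> \<Gamma>D \<Gamma>N \<longleftrightarrow>
     closed \<Gamma>D \<and> \<Gamma>D \<union> \<Gamma>N = frontier \<Omega> \<and> \<Gamma>D \<inter> \<Gamma>N = {} \<and>
     emeasure (hausdorff_measure (DIM('a) - 1)) \<Gamma>D > 0"

section \<open>Sobolev functions and traces\<close>

definition gradient :: "('a::euclidean_space \<Rightarrow> real) \<Rightarrow> 'a \<Rightarrow> 'a" where
  "gradient \<phi> x = (\<Sum>b\<in>Basis. frechet_derivative \<phi> (at x) b *\<^sub>R b)"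

primrec Ck :: "nat \<Rightarrow> ('a::euclidean_space \<Rightarrow> real) \<Rightarrow> bool" where
  "Ck 0 \<phi> \<longleftrightarrow> continuous_on UNIV \<phi>"
| "Ck (Suc k) \<phi> \<longleftrightarrow> (\<forall>x. \<phi> differentiable at x) \<and> (\<forall>b\<in>Basis. Ck k (\<lambda>x. gradient \<phi> x \<bullet> b))"

definition smooth :: "('a::euclidean_space \<Rightarrow> real) \<Rightarrow> bool" where
  "smooth \<phi> \<longleftrightarrow> (\<forall>k. Ck k \<phi>)"

definition test_functions :: "'a::euclidean_space set \<Rightarrow> ('a \<Rightarrow> real) set" where
  "test_functions \<Omega> =
     {\<phi>. smooth \<phi> \<and> compact (closure {x. \<phi> x \<noteq> 0}) \<and> closure {x. \<phi> x \<noteq> 0} \<subseteq> \<Omega>}"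

definition is_weak_gradient ::
  "'a::euclidean_space set \<Rightarrow> ('a \<Rightarrow> real) \<Rightarrow> ('a \<Rightarrow> 'a) \<Rightarrow> bool" where
  "is_weak_gradient \<Omega> v g \<longleftrightarrow> g \<in> L2 (lebesgue_on \<Omega>) \<and>
     (\<forall>\<phi>\<in>test_functions \<Omega>. \<forall>b\<in>Basis.
        (\<integral>x. v x * (gradient \<phi> x \<bullet> b) \<partial>lebesgue_on \<Omega>) = - (\<integral>x. (g x \<bullet> b) * \<phi> x \<partial>lebesgue_on \<Omega>))"

definition H1 :: "'a::euclidean_space set \<Rightarrow> ('a \<Rightarrow> real) set" where
  "H1 \<Omega> = {v \<in> L2 (lebesgue_on \<Omega>). \<exists>g. is_weak_gradient \<Omega> v g}"

text \<open>Determined up to null sets.\<close>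

definition weak_grad :: "'a::euclidean_space set \<Rightarrow> ('a \<Rightarrow> real) \<Rightarrow> 'a \<Rightarrow> 'a" where
  "weak_grad \<Omega> v = (SOME g. is_weak_gradient \<Omega> v g)"

text \<open>The trace operator on a bounded Lipschitz domain is the continuous extension from \<open>H\<^sup>1(\<Omega>)\<close> to
  \<open>L\<^sup>2(\<partial>\<Omega>)\<close> of the restriction of smooth functions to the boundary. As smooth functions are dense
  in \<open>H\<^sup>1(\<Omega>)\<close>, its graph is the following relation.\<close>

definition has_trace ::
  "'a::euclidean_space set \<Rightarrow> ('a \<Rightarrow> real) \<Rightarrow> ('a \<Rightarrow> real) \<Rightarrow> bool" where
  "has_trace \<Omega> v g \<longleftrightarrow> v \<in> H1 \<Omega> \<and> g \<in> L2 (boundary_measure \<Omega>) \<and>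
     (\<exists>\<phi>. (\<forall>n. smooth (\<phi> n)) \<and>
        L2_tendsto (lebesgue_on \<Omega>) \<phi> v \<and>
        L2_tendsto (lebesgue_on \<Omega>) (\<lambda>n. gradient (\<phi> n)) (weak_grad \<Omega> v) \<and>
        L2_tendsto (boundary_measure \<Omega>) \<phi> g)"

definition H1D :: "'a::euclidean_space set \<Rightarrow> 'a set \<Rightarrow> ('a \<Rightarrow> real) set" where
  "H1D \<Omega> \<Gamma>D = {v \<in> H1 \<Omega>. \<exists>g. has_trace \<Omega> v g \<and> (AE x in boundary_measure \<Omega>. x \<in> \<Gamma>D \<longrightarrow> g x = 0)}"

definition trace_nonpos_on :: "'a::euclidean_space set \<Rightarrow> 'a set \<Rightarrow> ('a \<Rightarrow> real) \<Rightarrow> bool" where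
  "trace_nonpos_on \<Omega> \<Gamma>D v \<longleftrightarrow>
     (\<exists>g. has_trace \<Omega> v g \<and> (AE x in boundary_measure \<Omega>. x \<in> \<Gamma>D \<longrightarrow> g x \<le> 0))"

text \<open>Used for bounded functionals only, for which the supremum is one of a nonempty bounded set.\<close>

definition dual_norm ::
  "'a::euclidean_space set \<Rightarrow> 'a set \<Rightarrow> (('a \<Rightarrow> real) \<Rightarrow> real) \<Rightarrow> real" where
  "dual_norm \<Omega> \<Gamma>D \<Phi> =
     Sup {\<Phi> v | v. v \<in> H1D \<Omega> \<Gamma>D \<and>
       L2_norm (lebesgue_on \<Omega>) v + L2_norm (lebesgue_on \<Omega>) (weak_grad \<Omega> v) \<le> 1}"

section \<open>Triangulations\<close>

definition conforming_triangulation :: "'a::euclidean_space set \<Rightarrow> 'a set set \<Rightarrow> bool" where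
  "conforming_triangulation \<Omega> \<T> \<longleftrightarrow>
     triangulation \<T> \<and> (\<forall>T\<in>\<T>. int DIM('a) simplex T) \<and> \<Union>\<T> = closure \<Omega>"

definition sides :: "'a::euclidean_space set set \<Rightarrow> 'a set set" where
  "sides \<T> = {S. \<exists>T\<in>\<T>. S facet_of T}"

definition boundary_sides :: "'a::euclidean_space set \<Rightarrow> 'a set set \<Rightarrow> 'a set set" where
  "boundary_sides \<Omega> \<T> = {S \<in> sides \<T>. S \<subseteq> frontier \<Omega>}"

definition interior_sides :: "'a::euclidean_space set \<Rightarrow> 'a set set \<Rightarrow> 'a set set" where
  "interior_sides \<Omega> \<T> = sides \<T> - boundary_sides \<Omega> \<T>"

definition barycenter :: "'a::euclidean_space set \<Rightarrow> 'a" where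
  "barycenter S = (let V = {z. z extreme_point_of S} in (1 / real (card V)) *\<^sub>R (\<Sum>z\<in>V. z))"

definition inradius :: "'a::euclidean_space set \<Rightarrow> real" where
  "inradius T = Sup {r. r > 0 \<and> (\<exists>x\<in>T. ball x r \<subseteq> T)}"

definition aspect_ratios :: "(real \<Rightarrow> 'a::euclidean_space set set) \<Rightarrow> real set" where
  "aspect_ratios \<T> = {diameter T / inradius T | T h. h > 0 \<and> T \<in> \<T> h}"

definition shape_regular :: "(real \<Rightarrow> 'a::euclidean_space set set) \<Rightarrow> bool" where
  "shape_regular \<T> \<longleftrightarrow> bdd_above (aspect_ratios \<T>)"

definition chunkiness :: "(real \<Rightarrow> 'a::euclidean_space set set) \<Rightarrow> real" where
  "chunkiness \<T> = Sup (aspect_ratios \<T>)"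

definition mesh_family ::
  "'a::euclidean_space set \<Rightarrow> 'a set \<Rightarrow> 'a set \<Rightarrow> (real \<Rightarrow> 'a set set) \<Rightarrow> bool" where
  "mesh_family \<Omega> \<Gamma>D \<Gamma>N \<T> \<longleftrightarrow> shape_regular \<T> \<and>
     (\<forall>h>0. conforming_triangulation \<Omega> (\<T> h) \<and>
        (\<forall>S\<in>boundary_sides \<Omega> (\<T> h). S \<subseteq> \<Gamma>D \<or> S \<subseteq> closure \<Gamma>N))"

section \<open>Finite element spaces\<close>

text \<open>Piecewise functions are prescribed in the interiors of the elements; their values on the
  skeleton, which is a null set, are arbitrary.\<close>

definition meshsize :: "'a::euclidean_space set set \<Rightarrow> 'a \<Rightarrow> real" where
  "meshsize \<T> x = diameter (THE T. T \<in> \<T> \<and> x \<in> interior T)"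

definition multi_indices :: "nat \<Rightarrow> ('a::euclidean_space \<Rightarrow> nat) set" where
  "multi_indices k = {\<alpha> \<in> Basis \<rightarrow>\<^sub>E {..k}. (\<Sum>b\<in>Basis. \<alpha> b) \<le> k}"

definition polynomials :: "nat \<Rightarrow> ('a::euclidean_space \<Rightarrow> real) set" where
  "polynomials k =
     {p. \<exists>c. \<forall>x. p x = (\<Sum>\<alpha>\<in>multi_indices k. c \<alpha> * (\<Prod>b\<in>Basis. (x \<bullet> b) ^ \<alpha> b))}"

definition elementwise_polynomials ::
  "nat \<Rightarrow> 'a::euclidean_space set set \<Rightarrow> ('a \<Rightarrow> real) set" where
  "elementwise_polynomials k \<T> =
     {v. \<forall>T\<in>\<T>. \<exists>p\<in>polynomials k. \<forall>x\<in>interior T. v x = p x}"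

definition broken_grad ::
  "'a::euclidean_space set set \<Rightarrow> ('a \<Rightarrow> real) \<Rightarrow> 'a \<Rightarrow> 'a" where
  "broken_grad \<T> v x = (if \<exists>T\<in>\<T>. x \<in> interior T then gradient v x else 0)"

definition L2_proj ::
  "'a::euclidean_space set \<Rightarrow> 'a set set \<Rightarrow> ('a \<Rightarrow> real) \<Rightarrow> 'a \<Rightarrow> real" where
  "L2_proj \<Omega> \<T> v =
     (SOME p. p \<in> elementwise_polynomials 0 \<T> \<and>
        (\<forall>q\<in>elementwise_polynomials 0 \<T>. L2_inner (lebesgue_on \<Omega>) (\<lambda>x. v x - p x) q = 0))"

text \<open>Continuity at a barycenter and the value there refer to the limit from inside the adjacent
  elements.\<close>

definition CR :: "'a::euclidean_space set \<Rightarrow> 'a set \<Rightarrow> 'a set set \<Rightarrow> ('a \<Rightarrow> real) set" where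
  "CR \<Omega> \<Gamma>D \<T> =
     {v \<in> elementwise_polynomials 1 \<T>.
        (\<forall>S\<in>interior_sides \<Omega> \<T>.
           \<exists>l. (v \<longlongrightarrow> l) (at (barycenter S) within (\<Union>T\<in>\<T>. interior T))) \<and>
        (\<forall>S\<in>sides \<T>. S \<subseteq> \<Gamma>D \<longrightarrow>
           (v \<longlongrightarrow> 0) (at (barycenter S) within (\<Union>T\<in>\<T>. interior T)))}"

section \<open>The obstacle problem\<close>

definition obstacle_set ::
  "'a::euclidean_space set \<Rightarrow> 'a set \<Rightarrow> ('a \<Rightarrow> real) \<Rightarrow> ('a \<Rightarrow> real) set" where
  "obstacle_set \<Omega> \<Gamma>D chi = {v \<in> H1D \<Omega> \<Gamma>D. (AE x in lebesgue_on \<Omega>. v x \<ge> chi x)}"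

definition energy ::
  "'a::euclidean_space set \<Rightarrow> ('a \<Rightarrow> real) \<Rightarrow> ('a \<Rightarrow> real) \<Rightarrow> real" where
  "energy \<Omega> f v =
     1 / 2 * (L2_norm (lebesgue_on \<Omega>) (weak_grad \<Omega> v))\<^sup>2 - L2_inner (lebesgue_on \<Omega>) f v"

definition obstacle_solution ::
  "'a::euclidean_space set \<Rightarrow> 'a set \<Rightarrow> ('a \<Rightarrow> real) \<Rightarrow> ('a \<Rightarrow> real) \<Rightarrow> ('a \<Rightarrow> real) \<Rightarrow> bool" where
  "obstacle_solution \<Omega> \<Gamma>D f chi u \<longleftrightarrow>
     is_arg_min (energy \<Omega> f) (\<lambda>v. v \<in> obstacle_set \<Omega> \<Gamma>D chi) u"

definition multiplier ::
  "'a::euclidean_space set \<Rightarrow> ('a \<Rightarrow> real) \<Rightarrow> ('a \<Rightarrow> real) \<Rightarrow> ('a \<Rightarrow> real) \<Rightarrow> real" where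
  "multiplier \<Omega> f u v =
     L2_inner (lebesgue_on \<Omega>) f v - L2_inner (lebesgue_on \<Omega>) (weak_grad \<Omega> u) (weak_grad \<Omega> v)"

section \<open>The discrete obstacle problem\<close>

definition CR_obstacle_set ::
  "'a::euclidean_space set \<Rightarrow> 'a set \<Rightarrow> 'a set set \<Rightarrow> ('a \<Rightarrow> real) \<Rightarrow> ('a \<Rightarrow> real) set" where
  "CR_obstacle_set \<Omega> \<Gamma>D \<T> chi_h =
     {v \<in> CR \<Omega> \<Gamma>D \<T>. (AE x in lebesgue_on \<Omega>. L2_proj \<Omega> \<T> v x \<ge> chi_h x)}"

definition CR_energy ::
  "'a::euclidean_space set \<Rightarrow> 'a set set \<Rightarrow> ('a \<Rightarrow> real) \<Rightarrow> ('a \<Rightarrow> real) \<Rightarrow> real" where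
  "CR_energy \<Omega> \<T> f v =
     1 / 2 * (L2_norm (lebesgue_on \<Omega>) (broken_grad \<T> v))\<^sup>2
       - L2_inner (lebesgue_on \<Omega>) (L2_proj \<Omega> \<T> f) (L2_proj \<Omega> \<T> v)"

definition CR_obstacle_solution ::
  "'a::euclidean_space set \<Rightarrow> 'a set \<Rightarrow> 'a set set \<Rightarrow> ('a \<Rightarrow> real) \<Rightarrow> ('a \<Rightarrow> real) \<Rightarrow>
     ('a \<Rightarrow> real) \<Rightarrow> bool" where
  "CR_obstacle_solution \<Omega> \<Gamma>D \<T> f chi_h u_h \<longleftrightarrow>
     is_arg_min (CR_energy \<Omega> \<T> f) (\<lambda>v. v \<in> CR_obstacle_set \<Omega> \<Gamma>D \<T> chi_h) u_h"

definition CR_multiplier ::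
  "'a::euclidean_space set \<Rightarrow> 'a set \<Rightarrow> 'a set set \<Rightarrow> ('a \<Rightarrow> real) \<Rightarrow> ('a \<Rightarrow> real) \<Rightarrow>
     ('a \<Rightarrow> real) \<Rightarrow> bool" where
  "CR_multiplier \<Omega> \<Gamma>D \<T> f u_h lambda_h \<longleftrightarrow>
     (\<exists>w\<in>CR \<Omega> \<Gamma>D \<T>. AE x in lebesgue_on \<Omega>. lambda_h x = L2_proj \<Omega> \<T> w x) \<and>
     (AE x in lebesgue_on \<Omega>. lambda_h x \<le> 0) \<and>
     (\<forall>v\<in>CR \<Omega> \<Gamma>D \<T>.
        L2_inner (lebesgue_on \<Omega>) lambda_h (L2_proj \<Omega> \<T> v) =
        L2_inner (lebesgue_on \<Omega>) (L2_proj \<Omega> \<T> f) (L2_proj \<Omega> \<T> v)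
          - L2_inner (lebesgue_on \<Omega>) (broken_grad \<T> u_h) (broken_grad \<T> v))"

definition CR_multiplier_functional ::
  "'a::euclidean_space set \<Rightarrow> 'a set set \<Rightarrow> ('a \<Rightarrow> real) \<Rightarrow> ('a \<Rightarrow> real) \<Rightarrow> real" where
  "CR_multiplier_functional \<Omega> \<T> lambda_h v = L2_inner (lebesgue_on \<Omega>) lambda_h (L2_proj \<Omega> \<T> v)"

section \<open>Estimator, oscillation and error measure\<close>

definition etaA_sq ::
  "'a::euclidean_space set \<Rightarrow> 'a set set \<Rightarrow> ('a \<Rightarrow> real) \<Rightarrow> ('a \<Rightarrow> real) \<Rightarrow> real" where
  "etaA_sq \<Omega> \<T> u_h v =
     (L2_norm (lebesgue_on \<Omega>) (\<lambda>x. weak_grad \<Omega> v x - broken_grad \<T> u_h x))\<^sup>2"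

definition etaB_sq ::
  "'a::euclidean_space set \<Rightarrow> 'a set set \<Rightarrow> ('a \<Rightarrow> real) \<Rightarrow> ('a \<Rightarrow> real) \<Rightarrow> ('a \<Rightarrow> real) \<Rightarrow> real"
  where
  "etaB_sq \<Omega> \<T> chi lambda_h v =
     L2_inner (lebesgue_on \<Omega>) (\<lambda>x. - lambda_h x) (L2_proj \<Omega> \<T> (\<lambda>x. v x - chi x))"

definition etaC_sq ::
  "'a::euclidean_space set \<Rightarrow> 'a set set \<Rightarrow> ('a \<Rightarrow> real) \<Rightarrow> ('a \<Rightarrow> real) \<Rightarrow> real" where
  "etaC_sq \<Omega> \<T> f lambda_h =
     1 / (real DIM('a))\<^sup>2 *
     (L2_norm (lebesgue_on \<Omega>) (\<lambda>x. meshsize \<T> x * (L2_proj \<Omega> \<T> f x - lambda_h x)))\<^sup>2"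

definition eta_sq ::
  "'a::euclidean_space set \<Rightarrow> 'a set set \<Rightarrow> ('a \<Rightarrow> real) \<Rightarrow> ('a \<Rightarrow> real) \<Rightarrow> ('a \<Rightarrow> real) \<Rightarrow>
     ('a \<Rightarrow> real) \<Rightarrow> ('a \<Rightarrow> real) \<Rightarrow> real" where
  "eta_sq \<Omega> \<T> f chi u_h lambda_h v = etaA_sq \<Omega> \<T> u_h v + etaB_sq \<Omega> \<T> chi lambda_h v + etaC_sq \<Omega> \<T> f lambda_h"

definition osc_sq :: "'a::euclidean_space set \<Rightarrow> 'a set set \<Rightarrow> ('a \<Rightarrow> real) \<Rightarrow> real" where
  "osc_sq \<Omega> \<T> f =
     (L2_norm (lebesgue_on \<Omega>) (\<lambda>x. meshsize \<T> x * (L2_proj \<Omega> \<T> f x - f x)))\<^sup>2"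

definition rho_sq ::
  "'a::euclidean_space set \<Rightarrow> 'a set \<Rightarrow> 'a set set \<Rightarrow> ('a \<Rightarrow> real) \<Rightarrow> ('a \<Rightarrow> real) \<Rightarrow> ('a \<Rightarrow> real) \<Rightarrow>
     ('a \<Rightarrow> real) \<Rightarrow> ('a \<Rightarrow> real) \<Rightarrow> ('a \<Rightarrow> real) \<Rightarrow> real" where
  "rho_sq \<Omega> \<Gamma>D \<T> f chi u u_h lambda_h v =
     1 / 2 * (L2_norm (lebesgue_on \<Omega>) (\<lambda>x. weak_grad \<Omega> v x - weak_grad \<Omega> u x))\<^sup>2
     + (- multiplier \<Omega> f u (\<lambda>x. v x - u x))
     + (L2_norm (lebesgue_on \<Omega>) (\<lambda>x. weak_grad \<Omega> u x - broken_grad \<T> u_h x))\<^sup>2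
     + L2_inner (lebesgue_on \<Omega>) (\<lambda>x. - lambda_h x) (L2_proj \<Omega> \<T> (\<lambda>x. u x - chi x))
     + (dual_norm \<Omega> \<Gamma>D (\<lambda>w. CR_multiplier_functional \<Omega> \<T> lambda_h w - multiplier \<Omega> f u w))\<^sup>2"

end

theory Submission
  imports Defs
begin

text \<open>
  The estimator controls the error because the discrete gradient can be corrected, element by
  element, to an equilibrated flux. Let \<open>c = f\<^sub>h - \<lambda>\<^sub>h\<close>, which is constant on each element, let
  \<open>x\<^sub>T\<close> be the centroid of the element \<open>T\<close>, and let \<open>z = \<nabla>\<^sub>h u\<^sub>h - (c / d) (x - x\<^sub>T)\<close>. Then
  \<open>(z, \<nabla>w) = (c, w)\<close> for all \<open>w \<in> H\<^sup>1\<^sub>D\<close> (\<open>flux_identity\<close>), and the correction is bounded by a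
  multiple of the element residual in the estimator. For \<open>e = v - u\<close> this yields
  \<open>\<bar>\<nabla>e\<bar>\<^sup>2 / 2 - \<langle>\<Lambda>, e\<rangle> + (-\<lambda>\<^sub>h, u - \<chi>) = - \<bar>\<nabla>e\<bar>\<^sup>2 / 2 + (\<nabla>v - z, \<nabla>e) + (f\<^sub>h - f, e) + (-\<lambda>\<^sub>h, v - \<chi>)\<close>.
  The first two terms on the left are the difference of the energies of \<open>v\<close> and \<open>u\<close>, hence
  nonnegative, and so is the third by the signs of \<open>\<lambda>\<^sub>h\<close> and \<open>u - \<chi>\<close>. As \<open>f\<^sub>h - f\<close> has mean zero on
  each element, a Poincare inequality bounds \<open>(f\<^sub>h - f, e)\<close> by the oscillation times \<open>\<bar>\<nabla>e\<bar>\<close>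
  (\<open>oscillation_pairing\<close>). So the energy difference, the complementarity term and \<open>\<bar>\<nabla>e\<bar>\<close> are
  controlled; the remaining two terms of the error follow from the triangle inequality and, for the
  dual norm, from testing the difference of the multipliers with \<open>w\<close> and using the flux identity once
  more (\<open>reliability_estimate\<close>).

  The flux identity is the discrete equation tested with the Crouzeix--Raviart interpolant of \<open>w\<close>,
  whose gradient is the elementwise mean of \<open>\<nabla>w\<close> and whose values at the barycenters of the sides are
  the side means of \<open>w\<close>. Traces enter only here. The side mean over the facet opposite to the vertex
  \<open>p\<close> of \<open>T\<close> is written as the volume mean of \<open>w + (1 / d) (x - p) \<bullet> \<nabla>w\<close>, which makes sense for
  Sobolev functions and turns the required properties of the interpolant on one element into linear
  algebra. Two facts remain, and both are proved for smooth functions and passed to the limit: a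
  common side has the same mean from both of its elements (\<open>side_mean_shared\<close>), and the mean vanishes
  on Dirichlet sides (\<open>side_mean_Dirichlet\<close>). For smooth \<open>\<phi>\<close> the volume mean equals the mean of
  \<open>\<phi> (proj x)\<close>, where \<open>proj\<close> is the radial projection from \<open>p\<close> onto the facet
  (\<open>radial_trace_formula\<close>). The first fact follows because an affine map that fixes the side carries
  one simplex to the other, and the second because the cone over a set of diameter \<open>r\<close> has volume
  \<open>O(r\<^sup>d\<^sup>-\<^sup>1)\<close>, so that the mean is dominated by an integral with respect to Hausdorff measure.
\<close>

section \<open>Square-integrable functions\<close>

lemma L2_I:
  "f \<in> borel_measurable M \<Longrightarrow> integrable M (\<lambda>x. (norm (f x))\<^sup>2) \<Longrightarrow> f \<in> L2 M"
  by (simp add: L2_def)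

lemma L2_D:
  assumes "f \<in> L2 M"
  shows "f \<in> borel_measurable M" "integrable M (\<lambda>x. (norm (f x))\<^sup>2)"
  using assms by (auto simp: L2_def)

lemma norm_add_square: "(norm (a + b))\<^sup>2 = (norm a)\<^sup>2 + 2 * (a \<bullet> b) + (norm (b::'b::real_inner))\<^sup>2"
  using dot_norm[of a b] by simp

lemma abs_inner_le_sum_squares: "\<bar>a \<bullet> b\<bar> \<le> (norm a)\<^sup>2 + (norm (b::'b::real_inner))\<^sup>2"
proof -
  have "\<bar>a \<bullet> b\<bar> \<le> norm a * norm b" by (rule Cauchy_Schwarz_ineq2)
  also have "\<dots> \<le> (norm a)\<^sup>2 + (norm b)\<^sup>2"
    using sum_squares_bound[of "norm a" "norm b"] mult_nonneg_nonneg[OF norm_ge_zero norm_ge_zero, of a b]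
    by linarith
  finally show ?thesis .
qed

lemma L2_integrable_inner:
  assumes f: "f \<in> L2 M" and g: "g \<in> L2 M"
  shows "integrable M (\<lambda>x. f x \<bullet> g x)"
proof (rule Bochner_Integration.integrable_bound)
  show "integrable M (\<lambda>x. (norm (f x))\<^sup>2 + (norm (g x))\<^sup>2)"
    using L2_D[OF f] L2_D[OF g] by simp
  show "(\<lambda>x. f x \<bullet> g x) \<in> borel_measurable M"
    using L2_D(1)[OF f] L2_D(1)[OF g] by simp
qed (use abs_inner_le_sum_squares in \<open>auto intro!: always_eventually\<close>)

lemma L2_integrable_mult:
  fixes f g :: "'a \<Rightarrow> real"
  assumes "f \<in> L2 M" "g \<in> L2 M"
  shows "integrable M (\<lambda>x. f x * g x)"
  using L2_integrable_inner[OF assms] by simp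

lemma L2_scaleR:
  assumes f: "f \<in> L2 M"
  shows "(\<lambda>x. c *\<^sub>R f x) \<in> L2 M"
  using L2_D[OF f] by (auto intro!: L2_I simp: power_mult_distrib)

lemma L2_add:
  assumes f: "f \<in> L2 M" and g: "g \<in> L2 M"
  shows "(\<lambda>x. f x + g x) \<in> L2 M"
proof (rule L2_I)
  show "(\<lambda>x. f x + g x) \<in> borel_measurable M"
    using L2_D(1)[OF f] L2_D(1)[OF g] by simp
  have "integrable M (\<lambda>x. (norm (f x))\<^sup>2 + 2 * (f x \<bullet> g x) + (norm (g x))\<^sup>2)"
    using L2_D(2)[OF f] L2_D(2)[OF g] L2_integrable_inner[OF f g] by simp
  then show "integrable M (\<lambda>x. (norm (f x + g x))\<^sup>2)"
    by (simp add: norm_add_square)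
qed

lemma L2_diff:
  assumes f: "f \<in> L2 M" and g: "g \<in> L2 M"
  shows "(\<lambda>x. f x - g x) \<in> L2 M"
  using L2_add[OF f L2_scaleR[OF g, of "-1"]] by simp

lemma L2_bounded_mult:
  fixes f :: "'a \<Rightarrow> 'b::euclidean_space" and k :: "'a \<Rightarrow> real"
  assumes f: "f \<in> L2 M" and k: "k \<in> borel_measurable M" and b: "AE x in M. \<bar>k x\<bar> \<le> B"
  shows "(\<lambda>x. k x *\<^sub>R f x) \<in> L2 M"
proof (rule L2_I)
  show "(\<lambda>x. k x *\<^sub>R f x) \<in> borel_measurable M"
    using L2_D(1)[OF f] k by simp
  show "integrable M (\<lambda>x. (norm (k x *\<^sub>R f x))\<^sup>2)"
  proof (rule Bochner_Integration.integrable_bound)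
    show "integrable M (\<lambda>x. B\<^sup>2 * (norm (f x))\<^sup>2)"
      using L2_D[OF f] by simp
    show "(\<lambda>x. (norm (k x *\<^sub>R f x))\<^sup>2) \<in> borel_measurable M"
      using L2_D(1)[OF f] k by simp
    show "AE x in M. norm ((norm (k x *\<^sub>R f x))\<^sup>2) \<le> norm (B\<^sup>2 * (norm (f x))\<^sup>2)"
      using b
    proof eventually_elim
      case (elim x)
      then have "(\<bar>k x\<bar>)\<^sup>2 \<le> B\<^sup>2" by (intro power_mono) auto
      then show ?case by (simp add: power_mult_distrib mult_right_mono)
    qed
  qed
qed

lemma L2_norm_nonneg [simp]: "0 \<le> L2_norm M f"
  by (simp add: L2_norm_def L2_inner_def)

lemma L2_norm_sq: "(L2_norm M f)\<^sup>2 = (\<integral>x. (norm (f x))\<^sup>2 \<partial>M)"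
  by (simp add: L2_norm_def L2_inner_def power2_norm_eq_inner)

lemma L2_inner_self: "L2_inner M f f = (L2_norm M f)\<^sup>2"
  by (simp add: L2_norm_def L2_inner_def)

lemma L2_inner_commute: "L2_inner M f g = L2_inner M g f"
  by (simp add: L2_inner_def inner_commute)

lemma L2_inner_diff_left:
  assumes "f \<in> L2 M" "f' \<in> L2 M" "g \<in> L2 M"
  shows "L2_inner M (\<lambda>x. f x - f' x) g = L2_inner M f g - L2_inner M f' g"
  unfolding L2_inner_def inner_diff_left
  using assms by (intro Bochner_Integration.integral_diff L2_integrable_inner)

lemma L2_inner_diff_right:
  assumes "f \<in> L2 M" "g \<in> L2 M" "g' \<in> L2 M"
  shows "L2_inner M f (\<lambda>x. g x - g' x) = L2_inner M f g - L2_inner M f g'"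
  using L2_inner_diff_left[OF assms(2,3,1)] by (simp add: L2_inner_commute)

lemma L2_inner_AE_cong:
  assumes "f \<in> borel_measurable M" "g \<in> borel_measurable M"
    "f' \<in> borel_measurable M" "g' \<in> borel_measurable M"
    "AE x in M. f x = f' x" "AE x in M. g x = g' x"
  shows "L2_inner M f g = L2_inner M f' g'"
  unfolding L2_inner_def
  by (rule integral_cong_AE) (use assms in \<open>auto elim!: eventually_elim2\<close>)

lemma L2_norm_AE_cong:
  assumes "f \<in> borel_measurable M" "f' \<in> borel_measurable M" "AE x in M. f x = f' x"
  shows "L2_norm M f = L2_norm M f'"
  unfolding L2_norm_def using L2_inner_AE_cong[OF assms(1,1,2,2,3,3)] by simp

lemma L2_AE_cong:
  assumes "f \<in> L2 M" "f' \<in> borel_measurable M" "AE x in M. f x = f' x"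
  shows "f' \<in> L2 M"
proof (rule L2_I)
  have "integrable M (\<lambda>x. (norm (f x))\<^sup>2) \<longleftrightarrow> integrable M (\<lambda>x. (norm (f' x))\<^sup>2)"
    by (rule integrable_cong_AE) (use assms L2_D(1)[OF assms(1)] in \<open>auto elim!: eventually_mono\<close>)
  then show "integrable M (\<lambda>x. (norm (f' x))\<^sup>2)" using L2_D(2)[OF assms(1)] by simp
qed (use assms in auto)

text \<open>The quadratic form \<open>(s, t) \<mapsto> \<parallel>s f + t g\<parallel>\<^sup>2\<close> is nonnegative, which bounds its mixed coefficient.\<close>

lemma L2_Cauchy_Schwarz:
  assumes f: "f \<in> L2 M" and g: "g \<in> L2 M"
  shows "\<bar>L2_inner M f g\<bar> \<le> L2_norm M f * L2_norm M g"
proof -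
  let ?A = "L2_norm M f" and ?B = "L2_norm M g" and ?I = "L2_inner M f g"
  have nonneg: "0 \<le> s\<^sup>2 * ?A\<^sup>2 + 2 * s * t * ?I + t\<^sup>2 * ?B\<^sup>2" for s t :: real
  proof -
    have "0 \<le> (\<integral>x. (norm (s *\<^sub>R f x + t *\<^sub>R g x))\<^sup>2 \<partial>M)" by simp
    also have "\<dots> = (\<integral>x. s\<^sup>2 * (norm (f x))\<^sup>2 + (2 * s * t) * (f x \<bullet> g x) + t\<^sup>2 * (norm (g x))\<^sup>2 \<partial>M)"
      by (intro Bochner_Integration.integral_cong refl)
        (simp add: norm_add_square power_mult_distrib)
    also have "\<dots> = s\<^sup>2 * ?A\<^sup>2 + 2 * s * t * ?I + t\<^sup>2 * ?B\<^sup>2"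
      using L2_D(2)[OF f] L2_D(2)[OF g] L2_integrable_inner[OF f g]
      by (simp add: L2_norm_sq L2_inner_def)
    finally show ?thesis .
  qed
  have "?I\<^sup>2 \<le> (?A * ?B)\<^sup>2"
  proof (cases "?B = 0")
    case True
    have "?I = 0"
    proof (rule ccontr)
      assume "?I \<noteq> 0"
      then have "?I\<^sup>2 > 0" by simp
      define t where "t = - (?A\<^sup>2 + 1) / (2 * ?I)"
      have "0 \<le> ?A\<^sup>2 + 2 * t * ?I" using nonneg[of 1 t] True by simp
      also have "\<dots> = -1" using \<open>?I \<noteq> 0\<close> by (simp add: t_def field_simps)
      finally show False by simp
    qed
    then show ?thesis by simp
  next
    case False
    then have B: "?B\<^sup>2 > 0" by simp
    have "0 \<le> (?B\<^sup>2)\<^sup>2 * ?A\<^sup>2 + 2 * ?B\<^sup>2 * (- ?I) * ?I + (- ?I)\<^sup>2 * ?B\<^sup>2" by (rule nonneg)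
    also have "\<dots> = ?B\<^sup>2 * (?B\<^sup>2 * ?A\<^sup>2 - ?I\<^sup>2)" by (simp add: power2_eq_square algebra_simps)
    finally show ?thesis using B by (simp add: zero_le_mult_iff power_mult_distrib mult.commute)
  qed
  then have "\<bar>?I\<bar> \<le> \<bar>?A * ?B\<bar>" by (simp only: abs_le_square_iff)
  then show ?thesis by (simp add: abs_mult)
qed

lemma L2_norm_triangle:
  assumes f: "f \<in> L2 M" and g: "g \<in> L2 M"
  shows "L2_norm M (\<lambda>x. f x + g x) \<le> L2_norm M f + L2_norm M g"
proof (rule power2_le_imp_le)
  have "(L2_norm M (\<lambda>x. f x + g x))\<^sup>2 =
     (\<integral>x. (norm (f x))\<^sup>2 + 2 * (f x \<bullet> g x) + (norm (g x))\<^sup>2 \<partial>M)"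
    unfolding L2_norm_sq
    by (intro Bochner_Integration.integral_cong refl)
      (simp add: norm_add_square)
  also have "\<dots> = (L2_norm M f)\<^sup>2 + 2 * L2_inner M f g + (L2_norm M g)\<^sup>2"
    using L2_D(2)[OF f] L2_D(2)[OF g] L2_integrable_inner[OF f g]
    by (simp add: L2_norm_sq L2_inner_def)
  also have "\<dots> \<le> (L2_norm M f + L2_norm M g)\<^sup>2"
    using L2_Cauchy_Schwarz[OF f g] by (simp add: power2_sum)
  finally show "(L2_norm M (\<lambda>x. f x + g x))\<^sup>2 \<le> (L2_norm M f + L2_norm M g)\<^sup>2" .
qed simp

lemma L2_norm_scaleR: "L2_norm M (\<lambda>x. c *\<^sub>R f x) = \<bar>c\<bar> * L2_norm M f"
proof -
  have "(L2_norm M (\<lambda>x. c *\<^sub>R f x))\<^sup>2 = (\<bar>c\<bar> * L2_norm M f)\<^sup>2"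
    by (simp add: L2_norm_sq power_mult_distrib)
  then show ?thesis by (simp add: power2_eq_iff_nonneg)
qed

lemma L2_norm_triangle_diff:
  assumes f: "f \<in> L2 M" and g: "g \<in> L2 M"
  shows "L2_norm M (\<lambda>x. f x - g x) \<le> L2_norm M f + L2_norm M g"
  using L2_norm_triangle[OF f L2_scaleR[OF g, of "-1"]] L2_norm_scaleR[of M "-1" g] by simp

lemma L2_norm_mono:
  assumes f: "f \<in> L2 M" and g: "g \<in> L2 M" and le: "AE x in M. norm (f x) \<le> norm (g x)"
  shows "L2_norm M f \<le> L2_norm M g"
proof (rule power2_le_imp_le)
  show "(L2_norm M f)\<^sup>2 \<le> (L2_norm M g)\<^sup>2"
    unfolding L2_norm_sq
    by (rule integral_mono_AE) (use le L2_D[OF f] L2_D[OF g] in \<open>auto elim!: eventually_mono intro: power_mono\<close>)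
qed simp

lemma finite_measure_L2_integrable:
  assumes "finite_measure M" "f \<in> L2 M"
  shows "integrable M f"
proof (rule Bochner_Integration.integrable_bound)
  interpret finite_measure M by fact
  show "integrable M (\<lambda>x. 1 + (norm (f x))\<^sup>2)" using L2_D[OF assms(2)] by simp
  have "norm (f x) \<le> 1 + (norm (f x))\<^sup>2" for x
    using sum_squares_bound[of 1 "norm (f x)"] norm_ge_zero[of "f x"] by (simp del: norm_ge_zero)
  then show "AE x in M. norm (f x) \<le> norm (1 + (norm (f x))\<^sup>2)" by simp
qed (rule L2_D(1)[OF assms(2)])

lemma finite_measure_bounded_L2:
  fixes f :: "'a \<Rightarrow> 'b::euclidean_space"
  assumes "finite_measure M" "f \<in> borel_measurable M" "AE x in M. norm (f x) \<le> B"
  shows "f \<in> L2 M"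
proof (rule L2_I)
  interpret finite_measure M by fact
  show "integrable M (\<lambda>x. (norm (f x))\<^sup>2)"
  proof (rule integrable_const_bound[where B="B\<^sup>2"])
    show "AE x in M. norm ((norm (f x))\<^sup>2) \<le> B\<^sup>2"
      using assms(3) by eventually_elim (auto intro: power_mono)
  qed (use assms in simp)
qed (use assms in simp)

lemma L2_tendsto_inner:
  assumes F: "L2_tendsto M F f" and f: "f \<in> L2 M" and g: "g \<in> L2 M"
  shows "(\<lambda>n. L2_inner M (F n) g) \<longlonglongrightarrow> L2_inner M f g"
proof -
  have d: "(\<lambda>x. F n x - f x) \<in> L2 M" for n using F by (simp add: L2_tendsto_def)
  have "(\<lambda>n. L2_norm M (\<lambda>x. F n x - f x) * L2_norm M g) \<longlonglongrightarrow> 0"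
    using F by (intro tendsto_mult_left_zero) (simp add: L2_tendsto_def)
  then have "(\<lambda>n. L2_inner M (\<lambda>x. F n x - f x) g) \<longlonglongrightarrow> 0"
    by (rule Lim_null_comparison[rotated])
      (use L2_Cauchy_Schwarz[OF d g] in auto)
  moreover have "L2_inner M (\<lambda>x. F n x - f x) g = L2_inner M (F n) g - L2_inner M f g" for n
    using L2_inner_diff_left[OF L2_add[OF d f] f g, of n] by simp
  ultimately show ?thesis by (simp add: LIM_zero_iff)
qed

lemma L2_tendsto_norm:
  assumes F: "L2_tendsto M F f" and f: "f \<in> L2 M"
  shows "(\<lambda>n. L2_norm M (F n)) \<longlonglongrightarrow> L2_norm M f"
proof -
  have d: "(\<lambda>x. F n x - f x) \<in> L2 M" for n using F by (simp add: L2_tendsto_def)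
  have Fn: "F n \<in> L2 M" for n using L2_add[OF d f, of n] by simp
  have "\<bar>L2_norm M (F n) - L2_norm M f\<bar> \<le> L2_norm M (\<lambda>x. F n x - f x)" for n
    using L2_norm_triangle[OF d f, of n] L2_norm_triangle_diff[OF Fn d, of n n] by simp
  moreover have "(\<lambda>n. L2_norm M (\<lambda>x. F n x - f x)) \<longlonglongrightarrow> 0" using F by (simp add: L2_tendsto_def)
  ultimately have "(\<lambda>n. L2_norm M (F n) - L2_norm M f) \<longlonglongrightarrow> 0"
    by (intro Lim_null_comparison[where f="\<lambda>n. L2_norm M (F n) - L2_norm M f"]) auto
  then show ?thesis by (simp add: LIM_zero_iff)
qed

lemma L2_tendsto_diff:
  assumes F: "L2_tendsto M F f" and G: "L2_tendsto M G g"
  shows "L2_tendsto M (\<lambda>n x. F n x - G n x) (\<lambda>x. f x - g x)"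
proof -
  have f: "(\<lambda>x. F n x - f x) \<in> L2 M" and g: "(\<lambda>x. G n x - g x) \<in> L2 M" for n
    using F G by (auto simp: L2_tendsto_def)
  have eq: "(\<lambda>x. (F n x - G n x) - (f x - g x)) = (\<lambda>x. (F n x - f x) - (G n x - g x))" for n
    by (auto simp: fun_eq_iff)
  have "(\<lambda>n. L2_norm M (\<lambda>x. F n x - f x) + L2_norm M (\<lambda>x. G n x - g x)) \<longlonglongrightarrow> 0"
    using F G by (intro tendsto_add_zero) (auto simp: L2_tendsto_def)
  then have "(\<lambda>n. L2_norm M (\<lambda>x. (F n x - f x) - (G n x - g x))) \<longlonglongrightarrow> 0"
    by (rule Lim_null_comparison[rotated])
       (use L2_norm_triangle_diff[OF f g] in auto)
  then show ?thesis unfolding L2_tendsto_def eq using L2_diff[OF f g] by simp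
qed

lemma L2_tendsto_AE_cong:
  assumes F: "L2_tendsto M F f" and m: "f \<in> borel_measurable M" "f' \<in> borel_measurable M" "\<And>n. F n \<in> borel_measurable M"
    and ae: "AE x in M. f x = f' x"
  shows "L2_tendsto M F f'"
proof -
  have d: "(\<lambda>x. F n x - f x) \<in> L2 M" for n using F by (simp add: L2_tendsto_def)
  have e: "AE x in M. F n x - f x = F n x - f' x" for n using ae by eventually_elim simp
  have "(\<lambda>x. F n x - f' x) \<in> L2 M" for n
    by (rule L2_AE_cong[OF d _ e]) (use m in simp)
  moreover have "L2_norm M (\<lambda>x. F n x - f' x) = L2_norm M (\<lambda>x. F n x - f x)" for n
    by (rule L2_norm_AE_cong[symmetric]) (use m e in auto)
  ultimately show ?thesis using F by (simp add: L2_tendsto_def)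
qed

section \<open>Smooth functions and test functions\<close>

lemma gradient_inner:
  fixes \<phi> :: "'a::euclidean_space \<Rightarrow> real"
  assumes "\<phi> differentiable at x"
  shows "gradient \<phi> x \<bullet> h = frechet_derivative \<phi> (at x) h"
proof -
  interpret linear "frechet_derivative \<phi> (at x)"
    using assms by (rule linear_frechet_derivative)
  have "frechet_derivative \<phi> (at x) h = frechet_derivative \<phi> (at x) (\<Sum>b\<in>Basis. (h \<bullet> b) *\<^sub>R b)"
    by (simp add: euclidean_representation)
  also have "\<dots> = (\<Sum>b\<in>Basis. (h \<bullet> b) * frechet_derivative \<phi> (at x) b)"
    by (simp add: sum scaleR)
  also have "\<dots> = gradient \<phi> x \<bullet> h"
    by (simp add: gradient_def inner_sum_left inner_sum_right inner_commute mult.commute)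
  finally show ?thesis by simp
qed

lemma has_derivative_gradient:
  fixes \<phi> :: "'a::euclidean_space \<Rightarrow> real"
  assumes "\<phi> differentiable at x"
  shows "(\<phi> has_derivative (\<lambda>h. gradient \<phi> x \<bullet> h)) (at x)"
  using assms by (simp add: gradient_inner frechet_derivative_works[symmetric])

lemma gradient_eqI:
  fixes \<phi> :: "'a::euclidean_space \<Rightarrow> real"
  assumes "(\<phi> has_derivative (\<lambda>h. g \<bullet> h)) (at x)"
  shows "gradient \<phi> x = g"
proof -
  have "gradient \<phi> x \<bullet> h = g \<bullet> h" for h
    using gradient_inner[of \<phi> x h] frechet_derivative_at[OF assms] assms
    by (metis differentiable_def)
  then show ?thesis by (metis euclidean_eqI)
qed

lemma Ck_Suc_imp_Ck: "Ck (Suc k) \<phi> \<Longrightarrow> Ck k \<phi>"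
proof (induction k arbitrary: \<phi>)
  case 0
  then show ?case
    by (auto intro!: continuous_at_imp_continuous_on differentiable_imp_continuous_within)
qed auto

lemma Ck_const: "Ck k (\<lambda>x::'a::euclidean_space. c)"
proof (induction k arbitrary: c)
  case (Suc k)
  have "gradient (\<lambda>x::'a. c) x = 0" for x
    by (rule gradient_eqI) simp
  then show ?case using Suc by simp
qed simp

lemma Ck_add: "Ck k \<phi> \<Longrightarrow> Ck k \<psi> \<Longrightarrow> Ck k (\<lambda>x. \<phi> x + \<psi> x)"
proof (induction k arbitrary: \<phi> \<psi>)
  case (Suc k)
  then have d: "\<phi> differentiable at x" "\<psi> differentiable at x" for x by auto
  have "gradient (\<lambda>x. \<phi> x + \<psi> x) x = gradient \<phi> x + gradient \<psi> x" for x
    by (rule gradient_eqI)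
      (use has_derivative_add[OF d[THEN has_derivative_gradient]] in \<open>simp add: inner_add_left\<close>)
  then show ?case using Suc by (auto simp: inner_add_left)
qed (auto intro: continuous_on_add)

lemma Ck_mult: "Ck k \<phi> \<Longrightarrow> Ck k \<psi> \<Longrightarrow> Ck k (\<lambda>x. \<phi> x * \<psi> x)"
proof (induction k arbitrary: \<phi> \<psi>)
  case (Suc k)
  then have d: "\<phi> differentiable at x" "\<psi> differentiable at x" for x by auto
  have "gradient (\<lambda>x. \<phi> x * \<psi> x) x = \<phi> x *\<^sub>R gradient \<psi> x + \<psi> x *\<^sub>R gradient \<phi> x" for x
    by (rule gradient_eqI)
      (use has_derivative_mult[OF d[THEN has_derivative_gradient]] in
        \<open>simp add: inner_add_left mult.commute\<close>)
  moreover have "Ck k \<phi>" "Ck k \<psi>" using Suc.prems by (auto simp del: Ck.simps dest: Ck_Suc_imp_Ck)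
  ultimately show ?case using Suc by (auto simp: inner_add_left intro!: Ck_add differentiable_mult)
qed (auto intro: continuous_on_mult)

lemma Ck_cmult: "Ck k \<phi> \<Longrightarrow> Ck k (\<lambda>x. c * \<phi> x)"
  by (rule Ck_mult[OF Ck_const])

lemma Ck_prod: "(\<And>i. i \<in> I \<Longrightarrow> Ck k (\<phi> i)) \<Longrightarrow> Ck k (\<lambda>x. \<Prod>i\<in>I. \<phi> i x)"
  by (induction I rule: infinite_finite_induct) (auto intro: Ck_const Ck_mult)

lemma smooth_Ck: "smooth \<phi> \<Longrightarrow> Ck k \<phi>"
  by (simp add: smooth_def)

lemma smooth_differentiable: "smooth \<phi> \<Longrightarrow> \<phi> differentiable at x"
  using smooth_Ck[of \<phi> "Suc 0"] by simp

lemma smooth_has_derivative: "smooth \<phi> \<Longrightarrow> (\<phi> has_derivative (\<lambda>h. gradient \<phi> x \<bullet> h)) (at x)"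
  by (rule has_derivative_gradient[OF smooth_differentiable])

lemma smooth_continuous: "smooth \<phi> \<Longrightarrow> continuous_on A \<phi>"
  using smooth_Ck[of \<phi> 0] by (auto intro: continuous_on_subset)

lemma smooth_continuous_gradient:
  assumes "smooth \<phi>"
  shows "continuous_on A (gradient \<phi>)"
proof -
  have "continuous_on A (\<lambda>x. gradient \<phi> x \<bullet> b)" if "b \<in> Basis" for b
    by (rule continuous_on_subset[OF _ subset_UNIV])
      (use smooth_Ck[OF assms, of "Suc 0"] that in simp)
  then have "continuous_on A (\<lambda>x. \<Sum>b\<in>Basis. (gradient \<phi> x \<bullet> b) *\<^sub>R b)"
    by (intro continuous_on_sum continuous_on_scaleR continuous_on_const)
  then show ?thesis by (simp add: euclidean_representation)
qed

lemma gradient_diff: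
  assumes "smooth \<phi>" "smooth \<psi>"
  shows "gradient (\<lambda>x. \<phi> x - \<psi> x) x = gradient \<phi> x - gradient \<psi> x"
  by (rule gradient_eqI)
    (use has_derivative_diff[OF assms[THEN smooth_has_derivative]] in \<open>simp add: inner_diff_left\<close>)

lemma smooth_diff:
  assumes "smooth \<phi>" "smooth \<psi>"
  shows "smooth (\<lambda>x. \<phi> x - \<psi> x)"
proof -
  have "Ck k (\<lambda>x. \<phi> x + (-1) * \<psi> x)" for k
    using assms by (intro Ck_add Ck_cmult smooth_Ck)
  then show ?thesis by (simp add: smooth_def)
qed

text \<open>The functions \<open>t\<^sup>-\<^sup>m exp (- 1 / t)\<close> on the positive half-line, extended by zero: their span is
  closed under differentiation, which makes each of them smooth.\<close>

definition flat :: "nat \<Rightarrow> real \<Rightarrow> real" where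
  "flat m t = (if t > 0 then exp (- (1 / t)) / t ^ m else 0)"

lemma flat_tendsto_0: "(flat m \<longlongrightarrow> 0) (at 0)"
proof -
  have "((\<lambda>t. (inverse t) ^ m / exp (inverse t)) \<longlongrightarrow> (0::real)) (at_right 0)"
    by (rule filterlim_compose[OF tendsto_power_div_exp_0 filterlim_inverse_at_top_right])
  then have "(flat m \<longlongrightarrow> 0) (at_right 0)"
    by (rule Lim_transform_eventually)
      (auto simp: eventually_at_filter flat_def field_simps exp_minus)
  moreover have "(flat m \<longlongrightarrow> 0) (at_left 0)"
    by (rule Lim_transform_eventually[OF tendsto_const]) (auto simp: eventually_at_filter flat_def)
  ultimately show ?thesis by (simp add: filterlim_split_at)
qed

lemma flat_has_derivative:
  "(flat m has_real_derivative (flat (m + 2) t - real m * flat (m + 1) t)) (at t)"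
proof -
  consider "t > 0" | "t < 0" | "t = 0" by linarith
  then show ?thesis
  proof cases
    case 1
    have "((\<lambda>t. exp (- (1 / t)) / t ^ m) has_real_derivative (flat (m + 2) t - real m * flat (m + 1) t)) (at t)"
    proof (cases m)
      case 0
      then show ?thesis using 1
        by (auto intro!: derivative_eq_intros simp: flat_def power2_eq_square field_simps)
    next
      case (Suc k)
      have "((\<lambda>t. exp (- (1 / t)) / t ^ m) has_real_derivative
          ((exp (- (1 / t)) * (1 / t\<^sup>2)) * t ^ m - exp (- (1 / t)) * (real m * t ^ (m - 1))) / (t ^ m * t ^ m)) (at t)"
        using 1 by (auto intro!: derivative_eq_intros simp: power2_eq_square)
      then show ?thesis
        by (rule back_subst[of "\<lambda>d. (_ has_real_derivative d) _"])
          (use 1 Suc in \<open>simp add: flat_def power2_eq_square divide_simps, simp add: algebra_simps\<close>)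
    qed
    then show ?thesis
      by (rule DERIV_cong_ev[THEN iffD1, OF refl _ refl, rotated])
        (use 1 in \<open>auto simp: flat_def eventually_nhds intro!: exI[of _ "{0<..}"]\<close>)
  next
    case 2
    have "((\<lambda>t. 0) has_real_derivative (flat (m + 2) t - real m * flat (m + 1) t)) (at t)"
      using 2 by (simp add: flat_def)
    then show ?thesis
      by (rule DERIV_cong_ev[THEN iffD1, OF refl _ refl, rotated])
        (use 2 in \<open>auto simp: flat_def eventually_nhds intro!: exI[of _ "{..<0}"]\<close>)
  next
    case 3
    have "((\<lambda>h. (flat m (0 + h) - flat m 0) / h) \<longlongrightarrow> 0) (at 0)"
      by (rule Lim_transform_eventually[OF flat_tendsto_0[of "m + 1"]])
        (auto simp: eventually_at_filter flat_def)
    then show ?thesis using 3 by (simp add: DERIV_def flat_def)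
  qed
qed

lemma Ck_flat:
  fixes i :: "'a::euclidean_space"
  shows "Ck k (\<lambda>x. flat m (\<alpha> * (x \<bullet> i) + \<beta>))"
proof (induction k arbitrary: m)
  case 0
  have "isCont (flat m) t" for t by (rule DERIV_isCont[OF flat_has_derivative])
  then have "continuous_on UNIV (flat m)" by (simp add: continuous_at_imp_continuous_on)
  then have "continuous_on UNIV (\<lambda>x::'a. flat m (\<alpha> * (x \<bullet> i) + \<beta>))"
    by (rule continuous_on_compose2) (auto intro!: continuous_intros)
  then show ?case by simp
next
  case (Suc k)
  let ?s = "\<lambda>x::'a. \<alpha> * (x \<bullet> i) + \<beta>"
  let ?d = "\<lambda>x::'a. flat (m + 2) (?s x) - real m * flat (m + 1) (?s x)"
  have D: "((\<lambda>x. flat m (?s x)) has_derivative (\<lambda>h. ((\<alpha> * ?d x) *\<^sub>R i) \<bullet> h)) (at x)" for x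
  proof -
    have 1: "(?s has_derivative (\<lambda>h. \<alpha> * (h \<bullet> i))) (at x)"
      by (auto intro!: derivative_eq_intros)
    have "((\<lambda>x. flat m (?s x)) has_derivative (\<lambda>h. (?d x) * (\<alpha> * (h \<bullet> i)))) (at x)"
      by (rule has_derivative_compose[OF 1 flat_has_derivative[of m "?s x", unfolded has_field_derivative_def]])
    then show ?thesis by (simp add: inner_commute mult_ac)
  qed
  have g: "gradient (\<lambda>x. flat m (?s x)) x \<bullet> b = (\<alpha> * (i \<bullet> b)) * (flat (m + 2) (?s x) + (- real m) * flat (m + 1) (?s x))" for x b
    unfolding gradient_eqI[OF D] by (simp add: algebra_simps)
  have "Ck k (\<lambda>x. gradient (\<lambda>x. flat m (?s x)) x \<bullet> b)" for b
    unfolding g by (intro Ck_cmult Ck_add Suc)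
  then show ?case using D by (auto simp: differentiable_def)
qed

text \<open>A smooth approximation of the indicator function of the open box: it vanishes outside the box
  and increases to \<open>1\<close> inside as \<open>n \<rightarrow> \<infinity>\<close>.\<close>

definition box_bump :: "'a::euclidean_space \<Rightarrow> 'a \<Rightarrow> nat \<Rightarrow> 'a \<Rightarrow> real" where
  "box_bump a b n x = (\<Prod>i\<in>Basis. flat 0 (real (Suc n) * (x \<bullet> i) + - (real (Suc n) * (a \<bullet> i))) *
     flat 0 (- real (Suc n) * (x \<bullet> i) + real (Suc n) * (b \<bullet> i)))"

lemma flat_0_bounds: "0 \<le> flat 0 t" "flat 0 t \<le> 1"
  by (auto simp: flat_def)

lemma box_bump_bounds: "0 \<le> box_bump a b n x" "box_bump a b n x \<le> 1"
  unfolding box_bump_def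
  by (auto intro!: prod_nonneg prod_le_1 mult_nonneg_nonneg mult_le_one flat_0_bounds)

lemma box_bump_eq_0: "x \<notin> box a b \<Longrightarrow> box_bump a b n x = 0"
proof -
  assume "x \<notin> box a b"
  then obtain i where i: "i \<in> Basis" "\<not> (a \<bullet> i < x \<bullet> i \<and> x \<bullet> i < b \<bullet> i)" by (auto simp: mem_box)
  define N where "N = real (Suc n)"
  have N: "N > 0" by (simp add: N_def)
  have "\<not> 0 < N * (x \<bullet> i) + - (N * (a \<bullet> i)) \<or> \<not> 0 < - N * (x \<bullet> i) + N * (b \<bullet> i)"
    using i(2) N by auto
  then have "flat 0 (N * (x \<bullet> i) + - (N * (a \<bullet> i))) * flat 0 (- N * (x \<bullet> i) + N * (b \<bullet> i)) = 0"
    by (auto simp: flat_def)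
  then show ?thesis unfolding box_bump_def N_def[symmetric] using i(1) by (auto intro!: prod_zero)
qed

lemma box_bump_tendsto: "(\<lambda>n. box_bump a b n x) \<longlonglongrightarrow> indicator (box a b) x"
proof (cases "x \<in> box a b")
  case True
  have 1: "(\<lambda>n. flat 0 (real (Suc n) * c)) \<longlonglongrightarrow> 1" if "c > 0" for c :: real
  proof -
    have "(\<lambda>n. exp (- (1 / c * inverse (real (Suc n))))) \<longlonglongrightarrow> exp (- (1 / c * 0))"
      by (intro tendsto_intros LIMSEQ_inverse_real_of_nat)
    moreover have "flat 0 (real (Suc n) * c) = exp (- (1 / c * inverse (real (Suc n))))" for n
    proof -
      have "0 < real (Suc n) * c" using that by (intro mult_pos_pos) auto
      then show ?thesis by (simp add: flat_def divide_simps mult.commute)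
    qed
    ultimately show ?thesis by simp
  qed
  have "(\<lambda>n. \<Prod>i\<in>Basis. flat 0 (real (Suc n) * (x \<bullet> i - a \<bullet> i)) * flat 0 (real (Suc n) * (b \<bullet> i - x \<bullet> i)))
      \<longlonglongrightarrow> (\<Prod>i\<in>(Basis::'a set). 1 * 1)"
    using True by (intro tendsto_prod tendsto_mult 1) (auto simp: mem_box)
  then show ?thesis using True by (simp add: box_bump_def algebra_simps)
next
  case False
  then show ?thesis by (simp add: box_bump_eq_0)
qed

lemma box_bump_test_function:
  assumes "cbox a b \<subseteq> \<Omega>"
  shows "box_bump a b n \<in> test_functions \<Omega>"
proof -
  have "smooth (box_bump a b n)"
    unfolding smooth_def box_bump_def by (intro allI Ck_prod Ck_mult Ck_flat)
  moreover have "closure {x. box_bump a b n x \<noteq> 0} \<subseteq> cbox a b"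
    using box_bump_eq_0 box_subset_cbox by (intro closure_minimal) fastforce+
  moreover have "compact (closure {x. box_bump a b n x \<noteq> 0})"
    using calculation(2) compact_Int_closed[OF compact_cbox closed_closure] by (metis Int_absorb1)
  ultimately show ?thesis using assms by (auto simp: test_functions_def)
qed

section \<open>Uniqueness of weak gradients\<close>

lemma open_sets_lebesgue: "open S \<Longrightarrow> S \<in> sets lebesgue"
  by (metis borel_open sets_completionI_sets sets_lborel)

lemma finite_measure_lebesgue_on_bounded:
  assumes "bounded \<Omega>" "open \<Omega>"
  shows "finite_measure (lebesgue_on \<Omega>)"
proof (rule finite_measureI)
  have "emeasure lebesgue \<Omega> < \<infinity>"
    using fmeasurableD2[of \<Omega> lebesgue] lmeasurable_open[OF assms] by (simp add: top.not_eq_extremum)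
  moreover have "\<Omega> \<in> sets lebesgue" using assms by (simp add: lmeasurable_open fmeasurableD)
  ultimately show "emeasure (lebesgue_on \<Omega>) (space (lebesgue_on \<Omega>)) \<noteq> \<infinity>"
    by (simp add: emeasure_restrict_space space_restrict_space)
qed

text \<open>Lebesgue measure is complete, so changes on null sets do not affect measurability.\<close>

lemma measurable_lebesgue_on_AE_cong:
  fixes f g :: "'a::euclidean_space \<Rightarrow> 'b::euclidean_space"
  assumes \<Omega>: "\<Omega> \<in> sets lebesgue" and f: "f \<in> borel_measurable (lebesgue_on \<Omega>)"
    and ae: "AE x in lebesgue_on \<Omega>. f x = g x"
  shows "g \<in> borel_measurable (lebesgue_on \<Omega>)"
proof -
  obtain N where N: "N \<in> null_sets (lebesgue_on \<Omega>)" "{x \<in> space (lebesgue_on \<Omega>). f x \<noteq> g x} \<subseteq> N"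
    using AE_E[OF ae] by (metis null_setsI)
  have "f \<in> borel_measurable (lebesgue_on (\<Omega> - N))"
    using f borel_measurable_diff_null[OF N(1) \<Omega>] by blast
  moreover have "f x = g x" if "x \<in> space (lebesgue_on (\<Omega> - N))" for x
    using that N(2) by (auto simp: space_restrict_space)
  ultimately have "g \<in> borel_measurable (lebesgue_on (\<Omega> - N))"
    using measurable_cong by blast
  then show ?thesis using borel_measurable_diff_null[OF N(1) \<Omega>] by blast
qed

text \<open>Testing with bump functions gives zero integrals over all boxes inside the domain; the Lebesgue
  differentiation theorem for boxes with corner \<open>x\<close> then yields \<open>k x = 0\<close> for almost all \<open>x\<close>.\<close>

lemma test_functions_vanish:
  fixes k :: "'a::euclidean_space \<Rightarrow> real"
  assumes \<Omega>: "open \<Omega>" and k: "integrable (lebesgue_on \<Omega>) k"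
    and 0: "\<And>\<phi>. \<phi> \<in> test_functions \<Omega> \<Longrightarrow> (\<integral>x. k x * \<phi> x \<partial>lebesgue_on \<Omega>) = 0"
  shows "AE x in lebesgue_on \<Omega>. k x = 0"
proof -
  have \<Omega>m: "\<Omega> \<in> sets lebesgue" using \<Omega> by (rule open_sets_lebesgue)
  define K where "K x = indicator \<Omega> x * k x" for x
  have Ki: "integrable lebesgue K"
    using k \<Omega>m unfolding K_def by (simp add: integrable_restrict_space)
  have Kon: "K integrable_on cbox a b" for a b
    using Ki by (metis absolutely_integrable_on_subcbox integrable_on_lebesgue integrable_on_subcbox subset_UNIV)
  have box0: "integral (cbox a b) K = 0" if sub: "cbox a b \<subseteq> \<Omega>" for a b
  proof -
    have lim: "(\<lambda>n. \<integral>x. k x * box_bump a b n x \<partial>lebesgue_on \<Omega>) \<longlonglongrightarrow> (\<integral>x. k x * indicator (box a b) x \<partial>lebesgue_on \<Omega>)"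
    proof (rule integral_dominated_convergence[where w="\<lambda>x. \<bar>k x\<bar>"])
      show "(\<lambda>x. k x * indicator (box a b) x) \<in> borel_measurable (lebesgue_on \<Omega>)"
        by (intro borel_measurable_times borel_measurable_integrable[OF k]
            measurable_restrict_space1 borel_measurable_indicator open_sets_lebesgue open_box)
      show "(\<lambda>x. k x * box_bump a b n x) \<in> borel_measurable (lebesgue_on \<Omega>)" for n
      proof (intro borel_measurable_times borel_measurable_integrable[OF k])
        have "smooth (box_bump a b n)" using box_bump_test_function[OF sub] by (simp add: test_functions_def)
        then show "box_bump a b n \<in> borel_measurable (lebesgue_on \<Omega>)"
          by (intro continuous_imp_measurable_on_sets_lebesgue smooth_continuous \<Omega>m)
      qed
      show "AE x in lebesgue_on \<Omega>. (\<lambda>n. k x * box_bump a b n x) \<longlonglongrightarrow> k x * indicator (box a b) x"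
        by (intro AE_I2 tendsto_mult tendsto_const box_bump_tendsto)
      show "AE x in lebesgue_on \<Omega>. norm (k x * box_bump a b n x) \<le> \<bar>k x\<bar>" for n
        using box_bump_bounds[of a b n] by (intro AE_I2) (simp add: abs_mult mult_left_le)
    qed (use k in auto)
    have "(\<integral>x. k x * box_bump a b n x \<partial>lebesgue_on \<Omega>) = 0" for n
      by (rule 0[OF box_bump_test_function[OF sub]])
    then have "(\<integral>x. k x * indicator (box a b) x \<partial>lebesgue_on \<Omega>) = 0"
      using lim by (simp add: LIMSEQ_const_iff)
    moreover have "(\<integral>x. k x * indicator (box a b) x \<partial>lebesgue_on \<Omega>) = (LINT x:box a b|lebesgue. K x)"
      unfolding set_lebesgue_integral_def K_def using \<Omega>m
      by (subst integral_restrict_space) (auto intro!: Bochner_Integration.integral_cong simp: indicator_def)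
    moreover have "(LINT x:box a b|lebesgue. K x) = integral (box a b) K"
      by (rule set_lebesgue_integral_eq_integral)
        (use integrable_mult_indicator[OF _ Ki, of "box a b"] in
          \<open>simp add: set_integrable_def open_sets_lebesgue\<close>)
    ultimately show ?thesis by (simp add: integral_open_interval)
  qed
  obtain N where N: "negligible N"
    and d: "\<And>x e. \<lbrakk>x \<notin> N; 0 < e\<rbrakk> \<Longrightarrow> \<exists>d>0. \<forall>h. 0 < h \<and> h < d \<longrightarrow>
        norm (integral (cbox x (x + h *\<^sub>R One)) K /\<^sub>R h ^ DIM('a) - K x) < e"
    using integrable_ccontinuous_explicit[OF Kon] by blast
  have K0: "K x = 0" if x: "x \<in> \<Omega> - N" for x
  proof (rule ccontr)
    assume "K x \<noteq> 0"
    then obtain d where d: "d > 0" "\<And>h. 0 < h \<Longrightarrow> h < d \<Longrightarrow>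
        norm (integral (cbox x (x + h *\<^sub>R One)) K /\<^sub>R h ^ DIM('a) - K x) < norm (K x)"
      using d[of x "norm (K x)"] x by auto
    obtain e where e: "e > 0" "cball x e \<subseteq> \<Omega>" using \<Omega> x open_contains_cball by blast
    define h where "h = min (d / 2) (e / DIM('a))"
    have h: "0 < h" "h < d" "h * DIM('a) \<le> e"
      using d(1) e(1) by (auto simp: h_def min_def field_simps)
    have "cbox x (x + h *\<^sub>R One) \<subseteq> cball x e"
    proof
      fix y assume y: "y \<in> cbox x (x + h *\<^sub>R One)"
      have "norm (y - x) \<le> (\<Sum>i\<in>Basis. \<bar>(y - x) \<bullet> i\<bar>)" by (rule norm_le_l1)
      also have "\<dots> \<le> (\<Sum>i\<in>(Basis::'a set). h)"
        using y by (intro sum_mono) (auto simp: mem_box inner_diff_left inner_add_left)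
      finally show "y \<in> cball x e" using h by (simp add: dist_norm norm_minus_commute mult.commute)
    qed
    then have "integral (cbox x (x + h *\<^sub>R One)) K = 0" using box0 e by blast
    then show False using d(2)[OF h(1,2)] by simp
  qed
  have "AE x in lebesgue. x \<notin> N"
    using N by (simp add: AE_not_in negligible_iff_null_sets)
  then have "AE x in lebesgue. x \<in> \<Omega> \<longrightarrow> k x = 0"
    by eventually_elim (use K0 in \<open>auto simp: K_def\<close>)
  then show ?thesis using \<Omega>m by (simp add: AE_restrict_space_iff)
qed

text \<open>\<open>weak_grad\<close> is a choice, and its linearity, up to null sets, rests on this uniqueness.\<close>

lemma weak_gradient_unique:
  fixes v :: "'a::euclidean_space \<Rightarrow> real"
  assumes \<Omega>: "open \<Omega>" "bounded \<Omega>" and g: "is_weak_gradient \<Omega> v g" "is_weak_gradient \<Omega> v g'"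
  shows "AE x in lebesgue_on \<Omega>. g x = g' x"
proof -
  note fm = finite_measure_lebesgue_on_bounded[OF \<Omega>(2,1)]
  have gi: "integrable (lebesgue_on \<Omega>) g" "integrable (lebesgue_on \<Omega>) g'"
    using g finite_measure_L2_integrable[OF fm] by (auto simp: is_weak_gradient_def)
  have "AE x in lebesgue_on \<Omega>. g x \<bullet> b - g' x \<bullet> b = 0" if b: "b \<in> Basis" for b
  proof (rule test_functions_vanish[OF \<Omega>(1)])
    show "integrable (lebesgue_on \<Omega>) (\<lambda>x. g x \<bullet> b - g' x \<bullet> b)" using gi by simp
    fix \<phi> assume \<phi>: "\<phi> \<in> test_functions \<Omega>"
    have sm: "smooth \<phi>" and cs: "compact (closure {x. \<phi> x \<noteq> 0})" using \<phi> by (auto simp: test_functions_def)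
    have "compact (\<phi> ` closure {x. \<phi> x \<noteq> 0})"
      by (rule compact_continuous_image[OF smooth_continuous[OF sm] cs])
    then obtain B where B: "\<And>y. y \<in> \<phi> ` closure {x. \<phi> x \<noteq> 0} \<Longrightarrow> norm y \<le> B"
      using compact_imp_bounded bounded_iff by metis
    have "norm (\<phi> x) \<le> \<bar>B\<bar>" for x
      using B[of "\<phi> x"] closure_subset[of "{x. \<phi> x \<noteq> 0}"] by (cases "\<phi> x = 0") (auto intro: order_trans)
    then have \<phi>b: "\<bar>\<phi> x\<bar> \<le> \<bar>B\<bar>" for x by simp
    have m: "\<phi> \<in> borel_measurable (lebesgue_on \<Omega>)"
      by (intro continuous_imp_measurable_on_sets_lebesgue smooth_continuous sm open_sets_lebesgue \<Omega>(1))
    have int: "integrable (lebesgue_on \<Omega>) (\<lambda>x. (k x \<bullet> b) * \<phi> x)" if "integrable (lebesgue_on \<Omega>) k" for k :: "'a \<Rightarrow> 'a"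
    proof (rule Bochner_Integration.integrable_bound)
      show "integrable (lebesgue_on \<Omega>) (\<lambda>x. B * (k x \<bullet> b))" using that by simp
      show "(\<lambda>x. k x \<bullet> b * \<phi> x) \<in> borel_measurable (lebesgue_on \<Omega>)" using that m by simp
    qed (use \<phi>b in \<open>auto simp: abs_mult mult.commute intro!: mult_right_mono always_eventually\<close>)
    have "(\<integral>x. (g x \<bullet> b) * \<phi> x \<partial>lebesgue_on \<Omega>) = (\<integral>x. (g' x \<bullet> b) * \<phi> x \<partial>lebesgue_on \<Omega>)"
    proof -
      have "- (\<integral>x. (g x \<bullet> b) * \<phi> x \<partial>lebesgue_on \<Omega>) = (\<integral>x. v x * (gradient \<phi> x \<bullet> b) \<partial>lebesgue_on \<Omega>)"
        using g(1) \<phi> b unfolding is_weak_gradient_def by simp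
      also have "\<dots> = - (\<integral>x. (g' x \<bullet> b) * \<phi> x \<partial>lebesgue_on \<Omega>)"
        using g(2) \<phi> b unfolding is_weak_gradient_def by simp
      finally show ?thesis by simp
    qed
    then show "(\<integral>x. (g x \<bullet> b - g' x \<bullet> b) * \<phi> x \<partial>lebesgue_on \<Omega>) = 0"
      using int[OF gi(1)] int[OF gi(2)] by (simp add: left_diff_distrib)
  qed
  then have "AE x in lebesgue_on \<Omega>. \<forall>b\<in>Basis. g x \<bullet> b - g' x \<bullet> b = 0"
    by (intro AE_finite_allI) auto
  then show ?thesis
    by eventually_elim (auto intro: euclidean_eqI)
qed

lemma weak_grad_is_weak_gradient: "v \<in> H1 \<Omega> \<Longrightarrow> is_weak_gradient \<Omega> v (weak_grad \<Omega> v)"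
  unfolding H1_def weak_grad_def by (auto intro: someI_ex[of "is_weak_gradient \<Omega> v"])

lemma is_weak_gradient_diff:
  fixes v w :: "'a::euclidean_space \<Rightarrow> real"
  assumes \<Omega>: "open \<Omega>" "bounded \<Omega>" and vw: "v \<in> L2 (lebesgue_on \<Omega>)" "w \<in> L2 (lebesgue_on \<Omega>)"
    and g: "is_weak_gradient \<Omega> v g" "is_weak_gradient \<Omega> w g'"
  shows "is_weak_gradient \<Omega> (\<lambda>x. v x - w x) (\<lambda>x. g x - g' x)"
  unfolding is_weak_gradient_def
proof (intro conjI ballI)
  note fm = finite_measure_lebesgue_on_bounded[OF \<Omega>(2,1)]
  have gL: "g \<in> L2 (lebesgue_on \<Omega>)" "g' \<in> L2 (lebesgue_on \<Omega>)"
    using g by (auto simp: is_weak_gradient_def)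
  then show "(\<lambda>x. g x - g' x) \<in> L2 (lebesgue_on \<Omega>)" by (rule L2_diff)
  fix \<phi> :: "'a \<Rightarrow> real" and b :: 'a
  assume \<phi>: "\<phi> \<in> test_functions \<Omega>" and b: "b \<in> Basis"
  have sm: "smooth \<phi>" using \<phi> by (simp add: test_functions_def)
  have bd: "\<exists>B. \<forall>x\<in>\<Omega>. norm (h x) \<le> B" if "continuous_on UNIV h" for h :: "'a \<Rightarrow> 'c::real_normed_vector"
  proof -
    have "compact (h ` closure \<Omega>)"
      using \<Omega>(2) by (intro compact_continuous_image continuous_on_subset[OF that]) (auto simp: compact_closure)
    then show ?thesis using closure_subset[of \<Omega>] by (meson bounded_iff compact_imp_bounded imageI subsetD)
  qed
  have cont: "continuous_on UNIV \<phi>" "continuous_on UNIV (\<lambda>x. gradient \<phi> x \<bullet> b)"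
    using smooth_continuous[OF sm] smooth_continuous_gradient[OF sm] by (auto intro!: continuous_intros)
  have L: "h \<in> L2 (lebesgue_on \<Omega>)" if c: "continuous_on UNIV h" for h :: "'a \<Rightarrow> real"
  proof -
    obtain B where "\<forall>x\<in>\<Omega>. norm (h x) \<le> B" using bd[OF c] by blast
    then show ?thesis
      by (intro finite_measure_bounded_L2[OF fm, where B=B] continuous_imp_measurable_on_sets_lebesgue
          continuous_on_subset[OF c]) (use \<Omega> in \<open>auto simp: space_restrict_space intro!: AE_I2\<close>)
  qed
  have gb: "(\<lambda>x. k x \<bullet> b) \<in> L2 (lebesgue_on \<Omega>)" if k: "k \<in> L2 (lebesgue_on \<Omega>)" for k :: "'a \<Rightarrow> 'a"
  proof (rule L2_I)
    show "integrable (lebesgue_on \<Omega>) (\<lambda>x. (norm (k x \<bullet> b))\<^sup>2)"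
      by (rule Bochner_Integration.integrable_bound[OF L2_D(2)[OF k]])
        (use L2_D(1)[OF k] b in \<open>auto intro!: always_eventually simp: Basis_le_norm power_mono abs_le_square_iff[symmetric]\<close>)
  qed (use L2_D(1)[OF k] in simp)
  have "(\<integral>x. (v x - w x) * (gradient \<phi> x \<bullet> b) \<partial>lebesgue_on \<Omega>) =
      (\<integral>x. v x * (gradient \<phi> x \<bullet> b) \<partial>lebesgue_on \<Omega>) - (\<integral>x. w x * (gradient \<phi> x \<bullet> b) \<partial>lebesgue_on \<Omega>)"
    by (simp add: left_diff_distrib L2_integrable_mult[OF vw(1) L[OF cont(2)]]
        L2_integrable_mult[OF vw(2) L[OF cont(2)]])
  also have "\<dots> = - (\<integral>x. (g x \<bullet> b) * \<phi> x \<partial>lebesgue_on \<Omega>) + (\<integral>x. (g' x \<bullet> b) * \<phi> x \<partial>lebesgue_on \<Omega>)"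
    using g \<phi> b by (simp add: is_weak_gradient_def)
  also have "\<dots> = - (\<integral>x. ((g x - g' x) \<bullet> b) * \<phi> x \<partial>lebesgue_on \<Omega>)"
    by (simp add: inner_diff_left left_diff_distrib L2_integrable_mult[OF gb[OF gL(1)] L[OF cont(1)]]
        L2_integrable_mult[OF gb[OF gL(2)] L[OF cont(1)]])
  finally show "(\<integral>x. (v x - w x) * (gradient \<phi> x \<bullet> b) \<partial>lebesgue_on \<Omega>) =
      - (\<integral>x. ((g x - g' x) \<bullet> b) * \<phi> x \<partial>lebesgue_on \<Omega>)" .
qed

lemma H1_D:
  assumes "v \<in> H1 \<Omega>"
  shows "v \<in> L2 (lebesgue_on \<Omega>)" "weak_grad \<Omega> v \<in> L2 (lebesgue_on \<Omega>)"
  using assms weak_grad_is_weak_gradient[OF assms] by (auto simp: H1_def is_weak_gradient_def)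

lemma H1_diff:
  fixes v w :: "'a::euclidean_space \<Rightarrow> real"
  assumes \<Omega>: "open \<Omega>" "bounded \<Omega>" and v: "v \<in> H1 \<Omega>" and w: "w \<in> H1 \<Omega>"
  shows "(\<lambda>x. v x - w x) \<in> H1 \<Omega>"
    and "AE x in lebesgue_on \<Omega>. weak_grad \<Omega> (\<lambda>x. v x - w x) x = weak_grad \<Omega> v x - weak_grad \<Omega> w x"
proof -
  have *: "is_weak_gradient \<Omega> (\<lambda>x. v x - w x) (\<lambda>x. weak_grad \<Omega> v x - weak_grad \<Omega> w x)"
    by (intro is_weak_gradient_diff[OF \<Omega>] H1_D weak_grad_is_weak_gradient v w)
  then show 1: "(\<lambda>x. v x - w x) \<in> H1 \<Omega>"
    using L2_diff[OF H1_D(1)[OF v] H1_D(1)[OF w]] by (auto simp: H1_def)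
  show "AE x in lebesgue_on \<Omega>. weak_grad \<Omega> (\<lambda>x. v x - w x) x = weak_grad \<Omega> v x - weak_grad \<Omega> w x"
    by (rule weak_gradient_unique[OF \<Omega> weak_grad_is_weak_gradient[OF 1] *])
qed

lemma H1D_diff:
  fixes v w :: "'a::euclidean_space \<Rightarrow> real"
  assumes \<Omega>: "open \<Omega>" "bounded \<Omega>" and v: "v \<in> H1D \<Omega> \<Gamma>D" and w: "w \<in> H1D \<Omega> \<Gamma>D"
  shows "(\<lambda>x. v x - w x) \<in> H1D \<Omega> \<Gamma>D"
proof -
  have H: "v \<in> H1 \<Omega>" "w \<in> H1 \<Omega>" using v w by (auto simp: H1D_def)
  note d = H1_diff[OF \<Omega> H]
  obtain g \<phi> where g: "g \<in> L2 (boundary_measure \<Omega>)" "\<forall>n. smooth (\<phi> n)"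
    "L2_tendsto (lebesgue_on \<Omega>) \<phi> v" "L2_tendsto (lebesgue_on \<Omega>) (\<lambda>n. gradient (\<phi> n)) (weak_grad \<Omega> v)"
    "L2_tendsto (boundary_measure \<Omega>) \<phi> g" "AE x in boundary_measure \<Omega>. x \<in> \<Gamma>D \<longrightarrow> g x = 0"
    using v by (auto simp: H1D_def has_trace_def)
  obtain k \<psi> where k: "k \<in> L2 (boundary_measure \<Omega>)" "\<forall>n. smooth (\<psi> n)"
    "L2_tendsto (lebesgue_on \<Omega>) \<psi> w" "L2_tendsto (lebesgue_on \<Omega>) (\<lambda>n. gradient (\<psi> n)) (weak_grad \<Omega> w)"
    "L2_tendsto (boundary_measure \<Omega>) \<psi> k" "AE x in boundary_measure \<Omega>. x \<in> \<Gamma>D \<longrightarrow> k x = 0"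
    using w by (auto simp: H1D_def has_trace_def)
  have s: "smooth (\<lambda>x. \<phi> n x - \<psi> n x)" for n using g k by (intro smooth_diff) auto
  have gr: "(\<lambda>n. gradient (\<lambda>x. \<phi> n x - \<psi> n x)) = (\<lambda>n x. gradient (\<phi> n) x - gradient (\<psi> n) x)"
    using g k by (auto simp: fun_eq_iff gradient_diff)
  have "has_trace \<Omega> (\<lambda>x. v x - w x) (\<lambda>x. g x - k x)"
    unfolding has_trace_def
  proof (intro conjI exI[of _ "\<lambda>n x. \<phi> n x - \<psi> n x"] allI s d L2_diff g k L2_tendsto_diff)
    show "L2_tendsto (lebesgue_on \<Omega>) (\<lambda>n. gradient (\<lambda>x. \<phi> n x - \<psi> n x)) (weak_grad \<Omega> (\<lambda>x. v x - w x))"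
    proof (rule L2_tendsto_AE_cong)
      show "L2_tendsto (lebesgue_on \<Omega>) (\<lambda>n. gradient (\<lambda>x. \<phi> n x - \<psi> n x)) (\<lambda>x. weak_grad \<Omega> v x - weak_grad \<Omega> w x)"
        unfolding gr by (intro L2_tendsto_diff g k)
      show "(\<lambda>x. weak_grad \<Omega> v x - weak_grad \<Omega> w x) \<in> borel_measurable (lebesgue_on \<Omega>)"
        by (intro borel_measurable_diff L2_D H1_D H)
      show "weak_grad \<Omega> (\<lambda>x. v x - w x) \<in> borel_measurable (lebesgue_on \<Omega>)"
        by (intro L2_D H1_D d)
      show "gradient (\<lambda>x. \<phi> n x - \<psi> n x) \<in> borel_measurable (lebesgue_on \<Omega>)" for n
        by (intro continuous_imp_measurable_on_sets_lebesgue smooth_continuous_gradient s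
            open_sets_lebesgue \<Omega>(1))
      show "AE x in lebesgue_on \<Omega>. weak_grad \<Omega> v x - weak_grad \<Omega> w x = weak_grad \<Omega> (\<lambda>x. v x - w x) x"
        using d(2) by eventually_elim simp
    qed
  qed
  moreover have "AE x in boundary_measure \<Omega>. x \<in> \<Gamma>D \<longrightarrow> g x - k x = 0"
    using g(6) k(6) by eventually_elim simp
  ultimately show ?thesis using d(1) by (auto simp: H1D_def)
qed

section \<open>Affine substitutions\<close>

lemma nn_integral_lborel_scale:
  fixes f :: "'a::euclidean_space \<Rightarrow> ennreal"
  assumes "f \<in> borel_measurable borel" "c \<noteq> 0"
  shows "(\<integral>\<^sup>+x. f x \<partial>lborel) = ennreal (\<bar>c\<bar> ^ DIM('a)) * (\<integral>\<^sup>+x. f (t + c *\<^sub>R x) \<partial>lborel)"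
proof -
  have "(\<integral>\<^sup>+x. f x \<partial>lborel) = (\<integral>\<^sup>+x. f x \<partial>density (distr lborel borel (\<lambda>x. t + c *\<^sub>R x)) (\<lambda>_. \<bar>c\<bar> ^ DIM('a)))"
    using lborel_affine[OF assms(2), of t] by simp
  also have "\<dots> = ennreal (\<bar>c\<bar> ^ DIM('a)) * (\<integral>\<^sup>+x. f (t + c *\<^sub>R x) \<partial>lborel)"
    using assms(1) by (simp add: nn_integral_density nn_integral_distr nn_integral_cmult)
  finally show ?thesis .
qed

lemma integral_lborel_scale:
  fixes f :: "'a::euclidean_space \<Rightarrow> real"
  assumes "f \<in> borel_measurable borel" "c \<noteq> 0"
  shows "(\<integral>x. f x \<partial>lborel) = \<bar>c\<bar> ^ DIM('a) * (\<integral>x. f (t + c *\<^sub>R x) \<partial>lborel)"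
    and "integrable lborel f \<longleftrightarrow> integrable lborel (\<lambda>x. f (t + c *\<^sub>R x))"
proof -
  have "(\<integral>x. f x \<partial>lborel) = (\<integral>x. f x \<partial>density (distr lborel borel (\<lambda>x. t + c *\<^sub>R x)) (\<lambda>_. \<bar>c\<bar> ^ DIM('a)))"
    using lborel_affine[OF assms(2), of t] by simp
  also have "\<dots> = \<bar>c\<bar> ^ DIM('a) * (\<integral>x. f (t + c *\<^sub>R x) \<partial>lborel)"
    using assms(1) by (simp add: integral_density integral_distr)
  finally show "(\<integral>x. f x \<partial>lborel) = \<bar>c\<bar> ^ DIM('a) * (\<integral>x. f (t + c *\<^sub>R x) \<partial>lborel)" .
  have "integrable lborel f \<longleftrightarrow> integrable (density (distr lborel borel (\<lambda>x. t + c *\<^sub>R x)) (\<lambda>_. \<bar>c\<bar> ^ DIM('a))) f"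
    using lborel_affine[OF assms(2), of t] by simp
  also have "\<dots> \<longleftrightarrow> integrable lborel (\<lambda>x. f (t + c *\<^sub>R x))"
    using assms by (simp add: integrable_density integrable_distr_eq)
  finally show "integrable lborel f \<longleftrightarrow> integrable lborel (\<lambda>x. f (t + c *\<^sub>R x))" .
qed

text \<open>A linear bijection scales all integrals by the same factor. The determinant is avoided by the
  argument that shows the uniqueness of translation invariant measures: both sides are the integral
  of \<open>f (\<rho> x) * g (\<rho> x - y)\<close>, evaluated in the two orders, where \<open>\<rho> x = M x + c\<close>.\<close>

lemma nn_integral_affine_ratio:
  fixes f g :: "'a::euclidean_space \<Rightarrow> ennreal" and M :: "'a \<Rightarrow> 'a"
  assumes [measurable]: "f \<in> borel_measurable borel" "g \<in> borel_measurable borel"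
    and M: "linear M" "inj M"
  shows "(\<integral>\<^sup>+x. f (M x + c) \<partial>lborel) * (\<integral>\<^sup>+x. g x \<partial>lborel) =
    (\<integral>\<^sup>+x. f x \<partial>lborel) * (\<integral>\<^sup>+x. g (M x + c) \<partial>lborel)"
proof -
  let ?r = "\<lambda>x. M x + c"
  have "continuous_on UNIV M" using M(1) by (simp add: linear_continuous_on linear_linear)
  then have [measurable]: "M \<in> borel_measurable borel" by (rule borel_measurable_continuous_onI)
  have [measurable]: "(\<lambda>z. f (?r z)) \<in> borel_measurable borel" "(\<lambda>z. g (?r z)) \<in> borel_measurable borel"
    by measurable
  have reflect: "(\<integral>\<^sup>+y. g y \<partial>lborel) = (\<integral>\<^sup>+y. g (z - y) \<partial>lborel)" for z
    using nn_integral_lborel_scale[of g "-1" z] by simp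
  have shift: "(\<integral>\<^sup>+y. h y \<partial>lborel) = (\<integral>\<^sup>+y. h (y + z) \<partial>lborel)"
    if "h \<in> borel_measurable borel" for h :: "'a \<Rightarrow> ennreal" and z
    using nn_integral_lborel_scale[OF that, of 1 z] by (simp add: add.commute)
  obtain N where N: "\<And>y. M (N y) = y"
    using surj_f_inv_f[OF linear_inj_imp_surj[OF M]] by blast
  have "(\<integral>\<^sup>+x. f (?r x) \<partial>lborel) * (\<integral>\<^sup>+x. g x \<partial>lborel) =
      (\<integral>\<^sup>+x. f (?r x) * (\<integral>\<^sup>+y. g y \<partial>lborel) \<partial>lborel)"
    by (rule nn_integral_multc[symmetric]) simp
  also have "\<dots> = (\<integral>\<^sup>+x. \<integral>\<^sup>+y. f (?r x) * g (?r x - y) \<partial>lborel \<partial>lborel)"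
  proof (rule nn_integral_cong)
    fix x
    show "f (?r x) * (\<integral>\<^sup>+y. g y \<partial>lborel) = (\<integral>\<^sup>+y. f (?r x) * g (?r x - y) \<partial>lborel)"
      unfolding reflect[of "?r x"] by (rule nn_integral_cmult[symmetric]) measurable
  qed
  also have "\<dots> = (\<integral>\<^sup>+y. \<integral>\<^sup>+x. f (?r x) * g (?r x - y) \<partial>lborel \<partial>lborel)"
    by (rule lborel_pair.Fubini'[symmetric]) measurable
  also have "\<dots> = (\<integral>\<^sup>+y. \<integral>\<^sup>+x. f (?r x + y) * g (?r x) \<partial>lborel \<partial>lborel)"
  proof (rule nn_integral_cong)
    fix y
    have "(\<integral>\<^sup>+x. f (?r x) * g (?r x - y) \<partial>lborel) = (\<integral>\<^sup>+x. f (?r (x + N y)) * g (?r (x + N y) - y) \<partial>lborel)"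
      by (rule shift) measurable
    also have "\<dots> = (\<integral>\<^sup>+x. f (?r x + y) * g (?r x) \<partial>lborel)"
      by (simp add: linear_add[OF M(1)] N algebra_simps)
    finally show "(\<integral>\<^sup>+x. f (?r x) * g (?r x - y) \<partial>lborel) = (\<integral>\<^sup>+x. f (?r x + y) * g (?r x) \<partial>lborel)" .
  qed
  also have "\<dots> = (\<integral>\<^sup>+x. \<integral>\<^sup>+y. f (?r x + y) * g (?r x) \<partial>lborel \<partial>lborel)"
    by (rule lborel_pair.Fubini') measurable
  also have "\<dots> = (\<integral>\<^sup>+x. (\<integral>\<^sup>+y. f y \<partial>lborel) * g (?r x) \<partial>lborel)"
  proof (rule nn_integral_cong)
    fix x
    have "(\<integral>\<^sup>+y. f (?r x + y) * g (?r x) \<partial>lborel) = (\<integral>\<^sup>+y. f (?r x + y) \<partial>lborel) * g (?r x)"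
      by (rule nn_integral_multc) measurable
    then show "(\<integral>\<^sup>+y. f (?r x + y) * g (?r x) \<partial>lborel) = (\<integral>\<^sup>+y. f y \<partial>lborel) * g (?r x)"
      using shift[of f "?r x"] by (simp add: add.commute)
  qed
  also have "\<dots> = (\<integral>\<^sup>+x. f x \<partial>lborel) * (\<integral>\<^sup>+x. g (?r x) \<partial>lborel)"
    by (rule nn_integral_cmult) simp
  finally show ?thesis .
qed

section \<open>Cones and their radial projection\<close>

text \<open>A simplex is the cone over each of its facets, with the opposite vertex as apex. The
  functional \<open>a\<close> measures the relative height above the apex.\<close>

locale cone =
  fixes p a :: "'a::euclidean_space" and S T :: "'a set"
  assumes compact_base: "compact S"
    and height_base: "y \<in> S \<Longrightarrow> a \<bullet> (y - p) = 1"
    and cone_eq: "T = (\<lambda>(t, y). p + t *\<^sub>R (y - p)) ` ({0..1} \<times> S)"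
begin

definition proj :: "'a \<Rightarrow> 'a" where
  "proj x = p + (1 / (a \<bullet> (x - p))) *\<^sub>R (x - p)"

lemma compact_cone: "compact T"
  unfolding cone_eq
  by (intro compact_continuous_image compact_Times compact_base)
    (auto simp: case_prod_unfold intro!: continuous_intros)

lemma cone_borel [measurable]: "T \<in> sets borel"
  using compact_cone by (simp add: borel_compact)

lemma cone_finite: "emeasure lborel T < \<infinity>"
  by (rule emeasure_bounded_finite[OF compact_imp_bounded[OF compact_cone]])

lemma mem_coneE:
  assumes "x \<in> T"
  obtains t y where "0 \<le> t" "t \<le> 1" "y \<in> S" "x = p + t *\<^sub>R (y - p)"
  using assms unfolding cone_eq by auto

lemma mem_coneI: "0 \<le> t \<Longrightarrow> t \<le> 1 \<Longrightarrow> y \<in> S \<Longrightarrow> p + t *\<^sub>R (y - p) \<in> T"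
  unfolding cone_eq by force

lemma base_subset: "S \<subseteq> T"
proof
  fix y assume "y \<in> S"
  then show "y \<in> T" using mem_coneI[of 1 y] by simp
qed

lemma height_bounds: "x \<in> T \<Longrightarrow> 0 \<le> a \<bullet> (x - p)" "x \<in> T \<Longrightarrow> a \<bullet> (x - p) \<le> 1"
  by (auto elim!: mem_coneE simp: height_base)

lemma proj_ray: "y \<in> S \<Longrightarrow> 0 < t \<Longrightarrow> proj (p + t *\<^sub>R (y - p)) = y"
  by (simp add: proj_def height_base)

lemma cone_cases:
  assumes "x \<in> T" "x \<noteq> p"
  shows "0 < a \<bullet> (x - p)" "proj x \<in> S" "x = p + (a \<bullet> (x - p)) *\<^sub>R (proj x - p)"
proof -
  obtain t y where t: "0 \<le> t" "t \<le> 1" "y \<in> S" "x = p + t *\<^sub>R (y - p)"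
    using assms(1) by (rule mem_coneE)
  then have "t > 0" using assms(2) by (cases "t = 0") auto
  then show "0 < a \<bullet> (x - p)" "proj x \<in> S" "x = p + (a \<bullet> (x - p)) *\<^sub>R (proj x - p)"
    using t proj_ray[of y t] by (auto simp: height_base)
qed

lemma proj_in_cone: "x \<in> T \<Longrightarrow> proj x \<in> T"
  using cone_cases[of x] base_subset by (cases "x = p") (auto simp: proj_def)

lemma ray_mem_cone:
  assumes x: "x \<in> T" "x \<noteq> p" and t: "0 < t"
  shows "p + (1 / t) *\<^sub>R (x - p) \<in> T \<longleftrightarrow> a \<bullet> (x - p) \<le> t"
proof
  assume "p + (1 / t) *\<^sub>R (x - p) \<in> T"
  from height_bounds(2)[OF this] have "(1 / t) * (a \<bullet> (x - p)) \<le> 1" by simp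
  then show "a \<bullet> (x - p) \<le> t" using t by (simp add: divide_simps)
next
  let ?s = "a \<bullet> (x - p)"
  assume "?s \<le> t"
  moreover have "p + (1 / t) *\<^sub>R (x - p) = p + (?s / t) *\<^sub>R (proj x - p)"
    by (subst (1) cone_cases(3)[OF x]) simp
  ultimately show "p + (1 / t) *\<^sub>R (x - p) \<in> T"
    using mem_coneI[of "?s / t" "proj x"] cone_cases[OF x] t by simp
qed

lemma ray_mem_coneD:
  assumes "p + (1 / t) *\<^sub>R (x - p) \<in> T" "0 < t" "t \<le> 1"
  shows "x \<in> T"
proof -
  obtain s y where s: "0 \<le> s" "s \<le> 1" "y \<in> S" "p + (1 / t) *\<^sub>R (x - p) = p + s *\<^sub>R (y - p)"
    using assms(1) by (rule mem_coneE)
  then have "(1 / t) *\<^sub>R (x - p) = s *\<^sub>R (y - p)" by simp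
  then have "t *\<^sub>R ((1 / t) *\<^sub>R (x - p)) = t *\<^sub>R (s *\<^sub>R (y - p))" by simp
  then have "x = p + (t * s) *\<^sub>R (y - p)" using assms(2) by (simp add: algebra_simps)
  then show ?thesis using mem_coneI[of "t * s" y] s assms by (simp add: mult_le_one)
qed

lemma proj_measurable [measurable]: "proj \<in> borel_measurable borel"
  unfolding proj_def by measurable

lemma integrable_cone:
  fixes f :: "'a \<Rightarrow> real"
  assumes "f \<in> borel_measurable borel" "\<And>x. x \<in> T \<Longrightarrow> \<bar>f x\<bar> \<le> B"
  shows "integrable lborel (\<lambda>x. indicator T x * f x)"
proof (rule Bochner_Integration.integrable_bound)
  show "integrable lborel (\<lambda>x. B * indicator T x)"
    using cone_finite by (intro integrable_mult_right integrable_real_indicator) auto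
  show "AE x in lborel. norm (indicat_real T x * f x) \<le> norm (B * indicat_real T x)"
    using assms(2) by (intro AE_I2) (fastforce simp: indicator_def)
qed (use assms(1) in simp)

lemma continuous_bounded_on_cone:
  fixes f :: "'a \<Rightarrow> real"
  assumes "continuous_on UNIV f"
  obtains B where "\<And>x. x \<in> T \<Longrightarrow> \<bar>f x\<bar> \<le> B"
proof -
  have "compact (f ` T)"
    using continuous_on_subset[OF assms] by (intro compact_continuous_image compact_cone) auto
  then obtain B where "\<And>y. y \<in> f ` T \<Longrightarrow> norm y \<le> B" using compact_imp_bounded bounded_iff by metis
  then show ?thesis by (intro that[of B]) auto
qed

text \<open>Polar coordinates around the apex: along the ray through \<open>x\<close> the difference
  \<open>\<phi> (proj x) - \<phi> x\<close> is an integral of \<open>G q = \<nabla>\<phi>(q) \<bullet> (q - p)\<close>, and the homothety with centre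
  \<open>p\<close> and ratio \<open>1 / t\<close> turns the integral over \<open>x\<close> into \<open>t\<^sup>d\<close> times the integral of \<open>G\<close> over the
  cone. This is the divergence theorem for \<open>(x - p) \<phi>(x)\<close>.\<close>

theorem radial_trace_formula:
  fixes \<phi> :: "'a \<Rightarrow> real"
  assumes \<phi>: "smooth \<phi>"
  shows "(\<integral>x. indicator T x * \<phi> (proj x) \<partial>lborel) =
    (\<integral>x. indicator T x * (\<phi> x + (1 / DIM('a)) * (gradient \<phi> x \<bullet> (x - p))) \<partial>lborel)"
proof -
  define G where "G q = gradient \<phi> q \<bullet> (q - p)" for q
  define q where "q t x = p + (1 / t) *\<^sub>R (x - p)" for t :: real and x
  define H where "H t x = indicator {0<..1} t * (indicator T (q t x) * G (q t x) / t)" for t :: real and x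
  have Gc: "continuous_on A G" for A
    unfolding G_def by (intro continuous_intros smooth_continuous_gradient \<phi>)
  have [measurable]: "G \<in> borel_measurable borel" "\<phi> \<in> borel_measurable borel"
    by (intro borel_measurable_continuous_onI Gc smooth_continuous \<phi>)+
  have qm [measurable]: "case_prod q \<in> borel_measurable (lborel \<Otimes>\<^sub>M lborel)"
    unfolding q_def case_prod_unfold by measurable
  have [measurable]: "q t \<in> borel_measurable borel" "(\<lambda>t. q t x) \<in> borel_measurable borel" for t x
    unfolding q_def by measurable
  have Hm [measurable]: "case_prod H \<in> borel_measurable (lborel \<Otimes>\<^sub>M lborel)"
  proof -
    have [measurable]: "(\<lambda>z. q (fst z) (snd z)) \<in> borel_measurable (lborel \<Otimes>\<^sub>M lborel)"
      using qm by (simp add: case_prod_unfold)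
    show ?thesis unfolding H_def case_prod_unfold by measurable
  qed
  obtain B where B: "\<And>x. x \<in> T \<Longrightarrow> \<bar>G x\<bar> \<le> B"
    using continuous_bounded_on_cone[OF Gc] by metis
  obtain B' where B': "\<And>x. x \<in> T \<Longrightarrow> \<bar>\<phi> x\<bar> \<le> B'"
    using continuous_bounded_on_cone[OF smooth_continuous[OF \<phi>]] by metis
  have GT: "integrable lborel (\<lambda>x. indicator T x * G x)"
    by (rule integrable_cone[of _ B]) (use B in auto)
  have scale: "(\<integral>x. h (q t x) \<partial>lborel) = t ^ DIM('a) * (\<integral>x. h x \<partial>lborel)"
    and scale_int: "integrable lborel (\<lambda>x. h (q t x)) \<longleftrightarrow> integrable lborel h"
    if "h \<in> borel_measurable borel" "0 < t" for h :: "'a \<Rightarrow> real" and t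
  proof -
    have eq: "(p - (1 / t) *\<^sub>R p) + (1 / t) *\<^sub>R x = q t x" for x by (simp add: q_def algebra_simps)
    show "(\<integral>x. h (q t x) \<partial>lborel) = t ^ DIM('a) * (\<integral>x. h x \<partial>lborel)"
      using integral_lborel_scale(1)[OF that(1), of "1 / t" "p - (1 / t) *\<^sub>R p"] that(2)
      unfolding eq by (simp add: power_divide)
    show "integrable lborel (\<lambda>x. h (q t x)) \<longleftrightarrow> integrable lborel h"
      using integral_lborel_scale(2)[OF that(1), of "1 / t" "p - (1 / t) *\<^sub>R p"] that(2)
      unfolding eq by simp
  qed
  have pow: "(t ^ DIM('a)) / t = t ^ (DIM('a) - 1)" if "t > 0" for t :: real
    using that DIM_positive[where 'a='a] by (metis nonzero_mult_div_cancel_left power_eq_if less_irrefl)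
  have inner_x: "(\<integral>x. H t x \<partial>lborel) = indicator {0<..1} t * t ^ (DIM('a) - 1) * (\<integral>x. indicator T x * G x \<partial>lborel)" for t
  proof (cases "t \<in> {0<..1}")
    case True
    then have "(\<integral>x. H t x \<partial>lborel) = (\<integral>x. indicator T (q t x) * G (q t x) \<partial>lborel) / t"
      by (simp add: H_def)
    also have "\<dots> = t ^ DIM('a) / t * (\<integral>x. indicator T x * G x \<partial>lborel)"
      using True by (subst scale) auto
    finally show ?thesis using True pow[of t] by (simp del: times_divide_eq_left)
  qed (simp add: H_def)
  have inner_norm: "(\<integral>x. norm (H t x) \<partial>lborel) = indicator {0<..1} t * t ^ (DIM('a) - 1) * (\<integral>x. indicator T x * \<bar>G x\<bar> \<partial>lborel)" for t
  proof (cases "t \<in> {0<..1}")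
    case True
    then have "(\<integral>x. norm (H t x) \<partial>lborel) = (\<integral>x. indicator T (q t x) * \<bar>G (q t x)\<bar> \<partial>lborel) / t"
      by (simp add: H_def abs_mult)
    also have "\<dots> = t ^ DIM('a) / t * (\<integral>x. indicator T x * \<bar>G x\<bar> \<partial>lborel)"
      using True by (subst scale) auto
    finally show ?thesis using True pow[of t] by (simp del: times_divide_eq_left)
  qed (simp add: H_def)
  have pow_int: "has_bochner_integral lborel (\<lambda>t. indicator {0<..1} t * t ^ (DIM('a) - 1)) (1 / DIM('a))"
  proof -
    have "has_bochner_integral lborel (\<lambda>t. t ^ (DIM('a) - 1) * indicator {0..1} t) (1 ^ DIM('a) / DIM('a) - 0 ^ DIM('a) / DIM('a) :: real)"
      by (rule has_bochner_integral_FTC_Icc_real)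
        (auto intro!: derivative_eq_intros continuous_intros)
    moreover have "AE t in lborel. (t::real) ^ (DIM('a) - 1) * indicator {0..1} t = indicator {0<..1} t * t ^ (DIM('a) - 1)"
      using AE_lborel_singleton[of "0::real"] by eventually_elim (auto simp: indicator_def)
    ultimately show ?thesis
      by (subst (asm) has_bochner_integral_cong_AE) (auto simp: zero_power)
  qed
  have Hint: "integrable (lborel \<Otimes>\<^sub>M lborel) (case_prod H)"
  proof (rule lborel_pair.Fubini_integrable[OF Hm])
    show "integrable lborel (\<lambda>t. \<integral>x. norm (case_prod H (t, x)) \<partial>lborel)"
      unfolding prod.case inner_norm using pow_int by (simp add: has_bochner_integral_iff)
    show "AE t in lborel. integrable lborel (\<lambda>x. case_prod H (t, x))"
    proof (intro AE_I2)
      fix t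
      show "integrable lborel (\<lambda>x. case_prod H (t, x))"
      proof (cases "t \<in> {0<..1}")
        case True
        then have "integrable lborel (\<lambda>x. indicator T (q t x) * G (q t x))"
          using scale_int[of "\<lambda>x. indicator T x * G x" t] GT by simp
        then show ?thesis by (simp add: H_def)
      qed (simp add: H_def)
    qed
  qed
  have inner_t: "(\<integral>t. H t x \<partial>lborel) = indicator T x * (\<phi> (proj x) - \<phi> x)" if "x \<noteq> p" for x
  proof (cases "x \<in> T")
    case True
    let ?s = "a \<bullet> (x - p)"
    have s: "0 < ?s" "?s \<le> 1" using cone_cases[OF True that] height_bounds[OF True] by auto
    have D: "((\<lambda>t. - \<phi> (q t x)) has_real_derivative G (q t x) / t) (at t)" if "?s \<le> t" for t
    proof -
      have t: "t > 0" using s that by simp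
      have "((\<lambda>t. q t x) has_derivative (\<lambda>h. - (h / t\<^sup>2) *\<^sub>R (x - p))) (at t)"
        unfolding q_def using t
        by (auto intro!: derivative_eq_intros simp: power2_eq_square field_simps)
      then have "((\<lambda>t. - \<phi> (q t x)) has_derivative (\<lambda>h. - (gradient \<phi> (q t x) \<bullet> (- (h / t\<^sup>2) *\<^sub>R (x - p))))) (at t)"
        by (intro has_derivative_minus has_derivative_compose[OF _ smooth_has_derivative[OF \<phi>]])
      moreover have "- (gradient \<phi> (q t x) \<bullet> (- (h / t\<^sup>2) *\<^sub>R (x - p))) = G (q t x) / t * h" for h
      proof -
        define A where "A = gradient \<phi> (q t x) \<bullet> (x - p)"
        have "q t x - p = (1 / t) *\<^sub>R (x - p)" by (simp add: q_def)
        then have "G (q t x) = A / t" by (simp add: G_def A_def)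
        moreover have "gradient \<phi> (q t x) \<bullet> (- (h / t\<^sup>2) *\<^sub>R (x - p)) = - (h / t\<^sup>2) * A"
          unfolding A_def by (rule inner_scaleR_right)
        ultimately show ?thesis by (simp add: power2_eq_square)
      qed
      ultimately show ?thesis by (simp only: has_field_derivative_def)
    qed
    have c: "isCont (\<lambda>t. G (q t x) / t) t" if "?s \<le> t" for t
    proof -
      have "t \<noteq> 0" using s that by simp
      then have "isCont (\<lambda>t. q t x) t" unfolding q_def by (intro continuous_intros) auto
      moreover have "isCont G z" for z using Gc[of UNIV] by (simp add: continuous_on_eq_continuous_at)
      ultimately have "isCont (\<lambda>t. G (q t x)) t" by (rule isCont_o2)
      then show ?thesis by (rule isCont_divide[OF _ continuous_ident \<open>t \<noteq> 0\<close>])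
    qed
    have "(\<integral>t. G (q t x) / t * indicator {?s..1} t \<partial>lborel) = - \<phi> (q 1 x) - - \<phi> (q ?s x)"
      by (rule integral_FTC_Icc_real) (use s D c in auto)
    also have "\<dots> = \<phi> (proj x) - \<phi> x" by (simp add: q_def proj_def)
    also have "(\<integral>t. G (q t x) / t * indicator {?s..1} t \<partial>lborel) = (\<integral>t. H t x \<partial>lborel)"
    proof (rule Bochner_Integration.integral_cong[OF refl])
      fix t
      show "G (q t x) / t * indicator {?s..1} t = H t x"
      proof (cases "0 < t \<and> t \<le> 1")
        case t: True
        then have "q t x \<in> T \<longleftrightarrow> ?s \<le> t" unfolding q_def by (intro ray_mem_cone True that) auto
        then show ?thesis using t by (simp add: H_def indicator_def)
      qed (use s in \<open>auto simp: H_def indicator_def\<close>)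
    qed
    finally show ?thesis using True by simp
  next
    case False
    then have "H t x = 0" for t
      using ray_mem_coneD[of t x] by (auto simp: H_def q_def indicator_def)
    then show ?thesis using False by simp
  qed
  have \<phi>T: "integrable lborel (\<lambda>x. indicator T x * \<phi> x)"
    by (rule integrable_cone[of _ B']) (use B' in auto)
  have pT: "integrable lborel (\<lambda>x. indicator T x * \<phi> (proj x))"
    by (rule integrable_cone[of _ B']) (use B' proj_in_cone in auto)
  have "(\<integral>x. indicator T x * \<phi> (proj x) \<partial>lborel) - (\<integral>x. indicator T x * \<phi> x \<partial>lborel) =
      (\<integral>x. indicator T x * (\<phi> (proj x) - \<phi> x) \<partial>lborel)"
    by (subst Bochner_Integration.integral_diff[symmetric]) (use \<phi>T pT in \<open>auto simp: right_diff_distrib\<close>)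
  also have "\<dots> = (\<integral>x. \<integral>t. H t x \<partial>lborel \<partial>lborel)"
  proof (rule integral_cong_AE)
    show "AE x in lborel. indicator T x * (\<phi> (proj x) - \<phi> x) = (\<integral>t. H t x \<partial>lborel)"
      using AE_lborel_singleton[of p] by eventually_elim (simp add: inner_t)
    show "(\<lambda>x. \<integral>t. H t x \<partial>lborel) \<in> borel_measurable lborel"
      by (rule lborel.borel_measurable_lebesgue_integral)
        (use measurable_compose[OF measurable_pair_swap' Hm] in \<open>simp add: case_prod_unfold\<close>)
  qed simp
  also have "\<dots> = (\<integral>t. \<integral>x. H t x \<partial>lborel \<partial>lborel)"
    by (rule lborel_pair.Fubini_integral[OF Hint])
  also have "\<dots> = (1 / DIM('a)) * (\<integral>x. indicator T x * G x \<partial>lborel)"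
    unfolding inner_x using pow_int by (simp add: has_bochner_integral_iff)
  finally have "(\<integral>x. indicator T x * \<phi> (proj x) \<partial>lborel) =
      (\<integral>x. indicator T x * \<phi> x \<partial>lborel) + (1 / DIM('a)) * (\<integral>x. indicator T x * G x \<partial>lborel)"
    by simp
  also have "\<dots> = (\<integral>x. indicator T x * \<phi> x + (1 / DIM('a)) * (indicator T x * G x) \<partial>lborel)"
    using \<phi>T GT by simp
  also have "\<dots> = (\<integral>x. indicator T x * (\<phi> x + (1 / DIM('a)) * (gradient \<phi> x \<bullet> (x - p))) \<partial>lborel)"
    by (simp add: G_def algebra_simps)
  finally show ?thesis .
qed

end

text \<open>The affine map that fixes the base and moves one apex to the other carries the first cone to the
  second and commutes with the radial projections, so corresponding points have the same projection.\<close>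

lemma cone_average_indep_nn:
  fixes f :: "'a::euclidean_space \<Rightarrow> ennreal"
  assumes c: "cone p a S T" and c': "cone p' a' S T'" and int: "interior T' \<noteq> {}"
    and f [measurable]: "f \<in> borel_measurable borel"
  shows "(\<integral>\<^sup>+x. indicator T x * f (cone.proj p a x) \<partial>lborel) * emeasure lborel T' =
    (\<integral>\<^sup>+x. indicator T' x * f (cone.proj p' a' x) \<partial>lborel) * emeasure lborel T"
proof -
  interpret C: cone p a S T by fact
  interpret C': cone p' a' S T' by fact
  define k where "k = p' - p"
  define M where "M v = v - (a \<bullet> v) *\<^sub>R k" for v
  define A where "A x = M x + (1 + a \<bullet> p) *\<^sub>R k" for x
  have M: "linear M"
    by (rule linearI) (auto simp: M_def algebra_simps)
  have A_ray: "A (p + t *\<^sub>R (y - p)) = p' + t *\<^sub>R (y - p')" if "y \<in> S" for t y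
  proof -
    have "a \<bullet> y = 1 + a \<bullet> p" using C.height_base[OF that] by (simp add: inner_diff_right)
    then have "A (p + t *\<^sub>R (y - p)) = p + t *\<^sub>R (y - p) + (1 - t) *\<^sub>R k"
      by (simp add: A_def M_def algebra_simps)
    also have "\<dots> = p' + t *\<^sub>R (y - p')" by (simp add: k_def algebra_simps)
    finally show ?thesis .
  qed
  have ak: "a \<bullet> k \<noteq> 1"
  proof
    assume k1: "a \<bullet> k = 1"
    have "T' \<subseteq> {x. a \<bullet> x = 1 + a \<bullet> p}"
    proof
      fix x assume "x \<in> T'"
      then obtain t y where x: "y \<in> S" "x = p' + t *\<^sub>R (y - p')" by (rule C'.mem_coneE)
      have "a \<bullet> y = 1 + a \<bullet> p" "a \<bullet> p' = 1 + a \<bullet> p"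
        using C.height_base[OF x(1)] k1 by (auto simp: k_def inner_diff_right)
      then show "x \<in> {x. a \<bullet> x = 1 + a \<bullet> p}"
        by (simp add: x(2) inner_add_right inner_diff_right)
    qed
    moreover have "a \<noteq> 0" using k1 by auto
    ultimately show False
      using int interior_mono interior_hyperplane by (metis subset_empty)
  qed
  have inj: "inj M"
  proof (subst linear_injective_0[OF M], intro allI impI)
    fix v assume "M v = 0"
    then have v: "v = (a \<bullet> v) *\<^sub>R k" by (simp add: M_def)
    then have "a \<bullet> v = (a \<bullet> v) * (a \<bullet> k)" by (metis inner_scaleR_right)
    then have "a \<bullet> v = 0" using ak by simp
    then show "v = 0" using v by simp
  qed
  have A_inj: "A x = A y \<Longrightarrow> x = y" for x y
    using inj by (simp add: A_def inj_eq)
  have A_T: "A x \<in> T' \<longleftrightarrow> x \<in> T" for x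
  proof
    assume "x \<in> T"
    then obtain t y where "0 \<le> t" "t \<le> 1" "y \<in> S" "x = p + t *\<^sub>R (y - p)" by (rule C.mem_coneE)
    then show "A x \<in> T'" using A_ray C'.mem_coneI by simp
  next
    assume "A x \<in> T'"
    then obtain t y where t: "0 \<le> t" "t \<le> 1" "y \<in> S" "A x = p' + t *\<^sub>R (y - p')" by (rule C'.mem_coneE)
    then have "x = p + t *\<^sub>R (y - p)" using A_ray A_inj by metis
    then show "x \<in> T" using t C.mem_coneI by simp
  qed
  have A_proj: "C'.proj (A x) = C.proj x" if "x \<in> T" "x \<noteq> p" for x
  proof -
    note x = C.cone_cases[OF that]
    have "A x = p' + (a \<bullet> (x - p)) *\<^sub>R (C.proj x - p')"
      by (subst (1) x(3)) (rule A_ray[OF x(2)])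
    then show ?thesis using C'.proj_ray[OF x(2,1)] by simp
  qed
  have "(\<integral>\<^sup>+x. indicator T' (M x + (1 + a \<bullet> p) *\<^sub>R k) * f (C'.proj (M x + (1 + a \<bullet> p) *\<^sub>R k)) \<partial>lborel)
      * (\<integral>\<^sup>+x. indicator T' x \<partial>lborel) =
    (\<integral>\<^sup>+x. indicator T' x * f (C'.proj x) \<partial>lborel)
      * (\<integral>\<^sup>+x. indicator T' (M x + (1 + a \<bullet> p) *\<^sub>R k) \<partial>lborel)"
    by (rule nn_integral_affine_ratio[OF _ _ M inj]) measurable
  moreover have "indicator T' (M x + (1 + a \<bullet> p) *\<^sub>R k) = (indicator T x :: ennreal)" for x
    using A_T[of x] by (simp add: A_def indicator_def)
  moreover have "(\<integral>\<^sup>+x. indicator T x * f (C'.proj (M x + (1 + a \<bullet> p) *\<^sub>R k)) \<partial>lborel) =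
      (\<integral>\<^sup>+x. indicator T x * f (C.proj x) \<partial>lborel)"
  proof (rule nn_integral_cong_AE)
    show "AE x in lborel. indicator T x * f (C'.proj (M x + (1 + a \<bullet> p) *\<^sub>R k)) = indicator T x * f (C.proj x)"
      using AE_lborel_singleton[of p]
      by eventually_elim (use A_proj in \<open>auto simp: indicator_def A_def\<close>)
  qed
  ultimately show ?thesis by simp
qed

lemma cone_average_indep:
  fixes \<phi> :: "'a::euclidean_space \<Rightarrow> real"
  assumes c: "cone p a S T" and c': "cone p' a' S T'" and int: "interior T' \<noteq> {}"
    and \<phi>: "continuous_on UNIV \<phi>"
  shows "(\<integral>x. indicator T x * \<phi> (cone.proj p a x) \<partial>lborel) * measure lborel T' =
    (\<integral>x. indicator T' x * \<phi> (cone.proj p' a' x) \<partial>lborel) * measure lborel T"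
proof -
  interpret C: cone p a S T by fact
  interpret C': cone p' a' S T' by fact
  have [measurable]: "\<phi> \<in> borel_measurable borel" by (intro borel_measurable_continuous_onI \<phi>)
  have i: "integrable lborel (\<lambda>x. indicator T x * \<phi> (C.proj x))"
    by (rule C.continuous_bounded_on_cone[OF \<phi>], rule C.integrable_cone) (use C.proj_in_cone in auto)
  have i': "integrable lborel (\<lambda>x. indicator T' x * \<phi> (C'.proj x))"
    by (rule C'.continuous_bounded_on_cone[OF \<phi>], rule C'.integrable_cone) (use C'.proj_in_cone in auto)
  have split: "ennreal (indicator X x * r) = indicator X x * ennreal r"
    "ennreal (- (indicator X x * r)) = indicator X x * ennreal (- r)" for X :: "'a set" and x r
    by (auto simp: indicator_def)
  have "enn2real (\<integral>\<^sup>+x. indicator T x * ennreal (s * \<phi> (C.proj x)) \<partial>lborel) * measure lborel T' =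
    enn2real (\<integral>\<^sup>+x. indicator T' x * ennreal (s * \<phi> (C'.proj x)) \<partial>lborel) * measure lborel T" for s
  proof -
    have "(\<lambda>x. ennreal (s * \<phi> x)) \<in> borel_measurable borel" by measurable
    from arg_cong[OF cone_average_indep_nn[OF c c' int this], of enn2real]
    show ?thesis by (simp add: enn2real_mult measure_def)
  qed
  from this[of 1] this[of "-1"] show ?thesis
    unfolding real_lebesgue_integral_def[OF i] real_lebesgue_integral_def[OF i'] split
    by (simp add: left_diff_distrib)
qed

section \<open>Radial projection and Hausdorff measure\<close>

text \<open>\<open>measure_of\<close> yields the zero measure unless the given set function is a measure. Hence a set of
  positive measure certifies that the Hausdorff outer measure is one on the Borel sets.\<close>

lemma emeasure_hausdorff_measure:
  fixes X A :: "'a::metric_space set"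
  assumes "emeasure (hausdorff_measure s) X > 0" and A: "A \<in> sets borel"
  shows "emeasure (hausdorff_measure s) A = hausdorff_outer s A"
proof -
  have "measure_space UNIV (sigma_sets UNIV (sets borel)) (hausdorff_outer s :: 'a set \<Rightarrow> ennreal)"
    using assms(1) unfolding hausdorff_measure_def by (simp add: emeasure_measure_of_conv split: if_splits)
  then show ?thesis
    using A unfolding hausdorff_measure_def
    by (simp add: emeasure_measure_of_conv sets.sigma_sets_eq[of borel, simplified] del: if_split)
qed

lemma sets_hausdorff_measure [simp, measurable_cong]: "sets (hausdorff_measure s) = sets borel"
  unfolding hausdorff_measure_def by (simp add: sets_measure_of_conv sets.sigma_sets_eq[of borel, simplified])

lemma space_hausdorff_measure [simp]: "space (hausdorff_measure s) = UNIV"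
  unfolding hausdorff_measure_def by (simp add: space_measure_of_conv)

definition tube :: "'a::euclidean_space \<Rightarrow> 'a \<Rightarrow> real \<Rightarrow> 'a set" where
  "tube p e r = {p + t *\<^sub>R e + z | t z. 0 \<le> t \<and> t \<le> 1 \<and> norm z \<le> r}"

lemma compact_tube: "compact (tube p e r)"
proof -
  have "tube p e r = (\<lambda>(t, z). p + t *\<^sub>R e + z) ` ({0..1} \<times> cball 0 r)"
    by (force simp: tube_def)
  then show ?thesis
    by (auto simp: case_prod_unfold intro!: compact_continuous_image compact_Times continuous_intros)
qed

lemma tube_mono: "r \<le> r' \<Longrightarrow> tube p e r \<subseteq> tube p e r'"
  unfolding tube_def by fastforce

text \<open>A segment of length at most \<open>L\<close> is covered by about \<open>L / r\<close> balls of radius \<open>r\<close>, and the tube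
  around it by the balls of radius \<open>2 r\<close> with the same centres.\<close>

lemma emeasure_tube_pos:
  fixes p e :: "'a::euclidean_space"
  assumes "norm e \<le> L" "0 < r" "r \<le> L"
  shows "emeasure lborel (tube p e r) \<le>
    ennreal (unit_ball_vol (DIM('a)) * 2 ^ DIM('a) * 3 * L * r ^ (DIM('a) - 1))"
proof -
  define N where "N = nat \<lceil>L / r\<rceil>"
  have N: "L / r \<le> real N" "real N \<le> L / r + 1" "N > 0"
    using assms by (auto simp: N_def intro: real_nat_ceiling_ge)
  define B where "B j = cball (p + (real j / real N) *\<^sub>R e) (2 * r)" for j
  have "tube p e r \<subseteq> (\<Union>j\<le>N. B j)"
  proof
    fix x assume "x \<in> tube p e r"
    then obtain t z where x: "x = p + t *\<^sub>R e + z" "0 \<le> t" "t \<le> 1" "norm z \<le> r" by (auto simp: tube_def)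
    define j where "j = nat \<lfloor>t * N\<rfloor>"
    have j: "real j \<le> t * N" "t * N \<le> real j + 1" using x(2) by (auto simp: j_def)
    have "real j \<le> real N" using j(1) x(3) by (smt (verit) mult_left_le_one_le of_nat_0_le_iff x(2))
    then have jN: "j \<le> N" by simp
    have "t - real j / real N = (t * N - real j) / real N" using N(3) by (simp add: field_simps)
    then have d: "\<bar>t - real j / real N\<bar> \<le> 1 / real N" using j by (simp add: divide_right_mono)
    have "norm (x - (p + (real j / real N) *\<^sub>R e)) = norm ((t - real j / real N) *\<^sub>R e + z)"
      by (simp add: x(1) algebra_simps)
    also have "\<dots> \<le> \<bar>t - real j / real N\<bar> * norm e + norm z" by (metis norm_scaleR norm_triangle_ineq)
    also have "\<dots> \<le> (1 / real N) * L + r"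
      using d assms x(4) by (intro add_mono mult_mono) auto
    also have "\<dots> \<le> 2 * r" using N assms by (simp add: field_simps)
    finally have "x \<in> B j" by (simp add: B_def dist_norm norm_minus_commute)
    then show "x \<in> (\<Union>j\<le>N. B j)" using jN by blast
  qed
  then have "emeasure lborel (tube p e r) \<le> emeasure lborel (\<Union>j\<le>N. B j)"
    by (rule emeasure_mono) (auto simp: B_def)
  also have "\<dots> \<le> (\<Sum>j\<le>N. emeasure lborel (B j))"
    by (rule emeasure_subadditive_finite) (auto simp: B_def)
  also have "\<dots> = (\<Sum>j\<le>N. ennreal (unit_ball_vol (DIM('a)) * (2 * r) ^ DIM('a)))"
    unfolding B_def using assms by (intro sum.cong refl emeasure_cball) auto
  also have "\<dots> = ennreal ((real N + 1) * (unit_ball_vol (DIM('a)) * (2 * r) ^ DIM('a)))"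
    using assms by (subst sum_ennreal) (auto simp: algebra_simps)
  also have "\<dots> \<le> ennreal (unit_ball_vol (DIM('a)) * 2 ^ DIM('a) * 3 * L * r ^ (DIM('a) - 1))"
  proof (rule ennreal_leI)
    have rd: "r ^ DIM('a) = r * r ^ (DIM('a) - 1)" by (metis DIM_positive power_eq_if less_irrefl)
    have "(real N + 1) * r \<le> (L / r + 2) * r" using N(2) assms by (intro mult_right_mono) auto
    also have "\<dots> \<le> 3 * L" using assms by (simp add: field_simps)
    finally have *: "(real N + 1) * r \<le> 3 * L" .
    have "(real N + 1) * (unit_ball_vol (DIM('a)) * (2 * r) ^ DIM('a)) =
        (unit_ball_vol (DIM('a)) * 2 ^ DIM('a) * r ^ (DIM('a) - 1)) * ((real N + 1) * r)"
      by (simp add: power_mult_distrib rd)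
    also have "\<dots> \<le> (unit_ball_vol (DIM('a)) * 2 ^ DIM('a) * r ^ (DIM('a) - 1)) * (3 * L)"
      using * assms by (intro mult_left_mono) auto
    finally show "(real N + 1) * (unit_ball_vol (DIM('a)) * (2 * r) ^ DIM('a)) \<le>
        unit_ball_vol (DIM('a)) * 2 ^ DIM('a) * 3 * L * r ^ (DIM('a) - 1)" by (simp add: mult_ac)
  qed
  finally show ?thesis .
qed

text \<open>For \<open>r = 0\<close> the bound is the limit of the bounds for positive radii; \<open>0\<^sup>d\<^sup>-\<^sup>1\<close> is \<open>1\<close> for \<open>d = 1\<close>,
  in agreement with Hausdorff measure of dimension \<open>0\<close>, where a point counts \<open>1\<close>.\<close>

lemma emeasure_tube:
  fixes p e :: "'a::euclidean_space"
  assumes "norm e \<le> L" "0 \<le> r" "r \<le> L" "0 < L"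
  shows "emeasure lborel (tube p e r) \<le>
    ennreal (unit_ball_vol (DIM('a)) * 2 ^ DIM('a) * 3 * L * r ^ (DIM('a) - 1))"
proof (cases "r = 0")
  case True
  let ?K = "unit_ball_vol (DIM('a)) * 2 ^ DIM('a) * 3 * L"
  have "((\<lambda>s. ?K * s ^ (DIM('a) - 1)) \<longlongrightarrow> ?K * 0 ^ (DIM('a) - 1)) (at_right 0)"
    by (intro tendsto_intros)
  then have "((\<lambda>s. ennreal (?K * s ^ (DIM('a) - 1))) \<longlongrightarrow> ennreal (?K * 0 ^ (DIM('a) - 1))) (at_right 0)"
    by (rule tendsto_ennrealI)
  moreover have "\<forall>\<^sub>F s in at_right 0. emeasure lborel (tube p e r) \<le> ennreal (?K * s ^ (DIM('a) - 1))"
    unfolding eventually_at_right_field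
  proof (intro exI[of _ L] conjI allI impI assms)
    fix s :: real assume "0 < s" "s < L"
    then have "emeasure lborel (tube p e s) \<le> ennreal (?K * s ^ (DIM('a) - 1))"
      by (intro emeasure_tube_pos assms) auto
    moreover have "emeasure lborel (tube p e r) \<le> emeasure lborel (tube p e s)"
      using True \<open>0 < s\<close> compact_tube[of p e s] by (intro emeasure_mono tube_mono) (auto simp: borel_compact)
    ultimately show "emeasure lborel (tube p e r) \<le> ennreal (?K * s ^ (DIM('a) - 1))" by (rule order_trans[rotated])
  qed
  ultimately show ?thesis using True by (auto intro: tendsto_lowerbound)
next
  case False
  then show ?thesis using emeasure_tube_pos[of e L r p] assms by simp
qed

context cone
begin

definition projection_const :: "real \<Rightarrow> real" where
  "projection_const L = unit_ball_vol (DIM('a)) * 2 ^ DIM('a) * 3 * L /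
     (unit_ball_vol (real (DIM('a) - 1)) / 2 ^ (DIM('a) - 1))"

text \<open>The rays that meet a base set of diameter \<open>r\<close> lie in a tube of radius \<open>r\<close>, of volume
  \<open>O(r\<^sup>d\<^sup>-\<^sup>1)\<close>; hence volumes of cones are dominated by the Hausdorff measure of their bases.\<close>

lemma emeasure_proj_le_hausdorff:
  assumes L: "\<And>y. y \<in> S \<Longrightarrow> norm (y - p) \<le> L" "0 < L"
  shows "emeasure lborel {x \<in> T. x \<noteq> p \<and> proj x \<in> B} \<le>
    ennreal (projection_const L) * hausdorff_outer (DIM('a) - 1) B"
proof -
  let ?X = "emeasure lborel {x \<in> T. x \<noteq> p \<and> proj x \<in> B}"
  let ?v = "unit_ball_vol (real (DIM('a) - 1)) / 2 ^ (DIM('a) - 1)"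
  let ?C = "projection_const L"
  have v: "?v > 0" by simp
  have cancel: "c / b * b = c" if "0 < b" for b c :: real using that by simp
  have Cv: "?C * ?v = unit_ball_vol (DIM('a)) * 2 ^ DIM('a) * 3 * L"
    unfolding projection_const_def by (rule cancel[OF v])
  have C: "?C > 0" using L(2) v unfolding projection_const_def by (intro divide_pos_pos mult_pos_pos) auto
  have "ennreal (1 / ?C) * ?X \<le> hausdorff_premeasure (DIM('a) - 1) L B"
    unfolding hausdorff_premeasure_def
  proof (rule INF_greatest)
    fix D assume "D \<in> {C :: nat \<Rightarrow> 'a set. B \<subseteq> (\<Union>i. C i) \<and> (\<forall>i. bounded (C i) \<and> diameter (C i) \<le> L)}"
    then have D: "B \<subseteq> (\<Union>i. D i)" "\<And>i. bounded (D i)" "\<And>i. diameter (D i) \<le> L" by auto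
    define y where "y i = (SOME y. y \<in> D i \<inter> S)" for i
    define E where "E i = (if D i \<inter> S = {} then {} else tube p (y i - p) (diameter (D i)))" for i
    let ?t = "\<lambda>i. if D i = {} then 0 else ennreal (?v * diameter (D i) ^ (DIM('a) - 1))"
    have y: "y i \<in> D i" "y i \<in> S" if "D i \<inter> S \<noteq> {}" for i
      using some_in_eq[of "D i \<inter> S"] that unfolding y_def by auto
    have Em: "E i \<in> sets lborel" for i
      unfolding E_def using compact_tube[of p "y i - p" "diameter (D i)"] by (auto simp: borel_compact)
    have "{x \<in> T. x \<noteq> p \<and> proj x \<in> B} \<subseteq> (\<Union>i. E i)"
    proof
      fix x assume x: "x \<in> {x \<in> T. x \<noteq> p \<and> proj x \<in> B}"
      then have xT: "x \<in> T" "x \<noteq> p" by auto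
      obtain i where i: "proj x \<in> D i" using x D(1) by auto
      note c = cone_cases[OF xT]
      have ne: "D i \<inter> S \<noteq> {}" using i c by auto
      let ?s = "a \<bullet> (x - p)"
      have s: "0 \<le> ?s" "?s \<le> 1" using height_bounds[OF xT(1)] by auto
      define z where "z = ?s *\<^sub>R (proj x - y i)"
      have "norm (proj x - y i) \<le> diameter (D i)"
        using diameter_bounded_bound[OF D(2)[of i] i y(1)[OF ne]] by (simp add: dist_norm)
      then have "norm z \<le> diameter (D i)"
        using s mult_mono[of ?s 1 "norm (proj x - y i)" "diameter (D i)"] by (simp add: z_def)
      moreover have "x = p + ?s *\<^sub>R (y i - p) + z"
        by (subst (1) c(3)) (simp add: z_def algebra_simps)
      ultimately have "x \<in> E i" unfolding E_def tube_def using ne s by auto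
      then show "x \<in> (\<Union>i. E i)" by blast
    qed
    then have "?X \<le> emeasure lborel (\<Union>i. E i)"
      using Em by (intro emeasure_mono) auto
    also have "\<dots> \<le> (\<Sum>i. emeasure lborel (E i))"
      using Em by (intro emeasure_subadditive_countably) auto
    also have "\<dots> \<le> (\<Sum>i. ennreal ?C * ?t i)"
    proof (intro suminf_le allI)
      fix i
      show "emeasure lborel (E i) \<le> ennreal ?C * ?t i"
      proof (cases "D i \<inter> S = {}")
        case False
        have "emeasure lborel (E i) \<le> ennreal (unit_ball_vol (DIM('a)) * 2 ^ DIM('a) * 3 * L * diameter (D i) ^ (DIM('a) - 1))"
          using emeasure_tube[OF L(1)[OF y(2)[OF False]] diameter_ge_0[OF D(2)[of i]] D(3)[of i] L(2), of p] False
          by (simp add: E_def)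
        also have "unit_ball_vol (DIM('a)) * 2 ^ DIM('a) * 3 * L * diameter (D i) ^ (DIM('a) - 1) = ?C * (?v * diameter (D i) ^ (DIM('a) - 1))"
          unfolding Cv[symmetric] by (simp only: mult.assoc)
        also have "ennreal \<dots> = ennreal ?C * ennreal (?v * diameter (D i) ^ (DIM('a) - 1))"
          using C by (intro ennreal_mult') auto
        also have "\<dots> = ennreal ?C * ?t i" using False by auto
        finally show ?thesis .
      qed (simp add: E_def)
    qed auto
    also have "\<dots> = ennreal ?C * (\<Sum>i. ?t i)" by (rule ennreal_suminf_cmult)
    finally have "ennreal (1 / ?C) * ?X \<le> ennreal (1 / ?C) * (ennreal ?C * (\<Sum>i. ?t i))"
      by (rule mult_left_mono) simp
    also have "\<dots> = (\<Sum>i. ?t i)"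
      using C by (simp add: mult.assoc[symmetric] ennreal_mult'[symmetric])
    finally show "ennreal (1 / ?C) * ?X \<le> (\<Sum>i. ?t i)" .
  qed
  also have "\<dots> \<le> hausdorff_outer (DIM('a) - 1) B"
    unfolding hausdorff_outer_def using L(2) by (intro SUP_upper) auto
  finally have "ennreal ?C * (ennreal (1 / ?C) * ?X) \<le> ennreal ?C * hausdorff_outer (DIM('a) - 1) B"
    by (rule mult_left_mono) simp
  then show ?thesis using C by (simp add: mult.assoc[symmetric] ennreal_mult'[symmetric])
qed

text \<open>The preceding bound says that the image of Lebesgue measure on the cone under \<open>proj\<close> is at most a
  multiple of Hausdorff measure on the base; integrals of nonnegative functions inherit it. The apex is
  removed because \<open>proj\<close> maps it to itself, outside the base.\<close>

lemma proj_integral_le_hausdorff: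
  assumes pos: "emeasure (hausdorff_measure (DIM('a) - 1)) (X::'a set) > 0"
  obtains C :: real where "0 \<le> C"
    "\<And>f. f \<in> borel_measurable borel \<Longrightarrow> (\<integral>\<^sup>+x. indicator T x * f (proj x) \<partial>lborel) \<le>
       ennreal C * (\<integral>\<^sup>+y. indicator S y * f y \<partial>hausdorff_measure (DIM('a) - 1))"
proof -
  let ?H = "hausdorff_measure (DIM('a) - 1) :: 'a measure"
  have [measurable]: "S \<in> sets borel" using compact_base by (simp add: borel_compact)
  obtain b where b: "\<And>y. y \<in> (\<lambda>y. y - p) ` S \<Longrightarrow> norm y \<le> b"
    using compact_imp_bounded[OF compact_continuous_image[OF _ compact_base, of "\<lambda>y. y - p"]]
    by (auto simp: bounded_iff continuous_on_diff)
  define L where "L = max b 1"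
  have L: "\<And>y. y \<in> S \<Longrightarrow> norm (y - p) \<le> L" "0 < L" using b by (force simp: L_def)+
  let ?C = "projection_const L"
  have C: "?C \<ge> 0" unfolding projection_const_def using L(2) by simp
  define \<mu> where "\<mu> = distr (density lborel (indicator (T - {p}))) borel proj"
  define \<nu> where "\<nu> = scale_measure (ennreal ?C) (density ?H (indicator S))"
  have "\<mu> \<le> \<nu>"
  proof (subst le_measure)
    show s: "sets \<mu> = sets \<nu>" by (simp add: \<mu>_def \<nu>_def)
    show "\<forall>A\<in>sets \<mu>. emeasure \<mu> A \<le> emeasure \<nu> A"
    proof
      fix A assume "A \<in> sets \<mu>"
      then have A [measurable]: "A \<in> sets borel" by (simp add: \<mu>_def)
      have "emeasure \<mu> A = emeasure (density lborel (indicator (T - {p}))) (proj -` A)"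
        unfolding \<mu>_def by (subst emeasure_distr) auto
      also have "\<dots> = emeasure lborel ((T - {p}) \<inter> proj -` A)"
      proof -
        have "proj -` A \<in> sets lborel" using measurable_sets[OF proj_measurable A] by simp
        then show ?thesis by (subst emeasure_density) (auto simp: indicator_inter_arith[symmetric])
      qed
      also have "(T - {p}) \<inter> proj -` A = {x \<in> T. x \<noteq> p \<and> proj x \<in> A \<inter> S}"
        using cone_cases by auto
      also have "emeasure lborel \<dots> \<le> ennreal ?C * hausdorff_outer (DIM('a) - 1) (A \<inter> S)"
        by (rule emeasure_proj_le_hausdorff[OF L])
      also have "hausdorff_outer (DIM('a) - 1) (A \<inter> S) = emeasure ?H (A \<inter> S)"
        by (rule emeasure_hausdorff_measure[OF pos, symmetric]) auto
      also have "ennreal ?C * \<dots> = emeasure \<nu> A"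
        unfolding \<nu>_def by (simp add: emeasure_density indicator_inter_arith[symmetric] Int_commute)
      finally show "emeasure \<mu> A \<le> emeasure \<nu> A" .
    qed
  qed
  have "(\<integral>\<^sup>+x. indicator T x * f (proj x) \<partial>lborel) \<le> ennreal ?C * (\<integral>\<^sup>+y. indicator S y * f y \<partial>?H)"
    if [measurable]: "f \<in> borel_measurable borel" for f
  proof -
    have "(\<integral>\<^sup>+x. indicator T x * f (proj x) \<partial>lborel) = (\<integral>\<^sup>+x. indicator (T - {p}) x * f (proj x) \<partial>lborel)"
      by (rule nn_integral_cong_AE, use AE_lborel_singleton[of p] in eventually_elim) (auto simp: indicator_def)
    also have "\<dots> = (\<integral>\<^sup>+y. f y \<partial>\<mu>)"
      unfolding \<mu>_def by (simp add: nn_integral_distr nn_integral_density)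
    also have "\<dots> \<le> (\<integral>\<^sup>+y. f y \<partial>\<nu>)"
      by (rule nn_integral_mono_measure[OF _ \<open>\<mu> \<le> \<nu>\<close>]) (simp add: \<mu>_def \<nu>_def)
    also have "\<dots> = ennreal ?C * (\<integral>\<^sup>+y. indicator S y * f y \<partial>?H)"
      unfolding \<nu>_def by (subst nn_integral_scale_measure) (auto simp: nn_integral_density)
    finally show ?thesis .
  qed
  then show ?thesis using that C by blast
qed

end

section \<open>Poincare inequality on convex sets\<close>

lemma integrable_compact_indicator:
  fixes f :: "'a::euclidean_space \<Rightarrow> real"
  assumes "compact T" "continuous_on UNIV f"
  shows "integrable lborel (\<lambda>x. indicator T x * f x)"
  using borel_integrable_compact[OF assms(1) continuous_on_subset[OF assms(2)]] by simp

lemma square_integral_le: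
  fixes h :: "'a::euclidean_space \<Rightarrow> real"
  assumes T: "compact T" and h [measurable]: "h \<in> borel_measurable borel"
    and int: "integrable lborel (\<lambda>x. indicator T x * (h x)\<^sup>2)"
  shows "(\<integral>x. indicator T x * h x \<partial>lborel)\<^sup>2 \<le> measure lborel T * (\<integral>x. indicator T x * (h x)\<^sup>2 \<partial>lborel)"
proof -
  have [measurable]: "T \<in> sets borel" using T by (rule borel_compact)
  have fin: "emeasure lborel T < \<infinity>" by (rule emeasure_bounded_finite[OF compact_imp_bounded[OF T]])
  have sq: "(indicat_real T x)\<^sup>2 = indicator T x" for x by (simp add: indicator_def)
  have 1: "indicat_real T \<in> L2 lborel"
    by (rule L2_I) (use fin in \<open>auto simp: sq\<close>)
  have 2: "(\<lambda>x. indicator T x * h x) \<in> L2 lborel"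
    by (rule L2_I) (use int in \<open>auto simp: power_mult_distrib sq\<close>)
  have "(L2_inner lborel (indicat_real T) (\<lambda>x. indicator T x * h x))\<^sup>2 \<le>
      (L2_norm lborel (indicat_real T) * L2_norm lborel (\<lambda>x. indicator T x * h x))\<^sup>2"
    using L2_Cauchy_Schwarz[OF 1 2] by (simp only: abs_le_square_iff[symmetric] abs_mult abs_of_nonneg L2_norm_nonneg)
  moreover have "L2_inner lborel (indicat_real T) (\<lambda>x. indicator T x * h x) = (\<integral>x. indicator T x * h x \<partial>lborel)"
    unfolding L2_inner_def by (rule Bochner_Integration.integral_cong) (auto simp: indicator_def)
  ultimately show ?thesis
    by (simp add: power_mult_distrib L2_norm_sq sq)
qed

lemma square_integral_compact_le:
  fixes h :: "'a::euclidean_space \<Rightarrow> real"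
  assumes "compact T" "continuous_on UNIV h"
  shows "(\<integral>x. indicator T x * h x \<partial>lborel)\<^sup>2 \<le> measure lborel T * (\<integral>x. indicator T x * (h x)\<^sup>2 \<partial>lborel)"
  by (rule square_integral_le[OF assms(1) borel_measurable_continuous_onI[OF assms(2)]
        integrable_compact_indicator[OF assms(1) continuous_on_power[OF assms(2)]]])

text \<open>The substitution \<open>z = (1 - t) x + t y\<close> maps the convex set into itself and has the Jacobian
  \<open>t\<^sup>d \<ge> 2\<^sup>-\<^sup>d\<close>.\<close>

lemma nn_integral_scale_into_convex:
  fixes f :: "'a::euclidean_space \<Rightarrow> ennreal"
  assumes T: "convex T" "T \<in> sets borel" and f: "f \<in> borel_measurable borel"
    and x: "x \<in> T" and t: "1 / 2 \<le> t" "t \<le> 1"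
  shows "(\<integral>\<^sup>+y. indicator T y * f ((1 - t) *\<^sub>R x + t *\<^sub>R y) \<partial>lborel) \<le>
    ennreal (2 ^ DIM('a)) * (\<integral>\<^sup>+z. indicator T z * f z \<partial>lborel)"
proof -
  note [measurable] = T(2) f
  let ?g = "\<lambda>z. indicator T z * f z"
  have "(\<integral>\<^sup>+y. indicator T y * f ((1 - t) *\<^sub>R x + t *\<^sub>R y) \<partial>lborel) \<le> (\<integral>\<^sup>+y. ?g ((1 - t) *\<^sub>R x + t *\<^sub>R y) \<partial>lborel)"
    by (rule nn_integral_mono) (use convexD_alt[OF T(1) x _] t in \<open>auto simp: indicator_def\<close>)
  also have "\<dots> \<le> ennreal ((2 * t) ^ DIM('a)) * (\<integral>\<^sup>+y. ?g ((1 - t) *\<^sub>R x + t *\<^sub>R y) \<partial>lborel)"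
  proof -
    have "1 \<le> ennreal ((2 * t) ^ DIM('a))" 
      using t by (subst ennreal_1[symmetric], intro ennreal_leI one_le_power) auto
    then show ?thesis using mult_right_mono[of 1] by fastforce
  qed
  also have "\<dots> = ennreal (2 ^ DIM('a)) * (ennreal (\<bar>t\<bar> ^ DIM('a)) * (\<integral>\<^sup>+y. ?g ((1 - t) *\<^sub>R x + t *\<^sub>R y) \<partial>lborel))"
    using t by (simp add: power_mult_distrib ennreal_mult mult.assoc)
  also have "ennreal (\<bar>t\<bar> ^ DIM('a)) * (\<integral>\<^sup>+y. ?g ((1 - t) *\<^sub>R x + t *\<^sub>R y) \<partial>lborel) = (\<integral>\<^sup>+z. ?g z \<partial>lborel)"
    using t by (intro nn_integral_lborel_scale[symmetric]) auto
  finally show ?thesis .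
qed

text \<open>Fundamental theorem of calculus along the segment from \<open>x\<close> to \<open>y\<close>, and Jensen's inequality.\<close>

lemma square_increment_le:
  fixes \<phi> :: "'a::euclidean_space \<Rightarrow> real"
  assumes \<phi>: "smooth \<phi>"
  shows "ennreal ((\<phi> x - \<phi> y)\<^sup>2) \<le>
    ennreal ((dist x y)\<^sup>2) * (\<integral>\<^sup>+t. indicator {0..1} t * ennreal ((norm (gradient \<phi> ((1 - t) *\<^sub>R x + t *\<^sub>R y)))\<^sup>2) \<partial>lborel)"
proof -
  let ?c = "\<lambda>t. (1 - t) *\<^sub>R x + t *\<^sub>R y"
  let ?h = "\<lambda>t. gradient \<phi> (?c t) \<bullet> (y - x)"
  let ?N = "\<lambda>t. (norm (gradient \<phi> (?c t)))\<^sup>2"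
  have gc: "continuous_on UNIV (\<lambda>t. gradient \<phi> (?c t))"
    by (rule continuous_on_compose2[OF smooth_continuous_gradient[OF \<phi>, of UNIV]]) (auto intro!: continuous_intros)
  have hc: "continuous_on UNIV ?h" and Nc: "continuous_on UNIV ?N"
    using gc by (auto intro!: continuous_intros)
  have D: "((\<lambda>t. \<phi> (?c t)) has_real_derivative ?h t) (at t)" for t
  proof -
    have "(?c has_derivative (\<lambda>h. h *\<^sub>R (y - x))) (at t)"
      by (auto intro!: derivative_eq_intros simp: algebra_simps)
    then have "((\<lambda>t. \<phi> (?c t)) has_derivative (\<lambda>h. gradient \<phi> (?c t) \<bullet> (h *\<^sub>R (y - x)))) (at t)"
      by (rule has_derivative_compose[OF _ smooth_has_derivative[OF \<phi>]])
    moreover have "gradient \<phi> (?c t) \<bullet> (h *\<^sub>R (y - x)) = ?h t * h" for h by simp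
    ultimately show ?thesis by (simp only: has_field_derivative_def)
  qed
  have "(\<integral>t. ?h t * indicator {0..1} t \<partial>lborel) = \<phi> (?c 1) - \<phi> (?c 0)"
    using hc by (intro integral_FTC_Icc_real D) (auto simp: continuous_on_eq_continuous_at)
  then have "(\<phi> x - \<phi> y)\<^sup>2 = (\<integral>t. indicator {0..1} t * ?h t \<partial>lborel)\<^sup>2"
    by (simp add: mult.commute power2_commute)
  also have "\<dots> \<le> (\<integral>t. indicator {0..1} t * (?h t)\<^sup>2 \<partial>lborel)"
    using square_integral_compact_le[OF _ hc, of "{0..1}"] by simp
  also have "\<dots> \<le> (\<integral>t. indicator {0..1} t * ((dist x y)\<^sup>2 * ?N t) \<partial>lborel)"
  proof (rule integral_mono)
    show "integrable lborel (\<lambda>t. indicat_real {0..1} t * (?h t)\<^sup>2)"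
      by (intro integrable_compact_indicator continuous_on_power hc) auto
    show "integrable lborel (\<lambda>t. indicat_real {0..1} t * ((dist x y)\<^sup>2 * ?N t))"
      by (intro integrable_compact_indicator continuous_on_mult continuous_on_const Nc) auto
    fix t
    have "(?h t)\<^sup>2 \<le> (norm (gradient \<phi> (?c t)) * norm (y - x))\<^sup>2"
      using Cauchy_Schwarz_ineq2[of "gradient \<phi> (?c t)" "y - x"] by (metis abs_ge_zero power2_abs power_mono)
    then show "indicat_real {0..1} t * (?h t)\<^sup>2 \<le> indicat_real {0..1} t * ((dist x y)\<^sup>2 * ?N t)"
      by (intro mult_left_mono) (auto simp: power_mult_distrib dist_norm norm_minus_commute mult.commute)
  qed
  also have "\<dots> = (dist x y)\<^sup>2 * (\<integral>t. indicator {0..1} t * ?N t \<partial>lborel)"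
    by (subst integral_mult_right_zero[symmetric]) (simp add: mult_ac)
  finally have "ennreal ((\<phi> x - \<phi> y)\<^sup>2) \<le> ennreal ((dist x y)\<^sup>2) * ennreal (\<integral>t. indicator {0..1} t * ?N t \<partial>lborel)"
    by (subst ennreal_mult[symmetric]) (auto intro: ennreal_leI)
  also have "ennreal (\<integral>t. indicator {0..1} t * ?N t \<partial>lborel) = (\<integral>\<^sup>+t. ennreal (indicator {0..1} t * ?N t) \<partial>lborel)"
    by (rule nn_integral_eq_integral[symmetric]) (auto intro!: integrable_compact_indicator Nc)
  also have "\<dots> = (\<integral>\<^sup>+t. indicator {0..1} t * ennreal (?N t) \<partial>lborel)"
    by (intro nn_integral_cong) (simp add: indicator_def)
  finally show ?thesis .
qed

text \<open>The mean square of \<open>\<phi> x - \<phi> y\<close> is bounded by an integral of \<open>\<bar>\<nabla>\<phi>\<bar>\<^sup>2\<close> over the points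
  \<open>(1 - t) x + t y\<close>. For fixed \<open>t\<close> substitute in \<open>y\<close> if \<open>t \<ge> 1 / 2\<close> and in \<open>x\<close> otherwise, so that the
  factor from the substitution is at most \<open>2\<^sup>d\<close>.\<close>

theorem Poincare_convex:
  fixes \<phi> :: "'a::euclidean_space \<Rightarrow> real"
  assumes T: "convex T" "compact T" and pos: "measure lborel T > 0" and \<phi>: "smooth \<phi>"
    and m: "m = (\<integral>x. indicator T x * \<phi> x \<partial>lborel) / measure lborel T"
  shows "(\<integral>x. indicator T x * (\<phi> x - m)\<^sup>2 \<partial>lborel) \<le>
    2 ^ DIM('a) * (diameter T)\<^sup>2 * (\<integral>x. indicator T x * (norm (gradient \<phi> x))\<^sup>2 \<partial>lborel)"
proof -
  define F where "F z = ennreal ((norm (gradient \<phi> z))\<^sup>2)" for z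
  have c: "continuous_on UNIV \<phi>" "continuous_on UNIV (gradient \<phi>)"
    using smooth_continuous[OF \<phi>] smooth_continuous_gradient[OF \<phi>] by auto
  have [measurable]: "\<phi> \<in> borel_measurable borel" "gradient \<phi> \<in> borel_measurable borel" "T \<in> sets borel"
    using c T by (auto simp: borel_compact intro: borel_measurable_continuous_onI)
  have Fm [measurable]: "F \<in> borel_measurable borel" unfolding F_def by measurable
  let ?i = "\<lambda>x. indicator T x :: ennreal" and ?I = "\<lambda>t. indicator {0..1::real} t :: ennreal"
  let ?V = "measure lborel T"
  let ?J = "\<integral>\<^sup>+z. ?i z * F z \<partial>lborel"
  have fin: "emeasure lborel T < \<infinity>" by (rule emeasure_bounded_finite[OF compact_imp_bounded[OF T(2)]])
  have eV: "emeasure lborel T = ennreal ?V" using fin by (simp add: emeasure_eq_ennreal_measure top.not_eq_extremum)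
  let ?P = "\<lambda>t x y. (1 - t) *\<^sub>R x + t *\<^sub>R y"
  have jensen: "ennreal (?V * (\<phi> x - m)\<^sup>2) \<le> (\<integral>\<^sup>+y. ?i y * ennreal ((\<phi> x - \<phi> y)\<^sup>2) \<partial>lborel)" for x
  proof -
    have cx: "continuous_on UNIV (\<lambda>y. \<phi> x - \<phi> y)" by (intro continuous_intros c)
    have "(\<integral>y. indicator T y * (\<phi> x - \<phi> y) \<partial>lborel) = (\<integral>y. indicator T y * \<phi> x - indicator T y * \<phi> y \<partial>lborel)"
      by (simp add: right_diff_distrib)
    also have "\<dots> = ?V * \<phi> x - (\<integral>y. indicator T y * \<phi> y \<partial>lborel)"
      using integrable_compact_indicator[OF T(2) c(1)] integrable_compact_indicator[OF T(2) continuous_on_const, of "\<phi> x"]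
      by simp
    also have "\<dots> = ?V * (\<phi> x - m)" using pos by (simp add: m right_diff_distrib)
    finally have "(?V * (\<phi> x - m))\<^sup>2 \<le> ?V * (\<integral>y. indicator T y * (\<phi> x - \<phi> y)\<^sup>2 \<partial>lborel)"
      using square_integral_compact_le[OF T(2) cx] by simp
    then have "?V * (?V * (\<phi> x - m)\<^sup>2) \<le> ?V * (\<integral>y. indicator T y * (\<phi> x - \<phi> y)\<^sup>2 \<partial>lborel)"
      by (simp add: power2_eq_square mult_ac)
    then have "ennreal (?V * (\<phi> x - m)\<^sup>2) \<le> ennreal (\<integral>y. indicator T y * (\<phi> x - \<phi> y)\<^sup>2 \<partial>lborel)"
      using pos by (intro ennreal_leI) simp
    also have "\<dots> = (\<integral>\<^sup>+y. ennreal (indicator T y * (\<phi> x - \<phi> y)\<^sup>2) \<partial>lborel)"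
      by (rule nn_integral_eq_integral[symmetric]) (auto intro!: integrable_compact_indicator T continuous_on_power cx)
    also have "\<dots> = (\<integral>\<^sup>+y. ?i y * ennreal ((\<phi> x - \<phi> y)\<^sup>2) \<partial>lborel)"
      by (intro nn_integral_cong) (simp add: indicator_def)
    finally show ?thesis .
  qed
  have Jt: "(\<integral>\<^sup>+x. \<integral>\<^sup>+y. ?i x * (?i y * F (?P t x y)) \<partial>lborel \<partial>lborel) \<le>
      ennreal (2 ^ DIM('a)) * (ennreal ?V * ?J)" if t: "0 \<le> t" "t \<le> 1" for t
  proof (cases "1 / 2 \<le> t")
    case True
    have "(\<integral>\<^sup>+x. \<integral>\<^sup>+y. ?i x * (?i y * F (?P t x y)) \<partial>lborel \<partial>lborel) \<le>
        (\<integral>\<^sup>+x. (ennreal (2 ^ DIM('a)) * ?J) * ?i x \<partial>lborel)"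
    proof (rule nn_integral_mono)
      fix x
      have "(\<integral>\<^sup>+y. ?i x * (?i y * F (?P t x y)) \<partial>lborel) = ?i x * (\<integral>\<^sup>+y. ?i y * F (?P t x y) \<partial>lborel)"
        by (rule nn_integral_cmult) measurable
      also have "\<dots> \<le> (ennreal (2 ^ DIM('a)) * ?J) * ?i x"
        using nn_integral_scale_into_convex[OF T(1) _ Fm _ True t(2), of x]
        by (auto simp: indicator_def)
      finally show "(\<integral>\<^sup>+y. ?i x * (?i y * F (?P t x y)) \<partial>lborel) \<le> (ennreal (2 ^ DIM('a)) * ?J) * ?i x" .
    qed
    also have "\<dots> = (ennreal (2 ^ DIM('a)) * ?J) * ennreal ?V"
      by (simp add: nn_integral_cmult eV)
    finally show ?thesis by (simp add: mult_ac)
  next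
    case False
    have "(\<integral>\<^sup>+x. \<integral>\<^sup>+y. ?i x * (?i y * F (?P t x y)) \<partial>lborel \<partial>lborel) =
        (\<integral>\<^sup>+y. \<integral>\<^sup>+x. ?i x * (?i y * F (?P t x y)) \<partial>lborel \<partial>lborel)"
      by (rule lborel_pair.Fubini'[symmetric]) measurable
    also have "\<dots> \<le> (\<integral>\<^sup>+y. (ennreal (2 ^ DIM('a)) * ?J) * ?i y \<partial>lborel)"
    proof (rule nn_integral_mono)
      fix y
      have "(\<integral>\<^sup>+x. ?i x * (?i y * F (?P t x y)) \<partial>lborel) = (\<integral>\<^sup>+x. ?i y * (?i x * F (?P t x y)) \<partial>lborel)"
        by (simp add: mult_ac)
      also have "\<dots> = ?i y * (\<integral>\<^sup>+x. ?i x * F (?P t x y) \<partial>lborel)"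
        by (rule nn_integral_cmult) measurable
      also have "\<dots> \<le> (ennreal (2 ^ DIM('a)) * ?J) * ?i y"
        using nn_integral_scale_into_convex[OF T(1) _ Fm, of y "1 - t"] False t
        by (auto simp: indicator_def add.commute)
      finally show "(\<integral>\<^sup>+x. ?i x * (?i y * F (?P t x y)) \<partial>lborel) \<le> (ennreal (2 ^ DIM('a)) * ?J) * ?i y" .
    qed
    also have "\<dots> = (ennreal (2 ^ DIM('a)) * ?J) * ennreal ?V"
      by (simp add: nn_integral_cmult eV)
    finally show ?thesis by (simp add: mult_ac)
  qed
  let ?D = "ennreal ((diameter T)\<^sup>2)"
  have "ennreal ?V * (\<integral>\<^sup>+x. ?i x * ennreal ((\<phi> x - m)\<^sup>2) \<partial>lborel) =
      (\<integral>\<^sup>+x. ?i x * ennreal (?V * (\<phi> x - m)\<^sup>2) \<partial>lborel)"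
    by (subst nn_integral_cmult[symmetric]) (auto simp: ennreal_mult' mult_ac)
  also have "\<dots> \<le> (\<integral>\<^sup>+x. ?i x * (\<integral>\<^sup>+y. ?i y * ennreal ((\<phi> x - \<phi> y)\<^sup>2) \<partial>lborel) \<partial>lborel)"
    by (intro nn_integral_mono mult_left_mono jensen) auto
  also have "\<dots> \<le> (\<integral>\<^sup>+x. \<integral>\<^sup>+y. \<integral>\<^sup>+t. ?D * (?I t * (?i x * (?i y * F (?P t x y)))) \<partial>lborel \<partial>lborel \<partial>lborel)"
  proof (rule nn_integral_mono)
    fix x
    have "?i x * (\<integral>\<^sup>+y. ?i y * ennreal ((\<phi> x - \<phi> y)\<^sup>2) \<partial>lborel) = (\<integral>\<^sup>+y. ?i x * (?i y * ennreal ((\<phi> x - \<phi> y)\<^sup>2)) \<partial>lborel)"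
      by (rule nn_integral_cmult[symmetric]) measurable
    also have "\<dots> \<le> (\<integral>\<^sup>+y. \<integral>\<^sup>+t. ?D * (?I t * (?i x * (?i y * F (?P t x y)))) \<partial>lborel \<partial>lborel)"
    proof (rule nn_integral_mono)
      fix y
      show "?i x * (?i y * ennreal ((\<phi> x - \<phi> y)\<^sup>2)) \<le> (\<integral>\<^sup>+t. ?D * (?I t * (?i x * (?i y * F (?P t x y)))) \<partial>lborel)"
      proof (cases "x \<in> T \<and> y \<in> T")
        case True
        then have "dist x y \<le> diameter T"
          using diameter_bounded_bound[OF compact_imp_bounded[OF T(2)]] by blast
        then have "ennreal ((dist x y)\<^sup>2) \<le> ?D" by (intro ennreal_leI power_mono) auto
        then have "ennreal ((\<phi> x - \<phi> y)\<^sup>2) \<le> ?D * (\<integral>\<^sup>+t. ?I t * F (?P t x y) \<partial>lborel)"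
          unfolding F_def by (rule order_trans[OF square_increment_le[OF \<phi>] mult_right_mono]) simp
        also have "\<dots> = (\<integral>\<^sup>+t. ?D * (?I t * F (?P t x y)) \<partial>lborel)"
          by (rule nn_integral_cmult[symmetric]) measurable
        finally show ?thesis using True by simp
      qed auto
    qed
    finally show "?i x * (\<integral>\<^sup>+y. ?i y * ennreal ((\<phi> x - \<phi> y)\<^sup>2) \<partial>lborel) \<le>
      (\<integral>\<^sup>+y. \<integral>\<^sup>+t. ?D * (?I t * (?i x * (?i y * F (?P t x y)))) \<partial>lborel \<partial>lborel)" .
  qed
  also have "\<dots> = (\<integral>\<^sup>+x. \<integral>\<^sup>+t. \<integral>\<^sup>+y. ?D * (?I t * (?i x * (?i y * F (?P t x y)))) \<partial>lborel \<partial>lborel \<partial>lborel)"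
    by (intro nn_integral_cong lborel_pair.Fubini') measurable
  also have "\<dots> = (\<integral>\<^sup>+t. \<integral>\<^sup>+x. \<integral>\<^sup>+y. ?D * (?I t * (?i x * (?i y * F (?P t x y)))) \<partial>lborel \<partial>lborel \<partial>lborel)"
    by (rule lborel_pair.Fubini') measurable
  also have "\<dots> = (\<integral>\<^sup>+t. ?D * (?I t * (\<integral>\<^sup>+x. \<integral>\<^sup>+y. ?i x * (?i y * F (?P t x y)) \<partial>lborel \<partial>lborel)) \<partial>lborel)"
  proof (rule nn_integral_cong)
    fix t
    show "(\<integral>\<^sup>+x. \<integral>\<^sup>+y. ?D * (?I t * (?i x * (?i y * F (?P t x y)))) \<partial>lborel \<partial>lborel) =
        ?D * (?I t * (\<integral>\<^sup>+x. \<integral>\<^sup>+y. ?i x * (?i y * F (?P t x y)) \<partial>lborel \<partial>lborel))"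
      by (simp add: nn_integral_cmult)
  qed
  also have "\<dots> \<le> (\<integral>\<^sup>+t. (?D * (ennreal (2 ^ DIM('a)) * (ennreal ?V * ?J))) * ?I t \<partial>lborel)"
    by (intro nn_integral_mono) (use Jt in \<open>auto simp: indicator_def intro: mult_left_mono\<close>)
  also have "\<dots> = ?D * (ennreal (2 ^ DIM('a)) * (ennreal ?V * ?J))"
    by (subst nn_integral_cmult) auto
  finally have "ennreal ?V * (\<integral>\<^sup>+x. ?i x * ennreal ((\<phi> x - m)\<^sup>2) \<partial>lborel) \<le>
      ?D * (ennreal (2 ^ DIM('a)) * (ennreal ?V * ?J))" .
  moreover have "(\<integral>\<^sup>+x. ?i x * ennreal ((\<phi> x - m)\<^sup>2) \<partial>lborel) = ennreal (\<integral>x. indicator T x * (\<phi> x - m)\<^sup>2 \<partial>lborel)"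
  proof -
    have "(\<integral>\<^sup>+x. ?i x * ennreal ((\<phi> x - m)\<^sup>2) \<partial>lborel) = (\<integral>\<^sup>+x. ennreal (indicator T x * (\<phi> x - m)\<^sup>2) \<partial>lborel)"
      by (intro nn_integral_cong) (simp add: indicator_def)
    also have "\<dots> = ennreal (\<integral>x. indicator T x * (\<phi> x - m)\<^sup>2 \<partial>lborel)"
      by (rule nn_integral_eq_integral) (auto intro!: integrable_compact_indicator T continuous_intros c)
    finally show ?thesis .
  qed
  moreover have "?J = ennreal (\<integral>x. indicator T x * (norm (gradient \<phi> x))\<^sup>2 \<partial>lborel)"
  proof -
    have "?J = (\<integral>\<^sup>+x. ennreal (indicator T x * (norm (gradient \<phi> x))\<^sup>2) \<partial>lborel)"
      unfolding F_def by (intro nn_integral_cong) (simp add: indicator_def)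
    also have "\<dots> = ennreal (\<integral>x. indicator T x * (norm (gradient \<phi> x))\<^sup>2 \<partial>lborel)"
      by (rule nn_integral_eq_integral) (auto intro!: integrable_compact_indicator T continuous_intros c)
    finally show ?thesis .
  qed
  ultimately have "ennreal (?V * (\<integral>x. indicator T x * (\<phi> x - m)\<^sup>2 \<partial>lborel)) \<le>
      ennreal ((diameter T)\<^sup>2 * (2 ^ DIM('a) * (?V * (\<integral>x. indicator T x * (norm (gradient \<phi> x))\<^sup>2 \<partial>lborel))))"
    using pos by (simp add: ennreal_mult')
  then have "?V * (\<integral>x. indicator T x * (\<phi> x - m)\<^sup>2 \<partial>lborel) \<le>
      ?V * (2 ^ DIM('a) * (diameter T)\<^sup>2 * (\<integral>x. indicator T x * (norm (gradient \<phi> x))\<^sup>2 \<partial>lborel))"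
    by (subst (asm) ennreal_le_iff) (auto simp: mult_ac)
  then show ?thesis using pos by simp
qed

section \<open>Simplices as cones\<close>

text \<open>The height functional exists because the edges at the vertex \<open>p\<close> are linearly independent, so that
  it may be prescribed to be \<open>1\<close> on each of them.\<close>

lemma affine_independent_cone:
  fixes C :: "'a::euclidean_space set"
  assumes C: "\<not> affine_dependent C" and p: "p \<in> C" and ne: "C - {p} \<noteq> {}"
  obtains a where "cone p a (convex hull (C - {p})) (convex hull C)"
proof -
  have fin: "finite C" using C by (rule aff_independent_finite)
  have "independent ((\<lambda>x. - p + x) ` (C - {p}))"
    using C affine_dependent_iff_dependent2[OF p] by simp
  then obtain g :: "'a \<Rightarrow> real" where g: "linear g" "\<And>v. v \<in> (\<lambda>x. - p + x) ` (C - {p}) \<Longrightarrow> g v = 1"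
    using linear_independent_extend[of _ "\<lambda>_. 1::real"] by blast
  define a where "a = (\<Sum>b\<in>Basis. g b *\<^sub>R b)"
  have ga: "g v = a \<bullet> v" for v
  proof -
    have "g v = g (\<Sum>b\<in>Basis. (v \<bullet> b) *\<^sub>R b)" by (simp add: euclidean_representation)
    also have "\<dots> = (\<Sum>b\<in>Basis. (v \<bullet> b) * g b)" by (simp add: linear_sum[OF g(1)] linear_scale[OF g(1)])
    also have "\<dots> = a \<bullet> v"
      by (simp add: a_def inner_sum_left inner_sum_right inner_commute mult.commute)
    finally show ?thesis .
  qed
  let ?S = "convex hull (C - {p})"
  have "cone p a ?S (convex hull C)"
  proof
    show "compact ?S" using fin by (simp add: finite_imp_compact_convex_hull)
    have "?S \<subseteq> {y. a \<bullet> y = 1 + a \<bullet> p}"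
    proof (rule hull_minimal)
      show "C - {p} \<subseteq> {y. a \<bullet> y = 1 + a \<bullet> p}"
      proof
        fix q assume "q \<in> C - {p}"
        then have "g (- p + q) = 1" by (intro g(2)) auto
        then show "q \<in> {y. a \<bullet> y = 1 + a \<bullet> p}" by (simp add: ga inner_diff_right)
      qed
    qed (rule convex_hyperplane)
    then show "a \<bullet> (y - p) = 1" if "y \<in> ?S" for y
      using that by (auto simp: inner_diff_right)
    have "convex hull C = convex hull (insert p (C - {p}))" using p by (simp add: insert_absorb)
    also have "\<dots> = (\<lambda>(t, y). p + t *\<^sub>R (y - p)) ` ({0..1} \<times> ?S)"
      unfolding convex_hull_insert[OF ne]
    proof (intro equalityI subsetI)
      fix x assume "x \<in> {x. \<exists>u\<ge>0. \<exists>v\<ge>0. \<exists>b. u + v = 1 \<and> b \<in> ?S \<and> x = u *\<^sub>R p + v *\<^sub>R b}"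
      then obtain u v b where x: "u \<ge> 0" "v \<ge> 0" "u + v = 1" "b \<in> ?S" "x = u *\<^sub>R p + v *\<^sub>R b" by blast
      have u: "u = 1 - v" using x(3) by simp
      have "x = p + v *\<^sub>R (b - p)" unfolding x(5) u by (simp add: algebra_simps)
      then show "x \<in> (\<lambda>(t, y). p + t *\<^sub>R (y - p)) ` ({0..1} \<times> ?S)" using x by force
    next
      fix x assume "x \<in> (\<lambda>(t, y). p + t *\<^sub>R (y - p)) ` ({0..1} \<times> ?S)"
      then obtain t y where x: "0 \<le> t" "t \<le> 1" "y \<in> ?S" "x = p + t *\<^sub>R (y - p)" by auto
      then have "x = (1 - t) *\<^sub>R p + t *\<^sub>R y" by (simp add: algebra_simps)
      then show "x \<in> {x. \<exists>u\<ge>0. \<exists>v\<ge>0. \<exists>b. u + v = 1 \<and> b \<in> ?S \<and> x = u *\<^sub>R p + v *\<^sub>R b}"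
        using x by (intro CollectI exI[of _ "1 - t"] exI[of _ t] exI[of _ y] conjI) auto
    qed
    finally show "convex hull C = (\<lambda>(t, y). p + t *\<^sub>R (y - p)) ` ({0..1} \<times> ?S)" .
  qed
  then show ?thesis by (rule that)
qed

lemma extreme_points_simplex:
  fixes C :: "'a::euclidean_space set"
  shows "\<not> affine_dependent C \<Longrightarrow> {z. z extreme_point_of (convex hull C)} = C"
  by (simp add: extreme_point_of_convex_hull_affine_independent)

lemma barycenter_simplex:
  fixes C :: "'a::euclidean_space set"
  shows "\<not> affine_dependent C \<Longrightarrow> barycenter (convex hull C) = (1 / real (card C)) *\<^sub>R (\<Sum>z\<in>C. z)"
  by (simp add: barycenter_def extreme_points_simplex)

lemma barycenter_in_rel_interior:
  fixes C :: "'a::euclidean_space set"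
  assumes C: "\<not> affine_dependent C" and ne: "C \<noteq> {}"
  shows "barycenter (convex hull C) \<in> rel_interior (convex hull C)"
proof -
  have fin: "finite C" using C by (rule aff_independent_finite)
  then have pos: "real (card C) > 0" using ne by (simp add: card_gt_0_iff)
  show ?thesis
    unfolding rel_interior_convex_hull_explicit[OF C] barycenter_simplex[OF C]
    using pos by (intro CollectI exI[of _ "\<lambda>_. 1 / real (card C)"]) (auto simp: scaleR_sum_right)
qed

section \<open>Geometry of the mesh\<close>

text \<open>A Lipschitz domain lies on one side of its boundary, hence is the interior of its closure.\<close>

lemma lipschitz_domain_interior_closure:
  fixes \<Omega> :: "'a::euclidean_space set"
  assumes "lipschitz_domain \<Omega>"
  shows "interior (closure \<Omega>) \<subseteq> \<Omega>"
proof
  fix x assume x: "x \<in> interior (closure \<Omega>)"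
  have op: "open \<Omega>" using assms by (simp add: lipschitz_domain_def)
  show "x \<in> \<Omega>"
  proof (rule ccontr)
    assume nx: "x \<notin> \<Omega>"
    have "x \<in> frontier \<Omega>" using x nx op interior_subset by (auto simp: frontier_def interior_open)
    then obtain e r L \<gamma> where e: "norm e = 1" and r: "r > 0"
      and lip: "L-lipschitz_on {z. e \<bullet> z = 0} \<gamma>"
      and eq: "\<Omega> \<inter> ball x r = {y \<in> ball x r. \<gamma> (y - (e \<bullet> y) *\<^sub>R e) < e \<bullet> y}"
      using assms unfolding lipschitz_domain_def by blast
    define P where "P y = y - (e \<bullet> y) *\<^sub>R e" for y
    have ee: "e \<bullet> e = 1" using e by (simp add: dot_square_norm)
    have P0: "P y \<in> {z. e \<bullet> z = 0}" for y by (simp add: P_def inner_diff_right ee)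
    have "continuous_on {z. e \<bullet> z = 0} \<gamma>" by (rule lipschitz_on_continuous_on[OF lip])
    then have cP: "continuous_on UNIV (\<lambda>y. \<gamma> (P y))"
      by (rule continuous_on_compose2) (use P0 in \<open>auto simp: P_def intro!: continuous_intros\<close>)
    have above: "e \<bullet> x \<le> \<gamma> (P x)"
    proof (rule ccontr)
      assume "\<not> e \<bullet> x \<le> \<gamma> (P x)"
      then have "x \<in> {y \<in> ball x r. \<gamma> (P y) < e \<bullet> y}" using r by simp
      then show False using eq nx unfolding P_def by blast
    qed
    obtain d where d: "d > 0" "ball x d \<subseteq> closure \<Omega>" using x by (auto simp: mem_interior)
    define s where "s = min d r / 2"
    have s: "0 < s" "s < d" "s < r" using d r by (auto simp: s_def)
    \<comment> \<open>a point below the graph has a neighbourhood outside the domain\<close>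
    define y where "y = x - s *\<^sub>R e"
    have "P y = P x" by (simp add: y_def P_def inner_diff_right ee algebra_simps)
    moreover have "e \<bullet> y = e \<bullet> x - s" by (simp add: y_def inner_diff_right ee)
    ultimately have "y \<in> {z. e \<bullet> z < \<gamma> (P z)}" using above s by simp
    moreover have "open {z. e \<bullet> z < \<gamma> (P z)}"
      by (intro open_Collect_less cP continuous_intros)
    moreover have "dist x y = s" using e s by (simp add: y_def dist_norm)
    ultimately have "y \<in> {z. e \<bullet> z < \<gamma> (P z)} \<inter> ball x r \<inter> closure \<Omega>"
      and o: "open ({z. e \<bullet> z < \<gamma> (P z)} \<inter> ball x r)" using s d by auto
    then have "({z. e \<bullet> z < \<gamma> (P z)} \<inter> ball x r) \<inter> \<Omega> \<noteq> {}"
      using open_Int_closure_eq_empty[OF o, of \<Omega>] by blast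
    then show False using eq unfolding P_def[symmetric] by force
  qed
qed

locale mesh =
  fixes \<Omega> :: "'a::euclidean_space set" and \<T> :: "'a set set"
  assumes lipschitz: "lipschitz_domain \<Omega>"
    and conforming: "conforming_triangulation \<Omega> \<T>"
begin

abbreviation M :: "'a measure" where
  "M \<equiv> lebesgue_on \<Omega>"

definition verts :: "'a set \<Rightarrow> 'a set" where
  "verts T = {z. z extreme_point_of T}"

lemma open_domain: "open \<Omega>" and bounded_domain: "bounded \<Omega>"
  using lipschitz by (auto simp: lipschitz_domain_def)

lemma domain_lebesgue [simp]: "\<Omega> \<in> sets lebesgue"
  by (rule open_sets_lebesgue[OF open_domain])

lemma finite_mesh [simp]: "finite \<T>"
  using conforming by (simp add: conforming_triangulation_def triangulation_def)

lemma covers: "\<Union>\<T> = closure \<Omega>"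
  using conforming by (simp add: conforming_triangulation_def)

lemma Int_face: "T \<in> \<T> \<Longrightarrow> T' \<in> \<T> \<Longrightarrow> T \<inter> T' face_of T"
  using conforming by (simp add: conforming_triangulation_def triangulation_def)

lemma element:
  assumes "T \<in> \<T>"
  shows "\<not> affine_dependent (verts T)" "card (verts T) = DIM('a) + 1" "T = convex hull (verts T)"
    "aff_dim T = DIM('a)"
proof -
  have s: "int DIM('a) simplex T" using conforming assms by (simp add: conforming_triangulation_def)
  then obtain C where C: "\<not> affine_dependent C" "int (card C) = int DIM('a) + 1" "T = convex hull C"
    by (auto simp: simplex_def)
  then have "verts T = C" unfolding verts_def by (simp add: extreme_points_simplex)
  then show "\<not> affine_dependent (verts T)" "card (verts T) = DIM('a) + 1" "T = convex hull (verts T)"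
    using C by auto
  show "aff_dim T = DIM('a)" using aff_dim_simplex[OF s] by simp
qed

lemma finite_verts: "T \<in> \<T> \<Longrightarrow> finite (verts T)"
  using aff_independent_finite element(1) by blast

lemma convex_element: "T \<in> \<T> \<Longrightarrow> convex T"
  using element(3) convex_convex_hull by metis

lemma compact_element: "T \<in> \<T> \<Longrightarrow> compact T"
  using element(3) finite_imp_compact_convex_hull[OF finite_verts] by metis

lemma rel_interior_element: "T \<in> \<T> \<Longrightarrow> rel_interior T = interior T"
  using element(4) by (intro rel_interior_interior) (simp add: aff_dim_eq_full)

lemma interior_nonempty: "T \<in> \<T> \<Longrightarrow> interior T \<noteq> {}"
proof -
  assume T: "T \<in> \<T>"
  then have "T \<noteq> {}" using element(4)[OF T] by auto
  then show ?thesis using rel_interior_eq_empty[OF convex_element[OF T]] rel_interior_element[OF T] by simp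
qed

lemma face_full_dim: "T \<in> \<T> \<Longrightarrow> F face_of T \<Longrightarrow> aff_dim F = DIM('a) \<Longrightarrow> F = T"
  using face_of_aff_dim_lt[OF convex_element, of T F] element(4)[of T] by fastforce

text \<open>A face that meets the interior of a simplex is the whole simplex.\<close>

lemma interiors_disjoint:
  assumes T: "T \<in> \<T>" "T' \<in> \<T>" and x: "x \<in> interior T" "x \<in> T'"
  shows "T = T'"
proof -
  have "T \<subseteq> T \<inter> T'"
    by (rule subset_of_face_of[OF Int_face[OF T]])
      (use x rel_interior_element[OF T(1)] interior_subset in \<open>auto simp: disjnt_iff\<close>)
  then have "T \<inter> T' = T" by blast
  then have "T face_of T'" using Int_face[OF T(2,1)] by (simp add: Int_commute)
  then show ?thesis using face_full_dim[OF T(2)] element(4)[OF T(1)] by blast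
qed

lemma interior_subset_domain: "T \<in> \<T> \<Longrightarrow> interior T \<subseteq> \<Omega>"
  using lipschitz_domain_interior_closure[OF lipschitz] covers interior_mono[of T "closure \<Omega>"] by blast

definition skeleton :: "'a set" where
  "skeleton = \<Omega> - (\<Union>T\<in>\<T>. interior T)"

lemma skeleton_null: "skeleton \<in> null_sets lebesgue"
proof -
  have "skeleton \<subseteq> (\<Union>T\<in>\<T>. frontier T)"
  proof
    fix x assume x: "x \<in> skeleton"
    then have "x \<in> \<Union>\<T>" unfolding covers skeleton_def using closure_subset[of \<Omega>] by blast
    then obtain T where T: "T \<in> \<T>" "x \<in> T" by blast
    then have "x \<notin> interior T" "x \<in> closure T"
      using x closure_subset[of T] by (auto simp: skeleton_def)
    then show "x \<in> (\<Union>T\<in>\<T>. frontier T)" using T(1) by (auto simp: frontier_def)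
  qed
  moreover have "negligible (\<Union>T\<in>\<T>. frontier T)"
    by (intro negligible_Union) (auto intro: negligible_convex_frontier convex_element)
  ultimately show ?thesis by (metis negligible_iff_null_sets negligible_subset)
qed

lemma AE_in_element: "AE x in M. \<exists>T\<in>\<T>. x \<in> interior T"
proof -
  have "AE x in lebesgue. x \<notin> skeleton" using skeleton_null by (rule AE_not_in)
  then have "AE x in lebesgue. x \<in> \<Omega> \<longrightarrow> (\<exists>T\<in>\<T>. x \<in> interior T)"
    by eventually_elim (auto simp: skeleton_def)
  then show ?thesis by (simp add: AE_restrict_space_iff)
qed

definition elem :: "'a \<Rightarrow> 'a set" where
  "elem x = (THE T. T \<in> \<T> \<and> x \<in> interior T)"

lemma elem_eq: "T \<in> \<T> \<Longrightarrow> x \<in> interior T \<Longrightarrow> elem x = T"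
  unfolding elem_def by (rule the_equality) (use interiors_disjoint interior_subset in blast)+

lemma meshsize_eq: "meshsize \<T> x = diameter (elem x)"
  by (simp add: meshsize_def elem_def)

lemma sum_elements:
  fixes F :: "'a set \<Rightarrow> 'b::real_vector"
  assumes "T \<in> \<T>" "x \<in> interior T"
  shows "(\<Sum>T'\<in>\<T>. indicator (interior T') x *\<^sub>R F T') = F T"
proof -
  have "(\<Sum>T'\<in>\<T>. indicator (interior T') x *\<^sub>R F T') = (\<Sum>T'\<in>\<T>. if T' = T then F T else 0)"
  proof (rule sum.cong[OF refl])
    fix T' assume "T' \<in> \<T>"
    then have "x \<in> interior T' \<longleftrightarrow> T' = T"
      using assms interiors_disjoint[of T T' x] interior_subset[of T'] by blast
    then show "indicator (interior T') x *\<^sub>R F T' = (if T' = T then F T else 0)" by auto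
  qed
  then show ?thesis using assms by simp
qed

section \<open>Elementwise integrals\<close>

text \<open>Only the interior of the element matters: it lies in the domain, and its complement in the element
  is a null set.\<close>

definition elint :: "'a set \<Rightarrow> ('a \<Rightarrow> 'b::euclidean_space) \<Rightarrow> 'b" where
  "elint T f = (\<integral>x. indicator (interior T) x *\<^sub>R f x \<partial>M)"

definition vol :: "'a set \<Rightarrow> real" where
  "vol T = measure lborel T"

lemma finite_measure_domain: "finite_measure M"
  by (rule finite_measure_lebesgue_on_bounded[OF bounded_domain open_domain])

lemma vol_pos: "T \<in> \<T> \<Longrightarrow> vol T > 0"
proof -
  assume T: "T \<in> \<T>"
  obtain x e where xe: "e > 0" "cball x e \<subseteq> T"
    using interior_nonempty[OF T] by (metis equals0I mem_interior_cball)
  have "0 < measure lborel (cball x e)" using xe by (simp add: content_cball)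
  also have "\<dots> \<le> measure lborel T"
    using xe compact_element[OF T] emeasure_bounded_finite[OF compact_imp_bounded[OF compact_element[OF T]]]
    by (intro measure_mono_fmeasurable) (auto simp: borel_compact fmeasurable_def)
  finally show ?thesis by (simp add: vol_def)
qed

lemma integrable_elint:
  fixes f :: "'a \<Rightarrow> 'b::euclidean_space"
  assumes "integrable M f"
  shows "integrable M (\<lambda>x. indicator (interior T) x *\<^sub>R f x)"
proof (rule Bochner_Integration.integrable_bound[OF assms])
  show "(\<lambda>x. indicat_real (interior T) x *\<^sub>R f x) \<in> borel_measurable M"
    by (intro borel_measurable_scaleR borel_measurable_integrable[OF assms] measurable_restrict_space1
        borel_measurable_indicator open_sets_lebesgue open_interior)
qed (auto simp: indicator_def)

lemma integral_eq_sum_elint: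
  fixes f :: "'a \<Rightarrow> 'b::euclidean_space"
  assumes "integrable M f"
  shows "(\<integral>x. f x \<partial>M) = (\<Sum>T\<in>\<T>. elint T f)"
proof -
  have "(\<integral>x. f x \<partial>M) = (\<integral>x. (\<Sum>T\<in>\<T>. indicator (interior T) x *\<^sub>R f x) \<partial>M)"
  proof (rule integral_cong_AE)
    show "AE x in M. f x = (\<Sum>T\<in>\<T>. indicator (interior T) x *\<^sub>R f x)"
      using AE_in_element
    proof eventually_elim
      case (elim x)
      then obtain T where "T \<in> \<T>" "x \<in> interior T" by blast
      then show ?case using sum_elements[of T x "\<lambda>_. f x"] by simp
    qed
    show "(\<lambda>x. \<Sum>T\<in>\<T>. indicat_real (interior T) x *\<^sub>R f x) \<in> borel_measurable M"
      using integrable_elint[OF assms] by (intro borel_measurable_sum borel_measurable_integrable)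
  qed (use assms in simp)
  also have "\<dots> = (\<Sum>T\<in>\<T>. elint T f)"
    unfolding elint_def using integrable_elint[OF assms] by (rule Bochner_Integration.integral_sum)
  finally show ?thesis .
qed

lemma elint_cong: "(\<And>x. x \<in> interior T \<Longrightarrow> f x = g x) \<Longrightarrow> elint T f = elint T g"
  unfolding elint_def by (rule Bochner_Integration.integral_cong) (auto simp: indicator_def)

lemma elint_add:
  assumes "integrable M f" "integrable M g"
  shows "elint T (\<lambda>x. f x + g x) = elint T f + elint T g"
  unfolding elint_def scaleR_add_right using integrable_elint[OF assms(1)] integrable_elint[OF assms(2)]
  by (rule Bochner_Integration.integral_add)

lemma elint_diff:
  assumes "integrable M f" "integrable M g"
  shows "elint T (\<lambda>x. f x - g x) = elint T f - elint T g"
  unfolding elint_def scaleR_diff_right using integrable_elint[OF assms(1)] integrable_elint[OF assms(2)]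
  by (rule Bochner_Integration.integral_diff)

lemma elint_cmult: "elint T (\<lambda>x. c * f x) = c * elint T (f :: 'a \<Rightarrow> real)"
proof -
  have "elint T (\<lambda>x. c * f x) = (\<integral>x. c * (indicator (interior T) x *\<^sub>R f x) \<partial>M)"
    unfolding elint_def by (simp add: mult_ac)
  then show ?thesis unfolding elint_def by simp
qed

lemma elint_inner:
  assumes "integrable M f"
  shows "elint T (\<lambda>x. c \<bullet> f x) = c \<bullet> elint T f"
proof -
  have "elint T (\<lambda>x. c \<bullet> f x) = (\<integral>x. c \<bullet> (indicator (interior T) x *\<^sub>R f x) \<partial>M)"
    unfolding elint_def by simp
  then show ?thesis unfolding elint_def using integral_inner_right[of c] integrable_elint[OF assms] by metis
qed

lemma elint_borel:
  fixes f :: "'a \<Rightarrow> 'b::euclidean_space"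
  assumes T: "T \<in> \<T>" and f: "f \<in> borel_measurable borel"
  shows "elint T f = (\<integral>x. indicator T x *\<^sub>R f x \<partial>lborel)"
proof -
  have m: "(\<lambda>x. indicat_real (interior T) x *\<^sub>R f x) \<in> borel_measurable lborel" using f by simp
  have "elint T f = (\<integral>x. indicator \<Omega> x *\<^sub>R (indicator (interior T) x *\<^sub>R f x) \<partial>lebesgue)"
    unfolding elint_def by (rule integral_restrict_space) simp
  also have "\<dots> = (\<integral>x. indicator (interior T) x *\<^sub>R f x \<partial>lebesgue)"
    by (rule Bochner_Integration.integral_cong) (use interior_subset_domain[OF T] in \<open>auto simp: indicator_def\<close>)
  also have "\<dots> = (\<integral>x. indicator (interior T) x *\<^sub>R f x \<partial>lborel)"
    by (rule integral_completion[OF m])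
  also have "\<dots> = (\<integral>x. indicator T x *\<^sub>R f x \<partial>lborel)"
  proof (rule integral_cong_AE)
    have cT: "compact T" by (rule compact_element[OF T])
    then show "(\<lambda>x. indicat_real T x *\<^sub>R f x) \<in> borel_measurable lborel"
      using f borel_compact[of T] by simp
    have "frontier T \<in> null_sets lebesgue"
      using negligible_convex_frontier[OF convex_element[OF T]] by (simp add: negligible_iff_null_sets)
    moreover have "frontier T \<in> sets lborel" using cT by (simp add: borel_closed)
    ultimately have "frontier T \<in> null_sets lborel"
      by (simp add: null_sets_def)
    then have "AE x in lborel. x \<notin> frontier T" by (rule AE_not_in)
    then show "AE x in lborel. indicator (interior T) x *\<^sub>R f x = indicator T x *\<^sub>R f x"
      by eventually_elim
        (use interior_subset[of T] cT in \<open>auto simp: frontier_def indicator_def compact_imp_closed closure_closed\<close>)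
  qed (rule m)
  finally show ?thesis .
qed

lemma elint_const:
  assumes T: "T \<in> \<T>"
  shows "elint T (\<lambda>x. c) = vol T *\<^sub>R c"
proof -
  have "(\<integral>x. indicator T x *\<^sub>R c \<partial>lborel) = measure lborel T *\<^sub>R c"
    using compact_element[OF T] emeasure_bounded_finite[OF compact_imp_bounded[OF compact_element[OF T]]]
    by (subst integral_scaleR_left) (auto simp: borel_compact)
  then show ?thesis unfolding elint_borel[OF T borel_measurable_const] vol_def .
qed

lemma const_integrable: "integrable M (\<lambda>x. c :: 'b::euclidean_space)"
  by (rule finite_measure.integrable_const[OF finite_measure_domain])

text \<open>Lebesgue measure is complete, so the values on the skeleton, a null set, do not matter.\<close>

lemma elementwise_measurable:
  fixes f :: "'a \<Rightarrow> 'b::euclidean_space"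
  assumes "\<And>T. T \<in> \<T> \<Longrightarrow> \<exists>g. continuous_on UNIV g \<and> (\<forall>x\<in>interior T. f x = g x)"
  shows "f \<in> borel_measurable M"
proof -
  obtain g where g: "\<And>T. T \<in> \<T> \<Longrightarrow> continuous_on UNIV (g T) \<and> (\<forall>x\<in>interior T. f x = g T x)"
    using bchoice[of \<T> "\<lambda>T g. continuous_on UNIV g \<and> (\<forall>x\<in>interior T. f x = g x)"] assms by metis
  have N: "skeleton \<in> null_sets M"
    using skeleton_null by (subst null_sets_restrict_space) (auto simp: skeleton_def)
  have "(\<lambda>x. \<Sum>T\<in>\<T>. indicator (interior T) x *\<^sub>R g T x) \<in> borel_measurable borel"
    using g by (intro borel_measurable_sum borel_measurable_scaleR borel_measurable_indicator
        borel_measurable_continuous_onI) auto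
  then have "(\<lambda>x. \<Sum>T\<in>\<T>. indicator (interior T) x *\<^sub>R g T x) \<in> borel_measurable lebesgue"
    by (intro measurable_completion) simp
  then have "(\<lambda>x. \<Sum>T\<in>\<T>. indicator (interior T) x *\<^sub>R g T x) \<in> borel_measurable (lebesgue_on (\<Omega> - skeleton))"
    by (rule measurable_restrict_space1)
  moreover have "(\<Sum>T\<in>\<T>. indicator (interior T) x *\<^sub>R g T x) = f x" if x: "x \<in> \<Omega> - skeleton" for x
  proof -
    obtain T where T: "T \<in> \<T>" "x \<in> interior T" using x by (auto simp: skeleton_def)
    then show ?thesis using sum_elements[OF T, of "\<lambda>T. g T x"] g by simp
  qed
  ultimately have "f \<in> borel_measurable (lebesgue_on (\<Omega> - skeleton))"
    by (subst measurable_cong[symmetric]) (auto simp: space_restrict_space)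
  then show ?thesis using borel_measurable_diff_null[OF N domain_lebesgue] by blast
qed

lemma elementwise_bounded:
  fixes f :: "'a \<Rightarrow> 'b::euclidean_space"
  assumes "\<And>T. T \<in> \<T> \<Longrightarrow> \<exists>g. continuous_on UNIV g \<and> (\<forall>x\<in>interior T. f x = g x)"
  obtains B where "AE x in M. norm (f x) \<le> B"
proof -
  have "\<exists>B. \<forall>x\<in>interior T. norm (f x) \<le> B" if T: "T \<in> \<T>" for T
  proof -
    obtain g where g: "continuous_on UNIV g" "\<forall>x\<in>interior T. f x = g x" using assms[OF T] by blast
    have "compact (g ` T)" by (rule compact_continuous_image[OF continuous_on_subset[OF g(1)] compact_element[OF T]]) auto
    then obtain B where "\<forall>y\<in>g ` T. norm y \<le> B" using compact_imp_bounded bounded_iff by blast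
    then show ?thesis using g(2) interior_subset by (intro exI[of _ B]) fastforce
  qed
  then obtain B where B: "\<And>T x. T \<in> \<T> \<Longrightarrow> x \<in> interior T \<Longrightarrow> norm (f x) \<le> B T" by metis
  have "norm (f x) \<le> (\<Sum>T\<in>\<T>. \<bar>B T\<bar>)" if "T \<in> \<T>" "x \<in> interior T" for T x
    using B[OF that] member_le_sum[of T \<T> "\<lambda>T. \<bar>B T\<bar>"] that by simp
  then have "AE x in M. norm (f x) \<le> (\<Sum>T\<in>\<T>. \<bar>B T\<bar>)"
    using AE_in_element by (auto elim!: eventually_mono)
  then show ?thesis by (rule that)
qed

lemma elementwise_L2:
  fixes f :: "'a \<Rightarrow> 'b::euclidean_space"
  assumes "\<And>T. T \<in> \<T> \<Longrightarrow> \<exists>g. continuous_on UNIV g \<and> (\<forall>x\<in>interior T. f x = g x)"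
  shows "f \<in> L2 M"
  using elementwise_bounded[OF assms] finite_measure_bounded_L2[OF finite_measure_domain elementwise_measurable[OF assms]]
  by metis

lemma elementwise_const_L2:
  fixes f :: "'a \<Rightarrow> 'b::euclidean_space"
  assumes "\<And>T. T \<in> \<T> \<Longrightarrow> \<exists>c. \<forall>x\<in>interior T. f x = c"
  shows "f \<in> L2 M"
proof (rule elementwise_L2)
  fix T assume "T \<in> \<T>"
  then obtain c where "\<forall>x\<in>interior T. f x = c" using assms by blast
  then show "\<exists>g. continuous_on UNIV g \<and> (\<forall>x\<in>interior T. f x = g x)"
    by (intro exI[of _ "\<lambda>_. c"]) auto
qed

lemma continuous_L2:
  "continuous_on UNIV f \<Longrightarrow> f \<in> L2 M"
  by (rule elementwise_L2) blast

lemma L2_integrable: "f \<in> L2 M \<Longrightarrow> integrable M f"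
  by (rule finite_measure_L2_integrable[OF finite_measure_domain])

end

section \<open>Piecewise polynomials and elementwise means\<close>

lemma multi_indices_0: "multi_indices 0 = {\<lambda>b\<in>(Basis::'a::euclidean_space set). 0}"
  unfolding multi_indices_def by (auto simp: PiE_iff extensional_def fun_eq_iff restrict_def)

lemma polynomials_0: "p \<in> polynomials 0 \<longleftrightarrow> (\<exists>c. \<forall>x::'a::euclidean_space. p x = c)"
proof
  assume "\<exists>c. \<forall>x. p x = c"
  then obtain c where "\<forall>x. p x = c" by blast
  then show "p \<in> polynomials 0"
    unfolding polynomials_def multi_indices_0 by (auto intro!: exI[of _ "\<lambda>_. c"])
qed (auto simp: polynomials_def multi_indices_0)

lemma multi_indices_1:
  "multi_indices 1 = insert (\<lambda>b\<in>(Basis::'a::euclidean_space set). 0)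
     ((\<lambda>i. \<lambda>b\<in>Basis. if b = i then 1 else 0) ` Basis)" (is "_ = insert ?z (?e ` _)")
proof (intro equalityI subsetI)
  fix \<alpha> :: "'a \<Rightarrow> nat" assume a: "\<alpha> \<in> multi_indices 1"
  then have ext: "\<alpha> \<in> extensional Basis" and s: "(\<Sum>b\<in>Basis. \<alpha> b) \<le> 1"
    by (auto simp: multi_indices_def PiE_iff)
  show "\<alpha> \<in> insert ?z (?e ` Basis)"
  proof (cases "\<forall>b\<in>Basis. \<alpha> b = 0")
    case True
    then have "\<alpha> = ?z" using ext by (auto simp: fun_eq_iff extensional_def restrict_def)
    then show ?thesis by simp
  next
    case False
    then obtain i where i: "i \<in> Basis" "\<alpha> i \<noteq> 0" by blast
    have "(\<Sum>b\<in>Basis. \<alpha> b) = \<alpha> i + (\<Sum>b\<in>Basis - {i}. \<alpha> b)" using i by (simp add: sum.remove)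
    then have "\<alpha> i = 1" "(\<Sum>b\<in>Basis - {i}. \<alpha> b) = 0" using s i(2) by linarith+
    then have "\<alpha> = ?e i" using ext i by (auto simp: fun_eq_iff extensional_def restrict_def)
    then show ?thesis using i by blast
  qed
next
  fix \<alpha> :: "'a \<Rightarrow> nat" assume "\<alpha> \<in> insert ?z (?e ` Basis)"
  then show "\<alpha> \<in> multi_indices 1" by (auto simp: multi_indices_def PiE_iff)
qed

lemma sum_multi_indices_1:
  fixes x :: "'a::euclidean_space" and c :: "('a \<Rightarrow> nat) \<Rightarrow> real"
  shows "(\<Sum>\<alpha>\<in>multi_indices 1. c \<alpha> * (\<Prod>b\<in>Basis. (x \<bullet> b) ^ \<alpha> b)) =
    c (\<lambda>b\<in>Basis. 0) + (\<Sum>i\<in>Basis. c (\<lambda>b\<in>Basis. if b = i then 1 else 0) * (x \<bullet> i))"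
proof -
  let ?z = "\<lambda>b\<in>(Basis::'a set). 0 :: nat"
  let ?e = "\<lambda>i. \<lambda>b\<in>(Basis::'a set). if b = i then 1 else 0 :: nat"
  have z: "?z \<notin> ?e ` Basis"
  proof
    assume "?z \<in> ?e ` Basis"
    then obtain i where i: "i \<in> Basis" "?z = ?e i" by blast
    from fun_cong[OF i(2), of i] show False using i(1) by simp
  qed
  have inj: "inj_on ?e Basis"
  proof (rule inj_onI)
    fix i j :: 'a assume ij: "i \<in> Basis" "j \<in> Basis" "?e i = ?e j"
    from fun_cong[OF ij(3), of i] show "i = j" using ij(1,2) by (simp split: if_splits)
  qed
  have ez: "(\<Prod>b\<in>Basis. (x \<bullet> b) ^ ?z b) = 1" by (simp add: prod.neutral)
  have ee: "(\<Prod>b\<in>Basis. (x \<bullet> b) ^ ?e i b) = x \<bullet> i" if "i \<in> Basis" for i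
  proof -
    have "(\<Prod>b\<in>Basis. (x \<bullet> b) ^ ?e i b) = (\<Prod>b\<in>Basis. if b = i then x \<bullet> i else 1)"
      by (rule prod.cong) auto
    then show ?thesis using that by simp
  qed
  show ?thesis
    unfolding multi_indices_1 using z inj
    by (subst sum.insert) (auto simp: ez ee sum.reindex simp del: restrict_apply)
qed

lemma polynomials_1:
  "p \<in> polynomials 1 \<longleftrightarrow> (\<exists>G b. \<forall>x::'a::euclidean_space. p x = G \<bullet> x + b)"
proof
  assume "p \<in> polynomials 1"
  then obtain c where c: "\<And>x. p x = (\<Sum>\<alpha>\<in>multi_indices 1. c \<alpha> * (\<Prod>b\<in>Basis. (x \<bullet> b) ^ \<alpha> b))"
    by (auto simp: polynomials_def)
  have "p x = (\<Sum>i\<in>Basis. c (\<lambda>b\<in>Basis. if b = i then 1 else 0) *\<^sub>R i) \<bullet> x + c (\<lambda>b\<in>Basis. 0)" for x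
    unfolding c sum_multi_indices_1 by (simp add: inner_sum_left inner_sum_right inner_commute)
  then show "\<exists>G b. \<forall>x. p x = G \<bullet> x + b" by blast
next
  assume "\<exists>G b. \<forall>x. p x = G \<bullet> x + b"
  then obtain G b where p: "\<And>x. p x = G \<bullet> x + b" by blast
  define c :: "('a \<Rightarrow> nat) \<Rightarrow> real" where
    "c \<alpha> = (if \<forall>i\<in>Basis. \<alpha> i = 0 then b else (\<Sum>i\<in>Basis. real (\<alpha> i) * (G \<bullet> i)))" for \<alpha>
  have c0: "c (\<lambda>b\<in>Basis. 0) = b" by (simp add: c_def)
  have c1: "c (\<lambda>b\<in>Basis. if b = i then 1 else 0) = G \<bullet> i" if i: "i \<in> Basis" for i
  proof -
    have "(\<Sum>j\<in>Basis. real (if j = i then 1 else 0) * (G \<bullet> j)) = (\<Sum>j\<in>Basis. if j = i then G \<bullet> i else 0)"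
      by (rule sum.cong) auto
    then have "(\<Sum>j\<in>Basis. real (if j = i then 1 else 0) * (G \<bullet> j)) = G \<bullet> i" using i by simp
    then show ?thesis using i by (auto simp: c_def)
  qed
  have "p x = (\<Sum>\<alpha>\<in>multi_indices 1. c \<alpha> * (\<Prod>b\<in>Basis. (x \<bullet> b) ^ \<alpha> b))" for x
    unfolding sum_multi_indices_1 c0 p
    by (subst euclidean_inner) (simp add: c1)
  then show "p \<in> polynomials 1" by (auto simp: polynomials_def)
qed

context mesh
begin

definition avg :: "'a set \<Rightarrow> ('a \<Rightarrow> 'b::euclidean_space) \<Rightarrow> 'b" where
  "avg T f = (1 / vol T) *\<^sub>R elint T f"

lemma elint_eq_avg: "T \<in> \<T> \<Longrightarrow> elint T f = vol T *\<^sub>R avg T f"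
proof -
  assume "T \<in> \<T>"
  then have "vol T * (1 / vol T) = 1" using vol_pos by fastforce
  then show ?thesis by (simp only: avg_def scaleR_scaleR scaleR_one)
qed

lemma EP0_iff: "p \<in> elementwise_polynomials 0 \<T> \<longleftrightarrow> (\<forall>T\<in>\<T>. \<exists>c. \<forall>x\<in>interior T. p x = c)"
proof
  assume a: "p \<in> elementwise_polynomials 0 \<T>"
  show "\<forall>T\<in>\<T>. \<exists>c. \<forall>x\<in>interior T. p x = c"
  proof
    fix T assume "T \<in> \<T>"
    then obtain q where q: "q \<in> polynomials 0" "\<forall>x\<in>interior T. p x = q x"
      using a unfolding elementwise_polynomials_def by blast
    obtain c where "\<forall>x. q x = c" using q(1) unfolding polynomials_0 by blast
    then show "\<exists>c. \<forall>x\<in>interior T. p x = c" using q(2) by auto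
  qed
next
  assume a: "\<forall>T\<in>\<T>. \<exists>c. \<forall>x\<in>interior T. p x = c"
  show "p \<in> elementwise_polynomials 0 \<T>"
    unfolding elementwise_polynomials_def
  proof (intro CollectI ballI)
    fix T assume "T \<in> \<T>"
    then obtain c where "\<forall>x\<in>interior T. p x = c" using a by blast
    then show "\<exists>q\<in>polynomials 0. \<forall>x\<in>interior T. p x = q x"
      by (intro bexI[of _ "\<lambda>_. c"]) (auto simp: polynomials_0)
  qed
qed

lemma EP1_iff: "p \<in> elementwise_polynomials 1 \<T> \<longleftrightarrow> (\<forall>T\<in>\<T>. \<exists>G b. \<forall>x\<in>interior T. p x = G \<bullet> x + b)"
proof
  assume a: "p \<in> elementwise_polynomials 1 \<T>"
  show "\<forall>T\<in>\<T>. \<exists>G b. \<forall>x\<in>interior T. p x = G \<bullet> x + b"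
  proof
    fix T assume "T \<in> \<T>"
    then obtain q where q: "q \<in> polynomials 1" "\<forall>x\<in>interior T. p x = q x"
      using a unfolding elementwise_polynomials_def by blast
    obtain G b where "\<forall>x. q x = G \<bullet> x + b" using q(1) unfolding polynomials_1 by blast
    then show "\<exists>G b. \<forall>x\<in>interior T. p x = G \<bullet> x + b" using q(2) by auto
  qed
next
  assume a: "\<forall>T\<in>\<T>. \<exists>G b. \<forall>x\<in>interior T. p x = G \<bullet> x + b"
  show "p \<in> elementwise_polynomials 1 \<T>"
    unfolding elementwise_polynomials_def
  proof (intro CollectI ballI)
    fix T assume "T \<in> \<T>"
    then obtain G b where "\<forall>x\<in>interior T. p x = G \<bullet> x + b" using a by blast
    then show "\<exists>q\<in>polynomials 1. \<forall>x\<in>interior T. p x = q x"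
      by (intro bexI[of _ "\<lambda>x. G \<bullet> x + b"]) (simp, unfold polynomials_1, blast)
  qed
qed

lemma EP0_L2: "p \<in> elementwise_polynomials 0 \<T> \<Longrightarrow> p \<in> L2 M"
  by (rule elementwise_const_L2) (auto simp: EP0_iff)

lemma EP1_L2:
  assumes "p \<in> elementwise_polynomials 1 \<T>"
  shows "p \<in> L2 M"
proof (rule elementwise_L2)
  fix T assume "T \<in> \<T>"
  then obtain G b where "\<forall>x\<in>interior T. p x = G \<bullet> x + b" using assms EP1_iff by blast
  then show "\<exists>g. continuous_on UNIV g \<and> (\<forall>x\<in>interior T. p x = g x)"
    by (intro exI[of _ "\<lambda>x. G \<bullet> x + b"]) (auto intro!: continuous_intros)
qed

lemma EP0_mult_integrable:
  fixes v p :: "'a \<Rightarrow> real"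
  assumes v: "integrable M v" and p: "p \<in> elementwise_polynomials 0 \<T>"
  shows "integrable M (\<lambda>x. v x * p x)"
proof -
  have c: "\<exists>g. continuous_on UNIV g \<and> (\<forall>x\<in>interior T. p x = g x)" if T: "T \<in> \<T>" for T
  proof -
    obtain c where "\<forall>x\<in>interior T. p x = c" using p T by (auto simp: EP0_iff)
    then show ?thesis by (intro exI[of _ "\<lambda>_. c"]) auto
  qed
  obtain B where B: "AE x in M. norm (p x) \<le> B" using elementwise_bounded[OF c] by metis
  show ?thesis
  proof (rule Bochner_Integration.integrable_bound)
    show "integrable M (\<lambda>x. B * v x)" using v by simp
    show "(\<lambda>x. v x * p x) \<in> borel_measurable M"
      using v elementwise_measurable[OF c] by simp
    show "AE x in M. norm (v x * p x) \<le> norm (B * v x)"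
      using B
    proof eventually_elim
      case (elim x)
      then have "\<bar>p x\<bar> \<le> \<bar>B\<bar>" by simp
      then show ?case by (simp add: abs_mult mult.commute mult_right_mono)
    qed
  qed
qed

lemma integral_mult_EP0:
  fixes v p :: "'a \<Rightarrow> real"
  assumes v: "integrable M v"
    and c: "\<And>T x. T \<in> \<T> \<Longrightarrow> x \<in> interior T \<Longrightarrow> p x = c T"
  shows "(\<integral>x. v x * p x \<partial>M) = (\<Sum>T\<in>\<T>. c T * elint T v)"
proof -
  have p: "p \<in> elementwise_polynomials 0 \<T>" using c by (auto simp: EP0_iff)
  have "(\<integral>x. v x * p x \<partial>M) = (\<Sum>T\<in>\<T>. elint T (\<lambda>x. v x * p x))"
    by (rule integral_eq_sum_elint[OF EP0_mult_integrable[OF v p]])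
  also have "\<dots> = (\<Sum>T\<in>\<T>. c T * elint T v)"
  proof (rule sum.cong[OF refl])
    fix T assume T: "T \<in> \<T>"
    have "elint T (\<lambda>x. v x * p x) = elint T (\<lambda>x. c T * v x)"
      by (rule elint_cong) (simp add: c[OF T])
    then show "elint T (\<lambda>x. v x * p x) = c T * elint T v" by (simp add: elint_cmult)
  qed
  finally show ?thesis .
qed

text \<open>The projection is defined by a choice among functions with arbitrary values on the skeleton.
  Testing with the indicator function of one element determines it in the interiors.\<close>

lemma L2_proj_spec:
  assumes v: "integrable M v"
  shows "L2_proj \<Omega> \<T> v \<in> elementwise_polynomials 0 \<T>"
    and "T \<in> \<T> \<Longrightarrow> x \<in> interior T \<Longrightarrow> L2_proj \<Omega> \<T> v x = avg T v"
proof -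
  let ?P = "\<lambda>p. p \<in> elementwise_polynomials 0 \<T> \<and>
        (\<forall>q\<in>elementwise_polynomials 0 \<T>. L2_inner M (\<lambda>x. v x - p x) q = 0)"
  have pair: "L2_inner M (\<lambda>x. v x - p x) q = (\<Sum>T\<in>\<T>. c T * (elint T v - vol T * b T))"
    if c: "\<And>T x. T \<in> \<T> \<Longrightarrow> x \<in> interior T \<Longrightarrow> q x = c T"
      and b: "\<And>T x. T \<in> \<T> \<Longrightarrow> x \<in> interior T \<Longrightarrow> p x = b T" for p q c b
  proof -
    have pi: "integrable M p"
      using b by (intro L2_integrable EP0_L2) (auto simp: EP0_iff)
    have "L2_inner M (\<lambda>x. v x - p x) q = (\<Sum>T\<in>\<T>. c T * elint T (\<lambda>x. v x - p x))"
      unfolding L2_inner_def inner_real_def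
      by (rule integral_mult_EP0[OF _ c]) (use v pi in auto)
    also have "\<dots> = (\<Sum>T\<in>\<T>. c T * (elint T v - vol T * b T))"
    proof (rule sum.cong[OF refl])
      fix T assume T: "T \<in> \<T>"
      have "elint T p = elint T (\<lambda>_. b T)" by (rule elint_cong) (rule b[OF T])
      then show "c T * elint T (\<lambda>x. v x - p x) = c T * (elint T v - vol T * b T)"
        using elint_const[OF T, of "b T"] by (simp add: elint_diff[OF v pi])
    qed
    finally show ?thesis .
  qed
  define p where "p x = avg (elem x) v" for x
  have pT: "p x = avg T v" if "T \<in> \<T>" "x \<in> interior T" for T x using that by (simp add: p_def elem_eq)
  have "?P p"
  proof (intro conjI ballI)
    show "p \<in> elementwise_polynomials 0 \<T>" using pT by (auto simp: EP0_iff)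
    fix q assume "q \<in> elementwise_polynomials 0 \<T>"
    then obtain c where c: "\<And>T x. T \<in> \<T> \<Longrightarrow> x \<in> interior T \<Longrightarrow> q x = c T" unfolding EP0_iff by metis
    have "L2_inner M (\<lambda>x. v x - p x) q = (\<Sum>T\<in>\<T>. c T * (elint T v - vol T * avg T v))"
      by (rule pair[OF c pT])
    also have "\<dots> = 0" by (rule sum.neutral) (use elint_eq_avg[of _ v] in auto)
    finally show "L2_inner M (\<lambda>x. v x - p x) q = 0" .
  qed
  then have P: "?P (L2_proj \<Omega> \<T> v)" unfolding L2_proj_def by (rule someI[where P="?P"])
  then show "L2_proj \<Omega> \<T> v \<in> elementwise_polynomials 0 \<T>" by blast
  from P obtain b where b: "\<And>T x. T \<in> \<T> \<Longrightarrow> x \<in> interior T \<Longrightarrow> L2_proj \<Omega> \<T> v x = b T" unfolding EP0_iff by metis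
  show "L2_proj \<Omega> \<T> v x = avg T v" if T: "T \<in> \<T>" and x: "x \<in> interior T" for T x
  proof -
    define q :: "'a \<Rightarrow> real" where "q x = (if elem x = T then 1 else 0)" for x
    have q: "q x = (if T' = T then 1 else 0)" if "T' \<in> \<T>" "x \<in> interior T'" for T' x
      using that by (simp add: q_def elem_eq)
    then have "q \<in> elementwise_polynomials 0 \<T>" by (auto simp: EP0_iff)
    then have "0 = L2_inner M (\<lambda>x. v x - L2_proj \<Omega> \<T> v x) q" using P by simp
    also have "\<dots> = (\<Sum>T'\<in>\<T>. (if T' = T then 1 else 0) * (elint T' v - vol T' * b T'))"
      by (rule pair[OF q b])
    also have "\<dots> = (\<Sum>T'\<in>\<T>. if T' = T then elint T v - vol T * b T else 0)"
      by (rule sum.cong) auto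
    also have "\<dots> = elint T v - vol T * b T" using T by simp
    finally show ?thesis using b[OF T x] vol_pos[OF T] by (simp add: avg_def)
  qed
qed

lemma L2_proj_L2: "integrable M v \<Longrightarrow> L2_proj \<Omega> \<T> v \<in> L2 M"
  by (rule EP0_L2[OF L2_proj_spec(1)])

lemma L2_inner_proj:
  assumes c: "c \<in> elementwise_polynomials 0 \<T>" and v: "integrable M v"
  shows "L2_inner M c (L2_proj \<Omega> \<T> v) = L2_inner M c v"
proof -
  obtain b where b: "\<And>T x. T \<in> \<T> \<Longrightarrow> x \<in> interior T \<Longrightarrow> c x = b T" using c unfolding EP0_iff by metis
  have i: "integrable M (L2_proj \<Omega> \<T> v)" by (rule L2_integrable[OF L2_proj_L2[OF v]])
  have "L2_inner M c (L2_proj \<Omega> \<T> v) = (\<Sum>T\<in>\<T>. b T * elint T (L2_proj \<Omega> \<T> v))"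
    unfolding L2_inner_def inner_real_def using integral_mult_EP0[where p=c and c=b, OF i b] by (simp add: mult.commute)
  also have "\<dots> = (\<Sum>T\<in>\<T>. b T * elint T v)"
  proof (rule sum.cong[OF refl])
    fix T assume T: "T \<in> \<T>"
    have "elint T (L2_proj \<Omega> \<T> v) = elint T (\<lambda>_. avg T v)"
      by (rule elint_cong) (rule L2_proj_spec(2)[OF v T])
    then show "b T * elint T (L2_proj \<Omega> \<T> v) = b T * elint T v"
      by (simp add: elint_const[OF T] elint_eq_avg[OF T])
  qed
  also have "\<dots> = L2_inner M c v"
    unfolding L2_inner_def inner_real_def using integral_mult_EP0[where p=c and c=b, OF v b] by (simp add: mult.commute)
  finally show ?thesis .
qed

lemma L2_inner_eq_sum:
  assumes "f \<in> L2 M" "g \<in> L2 M"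
  shows "L2_inner M f g = (\<Sum>T\<in>\<T>. elint T (\<lambda>x. f x \<bullet> g x))"
  unfolding L2_inner_def by (rule integral_eq_sum_elint[OF L2_integrable_inner[OF assms]])

section \<open>Side means\<close>

text \<open>By the divergence theorem for \<open>(x - p) w(x)\<close> this is the mean of \<open>w\<close> over the facet opposite to
  the vertex \<open>p\<close>, expressed without traces: \<open>g\<close> stands for the gradient of \<open>w\<close>.\<close>

definition side_mean :: "'a set \<Rightarrow> 'a \<Rightarrow> ('a \<Rightarrow> real) \<Rightarrow> ('a \<Rightarrow> 'a) \<Rightarrow> real" where
  "side_mean T p w g = avg T (\<lambda>x. w x + (1 / DIM('a)) * (g x \<bullet> (x - p)))"

definition opposite :: "'a set \<Rightarrow> 'a \<Rightarrow> 'a set" where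
  "opposite T p = convex hull (verts T - {p})"

lemma opposite_simplex:
  assumes "T \<in> \<T>" "p \<in> verts T"
  shows "\<not> affine_dependent (verts T - {p})" "verts T - {p} \<noteq> {}" "card (verts T - {p}) = DIM('a)"
proof -
  note e = element[OF assms(1)]
  show "\<not> affine_dependent (verts T - {p})"
    using e(1) affine_independent_subset by blast
  show c: "card (verts T - {p}) = DIM('a)" using e(2) assms(2) by simp
  show "verts T - {p} \<noteq> {}" using c DIM_positive[where 'a='a] by (metis card.empty less_irrefl)
qed

lemma element_cone:
  assumes "T \<in> \<T>" "p \<in> verts T"
  obtains a where "cone p a (opposite T p) T"
  using affine_independent_cone[OF element(1)[OF assms(1)] assms(2) opposite_simplex(2)[OF assms]]
    element(3)[OF assms(1)] unfolding opposite_def by metis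

lemma facetE:
  assumes "T \<in> \<T>" "S facet_of T"
  obtains p where "p \<in> verts T" "S = opposite T p"
  using facet_of_convex_hull_affine_independent[OF element(1)[OF assms(1)]] assms(2) element(3)[OF assms(1)]
  unfolding opposite_def by metis

lemma smooth_L2:
  assumes "smooth \<phi>"
  shows "\<phi> \<in> L2 M" "gradient \<phi> \<in> L2 M"
  using smooth_continuous[OF assms] smooth_continuous_gradient[OF assms] by (auto intro: continuous_L2)

lemma side_mean_smooth:
  assumes T: "T \<in> \<T>" and c: "cone p a S T" and \<phi>: "smooth \<phi>"
  shows "side_mean T p \<phi> (gradient \<phi>) = (\<integral>x. indicator T x * \<phi> (cone.proj p a x) \<partial>lborel) / vol T"
proof -
  have "(\<lambda>x. \<phi> x + (1 / DIM('a)) * (gradient \<phi> x \<bullet> (x - p))) \<in> borel_measurable borel"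
    by (intro borel_measurable_continuous_onI continuous_intros smooth_continuous[OF \<phi>] smooth_continuous_gradient[OF \<phi>])
  from elint_borel[OF T this] show ?thesis
    unfolding side_mean_def avg_def by (simp add: cone.radial_trace_formula[OF c \<phi>])
qed

lemma side_mean_eq_L2_inner:
  assumes w: "w \<in> L2 M" and g: "g \<in> L2 M"
  shows "(\<lambda>x. indicator (interior T) x *\<^sub>R (x - p)) \<in> L2 M"
    and "(indicator (interior T) :: 'a \<Rightarrow> real) \<in> L2 M"
    and "side_mean T p w g = (1 / vol T) * (L2_inner M w (indicator (interior T)) +
      (1 / DIM('a)) * L2_inner M g (\<lambda>x. indicator (interior T) x *\<^sub>R (x - p)))"
proof -
  have m: "(indicator (interior T) :: 'a \<Rightarrow> real) \<in> borel_measurable M"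
    by (intro measurable_restrict_space1 borel_measurable_indicator open_sets_lebesgue open_interior)
  show 1: "(indicator (interior T) :: 'a \<Rightarrow> real) \<in> L2 M"
    by (rule finite_measure_bounded_L2[OF finite_measure_domain m, of 1]) (auto simp: indicator_def)
  have "(\<lambda>x. x - p) \<in> L2 M" by (intro continuous_L2 continuous_intros)
  then show 2: "(\<lambda>x. indicator (interior T) x *\<^sub>R (x - p)) \<in> L2 M"
    by (rule L2_bounded_mult[OF _ m, of _ 1]) (auto simp: indicator_def)
  have "elint T (\<lambda>x. w x + (1 / DIM('a)) * (g x \<bullet> (x - p))) =
      (\<integral>x. w x \<bullet> indicator (interior T) x + (1 / DIM('a)) * (g x \<bullet> (indicator (interior T) x *\<^sub>R (x - p))) \<partial>M)"
    unfolding elint_def by (rule Bochner_Integration.integral_cong) (auto simp: algebra_simps)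
  also have "\<dots> = L2_inner M w (indicator (interior T)) +
      (1 / DIM('a)) * L2_inner M g (\<lambda>x. indicator (interior T) x *\<^sub>R (x - p))"
    unfolding L2_inner_def using L2_integrable_inner[OF w 1] L2_integrable_inner[OF g 2]
    by (subst Bochner_Integration.integral_add) (simp_all del: inner_real_def inner_scaleR_right)
  finally show "side_mean T p w g = (1 / vol T) * (L2_inner M w (indicator (interior T)) +
      (1 / DIM('a)) * L2_inner M g (\<lambda>x. indicator (interior T) x *\<^sub>R (x - p)))"
    by (simp add: side_mean_def avg_def)
qed

text \<open>As a sum of \<open>L\<^sup>2\<close> inner products with fixed functions the side mean passes to the limit along
  smooth approximations.\<close>

lemma side_mean_tendsto:
  assumes w: "w \<in> L2 M" and g: "g \<in> L2 M" and s: "\<And>n. smooth (\<phi> n)"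
    and lim: "L2_tendsto M \<phi> w" "L2_tendsto M (\<lambda>n. gradient (\<phi> n)) g"
  shows "(\<lambda>n. side_mean T p (\<phi> n) (gradient (\<phi> n))) \<longlonglongrightarrow> side_mean T p w g"
  unfolding side_mean_eq_L2_inner(3)[OF w g] side_mean_eq_L2_inner(3)[OF smooth_L2[OF s]]
  by (intro tendsto_mult tendsto_const tendsto_add
      L2_tendsto_inner[OF lim(1) w side_mean_eq_L2_inner(2)[OF w g]]
      L2_tendsto_inner[OF lim(2) g side_mean_eq_L2_inner(1)[OF w g]])

lemma side_mean_shared:
  assumes T: "T \<in> \<T>" "p \<in> verts T" and T': "T' \<in> \<T>" "p' \<in> verts T'"
    and S: "opposite T p = opposite T' p'"
    and w: "w \<in> L2 M" and g: "g \<in> L2 M" and s: "\<And>n. smooth (\<phi> n)"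
    and lim: "L2_tendsto M \<phi> w" "L2_tendsto M (\<lambda>n. gradient (\<phi> n)) g"
  shows "side_mean T p w g = side_mean T' p' w g"
proof -
  obtain a where c: "cone p a (opposite T p) T" using element_cone[OF T] .
  obtain a' where c': "cone p' a' (opposite T p) T'" using element_cone[OF T'] S by metis
  have eq: "side_mean T p (\<phi> n) (gradient (\<phi> n)) = side_mean T' p' (\<phi> n) (gradient (\<phi> n))" for n
    using cone_average_indep[OF c c' interior_nonempty[OF T'(1)] smooth_continuous[OF s]]
      vol_pos[OF T(1)] vol_pos[OF T'(1)]
    unfolding side_mean_smooth[OF T(1) c s] side_mean_smooth[OF T'(1) c' s] vol_def
    by (simp add: field_simps)
  show ?thesis
    by (rule LIMSEQ_unique[OF side_mean_tendsto[OF w g s lim, of T p, unfolded eq] side_mean_tendsto[OF w g s lim]])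
qed

end

lemma gradient_affine_on_open:
  fixes v :: "'a::euclidean_space \<Rightarrow> real"
  assumes "open U" "x \<in> U" "\<And>y. y \<in> U \<Longrightarrow> v y = G \<bullet> y + b"
  shows "gradient v x = G"
proof (rule gradient_eqI)
  have "((\<lambda>y. G \<bullet> y + b) has_derivative (\<lambda>h. G \<bullet> h)) (at x)"
    by (auto intro!: derivative_eq_intros)
  then show "(v has_derivative (\<lambda>h. G \<bullet> h)) (at x)"
    by (rule has_derivative_transform_within_open[OF _ assms(1,2)]) (simp add: assms(3))
qed

context mesh
begin

text \<open>On a Dirichlet side the side means of the smooth approximations are controlled by their
  \<open>L\<^sup>2\<close>-norms with respect to Hausdorff measure, which tend to zero.\<close>

lemma side_mean_Dirichlet:
  assumes w: "w \<in> H1D \<Omega> \<Gamma>D" and pos: "emeasure (hausdorff_measure (DIM('a) - 1)) (X::'a set) > 0"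
    and \<Gamma>D: "\<Gamma>D \<subseteq> frontier \<Omega>" and T: "T \<in> \<T>" "p \<in> verts T" and S: "opposite T p \<subseteq> \<Gamma>D"
  shows "side_mean T p w (weak_grad \<Omega> w) = 0"
proof -
  obtain g \<phi> where g: "w \<in> H1 \<Omega>" "g \<in> L2 (boundary_measure \<Omega>)" "\<And>n. smooth (\<phi> n)"
    "L2_tendsto M \<phi> w" "L2_tendsto M (\<lambda>n. gradient (\<phi> n)) (weak_grad \<Omega> w)"
    "L2_tendsto (boundary_measure \<Omega>) \<phi> g" "AE x in boundary_measure \<Omega>. x \<in> \<Gamma>D \<longrightarrow> g x = 0"
    using w by (auto simp: H1D_def has_trace_def)
  let ?S = "opposite T p" and ?H = "hausdorff_measure (DIM('a) - 1) :: 'a measure"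
  obtain a where "cone p a ?S T" using element_cone[OF T] .
  then interpret C: cone p a ?S T .
  have Sb [measurable]: "?S \<in> sets borel" using C.compact_base by (rule borel_compact)
  obtain C where C: "0 \<le> C" "\<And>f. f \<in> borel_measurable borel \<Longrightarrow>
      (\<integral>\<^sup>+x. indicator T x * f (C.proj x) \<partial>lborel) \<le> ennreal C * (\<integral>\<^sup>+y. indicator ?S y * f y \<partial>?H)"
    using C.proj_integral_le_hausdorff[OF pos] by metis
  define N where "N n = L2_norm (boundary_measure \<Omega>) (\<lambda>x. \<phi> n x - g x)" for n
  have bound: "(side_mean T p (\<phi> n) (gradient (\<phi> n)))\<^sup>2 \<le> C / vol T * (N n)\<^sup>2" for n
  proof -
    have c: "continuous_on UNIV (\<phi> n)" by (rule smooth_continuous[OF g(3)])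
    have [measurable]: "\<phi> n \<in> borel_measurable borel" by (rule borel_measurable_continuous_onI[OF c])
    let ?I = "\<integral>x. indicator T x * (\<phi> n (C.proj x))\<^sup>2 \<partial>lborel"
    obtain B where B: "\<And>x. x \<in> T \<Longrightarrow> \<bar>(\<phi> n x)\<^sup>2\<bar> \<le> B"
      using C.continuous_bounded_on_cone[OF continuous_on_power[OF c, of 2]] by metis
    have int: "integrable lborel (\<lambda>x. indicator T x * (\<phi> n (C.proj x))\<^sup>2)"
      by (rule C.integrable_cone[of _ B]) (use B C.proj_in_cone in auto)
    have d: "(\<lambda>x. \<phi> n x - g x) \<in> L2 (boundary_measure \<Omega>)" using g(6) by (simp add: L2_tendsto_def)
    have fr: "frontier \<Omega> \<inter> space ?H \<in> sets ?H" by simp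
    have "ennreal ?I = (\<integral>\<^sup>+x. ennreal (indicator T x * (\<phi> n (C.proj x))\<^sup>2) \<partial>lborel)"
      by (rule nn_integral_eq_integral[symmetric, OF int]) simp
    also have "\<dots> = (\<integral>\<^sup>+x. indicator T x * ennreal ((\<phi> n (C.proj x))\<^sup>2) \<partial>lborel)"
      by (intro nn_integral_cong) (simp add: indicator_def)
    also have "\<dots> \<le> ennreal C * (\<integral>\<^sup>+y. indicator ?S y * ennreal ((\<phi> n y)\<^sup>2) \<partial>?H)"
      by (rule C(2)) measurable
    also have "(\<integral>\<^sup>+y. indicator ?S y * ennreal ((\<phi> n y)\<^sup>2) \<partial>?H) =
        (\<integral>\<^sup>+y. indicator ?S y * ennreal ((\<phi> n y)\<^sup>2) * indicator (frontier \<Omega>) y \<partial>?H)"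
      by (intro nn_integral_cong) (use S \<Gamma>D in \<open>auto simp: indicator_def\<close>)
    also have "\<dots> = (\<integral>\<^sup>+y. indicator ?S y * ennreal ((\<phi> n y)\<^sup>2) \<partial>boundary_measure \<Omega>)"
      unfolding boundary_measure_def by (rule nn_integral_restrict_space[OF fr, symmetric])
    also have "\<dots> \<le> (\<integral>\<^sup>+y. ennreal ((norm (\<phi> n y - g y))\<^sup>2) \<partial>boundary_measure \<Omega>)"
    proof (rule nn_integral_mono_AE)
      show "AE y in boundary_measure \<Omega>. indicator ?S y * ennreal ((\<phi> n y)\<^sup>2) \<le> ennreal ((norm (\<phi> n y - g y))\<^sup>2)"
        using g(7) by eventually_elim (use S in \<open>auto simp: indicator_def\<close>)
    qed
    also have "\<dots> = ennreal ((N n)\<^sup>2)"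
      unfolding N_def L2_norm_sq by (rule nn_integral_eq_integral[OF L2_D(2)[OF d]]) simp
    finally have "ennreal ?I \<le> ennreal (C * (N n)\<^sup>2)"
      using C(1) by (simp add: ennreal_mult' mult_left_mono)
    then have I: "?I \<le> C * (N n)\<^sup>2" using C(1) by (simp add: ennreal_le_iff)
    have "(\<integral>x. indicator T x * \<phi> n (C.proj x) \<partial>lborel)\<^sup>2 \<le> measure lborel T * ?I"
      by (rule square_integral_le[OF C.compact_cone _ int]) measurable
    also have "\<dots> \<le> vol T * (C * (N n)\<^sup>2)"
      unfolding vol_def by (rule mult_left_mono[OF I]) simp
    finally have "(\<integral>x. indicator T x * \<phi> n (C.proj x) \<partial>lborel)\<^sup>2 / (vol T)\<^sup>2 \<le> vol T * (C * (N n)\<^sup>2) / (vol T)\<^sup>2"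
      by (rule divide_right_mono) simp
    then show ?thesis
      unfolding side_mean_smooth[OF T(1) C.cone_axioms g(3)]
      using vol_pos[OF T(1)] by (simp add: power_divide power2_eq_square)
  qed
  have "(\<lambda>n. C / vol T * (N n)\<^sup>2) \<longlonglongrightarrow> C / vol T * 0\<^sup>2"
    using g(6) by (intro tendsto_intros) (simp add: L2_tendsto_def N_def)
  moreover have lim: "(\<lambda>n. (side_mean T p (\<phi> n) (gradient (\<phi> n)))\<^sup>2) \<longlonglongrightarrow> (side_mean T p w (weak_grad \<Omega> w))\<^sup>2"
    by (intro tendsto_power side_mean_tendsto H1_D g)
  ultimately have "(side_mean T p w (weak_grad \<Omega> w))\<^sup>2 \<le> C / vol T * 0\<^sup>2"
    using bound by (intro LIMSEQ_le[OF lim]) auto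
  then show ?thesis by simp
qed

lemma barycenter_side:
  assumes "T \<in> \<T>" "p \<in> verts T"
  shows "barycenter (opposite T p) = (1 / DIM('a)) *\<^sub>R ((\<Sum>z\<in>verts T. z) - p)"
    and "barycenter (opposite T p) \<in> rel_interior (opposite T p)"
proof -
  note o = opposite_simplex[OF assms]
  have "(\<Sum>z\<in>verts T - {p}. z) = (\<Sum>z\<in>verts T. z) - p"
    using finite_verts[OF assms(1)] assms(2) by (simp add: sum_diff1)
  then show "barycenter (opposite T p) = (1 / DIM('a)) *\<^sub>R ((\<Sum>z\<in>verts T. z) - p)"
    unfolding opposite_def barycenter_simplex[OF o(1)] o(3) by simp
  show "barycenter (opposite T p) \<in> rel_interior (opposite T p)"
    unfolding opposite_def by (rule barycenter_in_rel_interior[OF o(1,2)])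
qed

text \<open>The barycenter is a relative interior point of the side, so by conformity every element that
  contains it has the whole side as a facet.\<close>

lemma facet_of_element_at_barycenter:
  assumes T: "T \<in> \<T>" "T' \<in> \<T>" and S: "S facet_of T" and b: "barycenter S \<in> T'"
  shows "S facet_of T'"
proof -
  obtain p where p: "p \<in> verts T" "S = opposite T p" using facetE[OF T(1) S] .
  have bS: "barycenter S \<in> rel_interior S" using barycenter_side(2)[OF T(1) p(1)] p(2) by simp
  have Sf: "S face_of T" and Sne: "S \<noteq> {}" and Sd: "aff_dim S = aff_dim T - 1"
    using S by (auto simp: facet_of_def)
  let ?F = "T \<inter> T'"
  have "barycenter S \<in> ?F" using bS b rel_interior_subset[of S] face_of_imp_subset[OF Sf] by blast
  then have SF: "S \<subseteq> ?F"
    by (intro subset_of_face_of[OF Int_face[OF T] face_of_imp_subset[OF Sf]]) (use bS in \<open>auto simp: disjnt_iff\<close>)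
  show ?thesis
  proof (cases "?F = T")
    case True
    then have "T \<subseteq> T'" by blast
    then have "T = T'" using interior_nonempty[OF T(1)] interiors_disjoint[OF T] interior_subset[of T] by blast
    then show ?thesis using S by simp
  next
    case False
    have F: "?F face_of T" by (rule Int_face[OF T])
    have Fl: "aff_dim ?F < aff_dim T" by (rule face_of_aff_dim_lt[OF convex_element[OF T(1)] F False])
    have "S face_of ?F" by (rule face_of_subset[OF Sf SF]) auto
    moreover have "convex ?F" by (intro convex_Int convex_element T)
    ultimately have "S = ?F" using face_of_aff_dim_lt[of ?F S] Fl Sd by fastforce
    then have "S face_of T'" using Int_face[OF T(2,1)] by (simp add: Int_commute)
    then show ?thesis using Sne Sd element(4)[OF T(1)] element(4)[OF T(2)] by (simp add: facet_of_def)
  qed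
qed

section \<open>Crouzeix--Raviart interpolation\<close>

text \<open>The slope \<open>G\<close> is the mean gradient. The side mean for the vertex \<open>p\<close> and the value \<open>G \<bullet> b\<close> at
  the barycenter \<open>b\<close> of the opposite side depend on \<open>p\<close> through the same term \<open>- (1 / d) (G \<bullet> p)\<close>,
  so a single offset gives the side mean at the barycenter of every side.\<close>

definition offset :: "'a set \<Rightarrow> ('a \<Rightarrow> real) \<Rightarrow> ('a \<Rightarrow> 'a) \<Rightarrow> real" where
  "offset T w g = avg T w + (1 / DIM('a)) * avg T (\<lambda>x. x \<bullet> g x)
     - (1 / DIM('a)) * (avg T g \<bullet> (\<Sum>z\<in>verts T. z))"

definition interpolant :: "('a \<Rightarrow> real) \<Rightarrow> ('a \<Rightarrow> 'a) \<Rightarrow> 'a \<Rightarrow> real" where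
  "interpolant w g x = avg (elem x) g \<bullet> x + offset (elem x) w g"

lemma interpolant_eq:
  "T \<in> \<T> \<Longrightarrow> x \<in> interior T \<Longrightarrow> interpolant w g x = avg T g \<bullet> x + offset T w g"
  by (simp add: interpolant_def elem_eq)

lemma L2_inner_id_integrable:
  assumes "g \<in> L2 M"
  shows "integrable M (\<lambda>x. x \<bullet> g x)"
  by (rule L2_integrable_inner[OF _ assms]) (intro continuous_L2 continuous_on_id)

lemma avg_inner_translate:
  assumes g: "g \<in> L2 M"
  shows "avg T (\<lambda>x. (x - y) \<bullet> g x) = avg T (\<lambda>x. x \<bullet> g x) - y \<bullet> avg T g"
proof -
  have "elint T (\<lambda>x. (x - y) \<bullet> g x) = elint T (\<lambda>x. x \<bullet> g x - y \<bullet> g x)"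
    by (simp add: inner_diff_left)
  also have "\<dots> = elint T (\<lambda>x. x \<bullet> g x) - y \<bullet> elint T g"
    using L2_inner_id_integrable[OF g] L2_integrable[OF g]
    by (subst elint_diff) (simp_all add: elint_inner)
  finally show ?thesis by (simp add: avg_def right_diff_distrib)
qed

lemma side_mean_eq:
  assumes w: "w \<in> L2 M" and g: "g \<in> L2 M"
  shows "side_mean T p w g = avg T w + (1 / DIM('a)) * (avg T (\<lambda>x. x \<bullet> g x) - p \<bullet> avg T g)"
proof -
  have i: "integrable M (\<lambda>x. (x - p) \<bullet> g x)"
    by (rule L2_integrable_inner[OF _ g]) (intro continuous_L2 continuous_intros)
  have "elint T (\<lambda>x. w x + (1 / DIM('a)) * (g x \<bullet> (x - p))) =
      elint T (\<lambda>x. w x + (1 / DIM('a)) * ((x - p) \<bullet> g x))"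
    by (simp add: inner_commute)
  also have "\<dots> = elint T w + (1 / DIM('a)) * elint T (\<lambda>x. (x - p) \<bullet> g x)"
    using i by (subst elint_add[OF L2_integrable[OF w]]) (auto simp only: elint_cmult integrable_mult_right)
  finally have "side_mean T p w g = avg T w + (1 / DIM('a)) * avg T (\<lambda>x. (x - p) \<bullet> g x)"
    by (simp add: side_mean_def avg_def distrib_left)
  then show ?thesis by (simp only: avg_inner_translate[OF g])
qed

lemma interpolant_at_barycenter:
  assumes T: "T \<in> \<T>" "p \<in> verts T" and w: "w \<in> L2 M" and g: "g \<in> L2 M"
  shows "avg T g \<bullet> barycenter (opposite T p) + offset T w g = side_mean T p w g"
  unfolding barycenter_side(1)[OF T] side_mean_eq[OF w g] offset_def
  by (simp add: inner_diff_right inner_commute right_diff_distrib)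

lemma tendsto_within_finite_UN:
  "finite I \<Longrightarrow> (\<And>i. i \<in> I \<Longrightarrow> (f \<longlongrightarrow> l) (at x within A i)) \<Longrightarrow> (f \<longlongrightarrow> l) (at x within (\<Union>i\<in>I. A i))"
  by (induction I rule: finite_induct) (auto intro: Lim_Un)

lemma interpolant_tendsto:
  assumes T: "T \<in> \<T>" "p \<in> verts T" and w: "w \<in> L2 M" and g: "g \<in> L2 M"
    and s: "\<And>n. smooth (\<phi> n)"
    and lim: "L2_tendsto M \<phi> w" "L2_tendsto M (\<lambda>n. gradient (\<phi> n)) g"
    and S: "opposite T p facet_of T"
  shows "(interpolant w g \<longlongrightarrow> side_mean T p w g) (at (barycenter (opposite T p)) within (\<Union>T\<in>\<T>. interior T))"
proof (rule tendsto_within_finite_UN[OF finite_mesh])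
  fix T' assume T': "T' \<in> \<T>"
  let ?b = "barycenter (opposite T p)"
  show "(interpolant w g \<longlongrightarrow> side_mean T p w g) (at ?b within interior T')"
  proof (cases "?b \<in> T'")
    case True
    obtain p' where p': "p' \<in> verts T'" "opposite T p = opposite T' p'"
      using facetE[OF T' facet_of_element_at_barycenter[OF T(1) T' S True]] .
    have "side_mean T p w g = side_mean T' p' w g"
      by (rule side_mean_shared[OF T T' p' w g s lim])
    also have "\<dots> = avg T' g \<bullet> ?b + offset T' w g"
      using interpolant_at_barycenter[OF T' p'(1) w g] p'(2) by simp
    finally have eq: "side_mean T p w g = avg T' g \<bullet> ?b + offset T' w g" .
    have "((\<lambda>x. avg T' g \<bullet> x + offset T' w g) \<longlongrightarrow> avg T' g \<bullet> ?b + offset T' w g) (at ?b within interior T')"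
      by (intro tendsto_intros)
    then show ?thesis unfolding eq
      by (rule Lim_transform_eventually)
        (auto simp: eventually_at_filter interpolant_eq[OF T'])
  next
    case False
    have "closure (interior T') \<subseteq> T'"
      using compact_element[OF T'] interior_subset by (intro closure_minimal) (auto intro: compact_imp_closed)
    then have "?b \<notin> closure (interior T' - {?b})" using False closure_mono[of "interior T' - {?b}" "interior T'"] by blast
    then have "at ?b within interior T' = bot" by (simp add: at_within_eq_bot_iff)
    then show ?thesis by simp
  qed
qed

lemma interpolant_CR:
  assumes w: "w \<in> H1D \<Omega> \<Gamma>D" and pos: "emeasure (hausdorff_measure (DIM('a) - 1)) (X::'a set) > 0"
    and \<Gamma>D: "\<Gamma>D \<subseteq> frontier \<Omega>"
  shows "interpolant w (weak_grad \<Omega> w) \<in> CR \<Omega> \<Gamma>D \<T>"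
proof -
  obtain g \<phi> where g: "w \<in> H1 \<Omega>" "\<And>n. smooth (\<phi> n)"
    "L2_tendsto M \<phi> w" "L2_tendsto M (\<lambda>n. gradient (\<phi> n)) (weak_grad \<Omega> w)"
    using w by (auto simp: H1D_def has_trace_def)
  note L = H1_D[OF g(1)]
  have lim: "\<exists>T\<in>\<T>. \<exists>p\<in>verts T. S = opposite T p \<and>
      (interpolant w (weak_grad \<Omega> w) \<longlongrightarrow> side_mean T p w (weak_grad \<Omega> w)) (at (barycenter S) within (\<Union>T\<in>\<T>. interior T))"
    if S: "S \<in> sides \<T>" for S
  proof -
    obtain T where T: "T \<in> \<T>" "S facet_of T" using S by (auto simp: sides_def)
    obtain p where p: "p \<in> verts T" "S = opposite T p" using facetE[OF T] .
    then show ?thesis using interpolant_tendsto[OF T(1) p(1) L g(2,3,4)] T by blast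
  qed
  have "interpolant w (weak_grad \<Omega> w) \<in> elementwise_polynomials 1 \<T>"
    unfolding EP1_iff using interpolant_eq by blast
  moreover have "\<exists>l. (interpolant w (weak_grad \<Omega> w) \<longlongrightarrow> l) (at (barycenter S) within (\<Union>T\<in>\<T>. interior T))"
    if "S \<in> interior_sides \<Omega> \<T>" for S
    using lim[of S] that by (auto simp: interior_sides_def)
  moreover have "(interpolant w (weak_grad \<Omega> w) \<longlongrightarrow> 0) (at (barycenter S) within (\<Union>T\<in>\<T>. interior T))"
    if S: "S \<in> sides \<T>" "S \<subseteq> \<Gamma>D" for S
  proof -
    obtain T p where T: "T \<in> \<T>" "p \<in> verts T" "S = opposite T p"
      "(interpolant w (weak_grad \<Omega> w) \<longlongrightarrow> side_mean T p w (weak_grad \<Omega> w)) (at (barycenter S) within (\<Union>T\<in>\<T>. interior T))"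
      using lim[OF S(1)] by blast
    have "side_mean T p w (weak_grad \<Omega> w) = 0"
      by (rule side_mean_Dirichlet[OF w pos \<Gamma>D T(1,2)]) (use T(3) S(2) in simp)
    then show ?thesis using T(4) by simp
  qed
  ultimately show ?thesis by (auto simp: CR_def)
qed

section \<open>The equilibrated flux\<close>

text \<open>This is the centroid of the simplex, in the form in which it arises from the offset of the
  interpolant.\<close>

definition anchor :: "'a set \<Rightarrow> 'a" where
  "anchor T = (\<Sum>z\<in>verts T. z) - real DIM('a) *\<^sub>R avg T (\<lambda>x. x)"

lemma norm_elint_le:
  fixes f :: "'a \<Rightarrow> 'b::euclidean_space"
  assumes T: "T \<in> \<T>" and f: "f \<in> L2 M" and B: "\<And>x. x \<in> interior T \<Longrightarrow> norm (f x) \<le> B"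
  shows "norm (elint T f) \<le> vol T * B"
proof -
  have i: "integrable M (\<lambda>x. indicator (interior T) x *\<^sub>R f x)"
    by (rule integrable_elint[OF L2_integrable[OF f]])
  have "norm (elint T f) \<le> (\<integral>x. norm (indicator (interior T) x *\<^sub>R f x) \<partial>M)"
    unfolding elint_def by (rule integral_norm_bound)
  also have "\<dots> \<le> elint T (\<lambda>x. B)"
    unfolding elint_def
    by (rule integral_mono[OF integrable_norm[OF i] integrable_elint[OF const_integrable]])
      (use B in \<open>auto simp: indicator_def\<close>)
  finally show ?thesis by (simp add: elint_const[OF T])
qed

lemma norm_anchor_le:
  assumes T: "T \<in> \<T>" and x: "x \<in> T"
  shows "norm (x - anchor T) \<le> (DIM('a) + 1) * diameter T"
proof -
  define b where "b = barycenter T"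
  note e = element[OF T]
  have "verts T \<noteq> {}" using e(2) by (metis card.empty add_is_0 zero_neq_one)
  then have "b \<in> rel_interior T"
    unfolding b_def using barycenter_in_rel_interior[OF e(1)] e(3) by simp
  then have bT: "b \<in> T" using rel_interior_subset by blast
  have bsum: "(\<Sum>z\<in>verts T. z) = (real DIM('a) + 1) *\<^sub>R b"
    using barycenter_simplex[OF e(1)] e(2,3) unfolding b_def by (simp add: add.commute)
  have diam: "norm (y - b) \<le> diameter T" if "y \<in> T" for y
    using diameter_bounded_bound[OF compact_imp_bounded[OF compact_element[OF T]] that bT] by (simp add: dist_norm)
  have id: "(\<lambda>x. x) \<in> L2 M" by (intro continuous_L2 continuous_on_id)
  have "elint T (\<lambda>x. x - b) = elint T (\<lambda>x. x) - vol T *\<^sub>R b"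
    using elint_diff[OF L2_integrable[OF id] const_integrable, of T b] elint_const[OF T, of b] by simp
  then have "avg T (\<lambda>x. x) - b = (1 / vol T) *\<^sub>R elint T (\<lambda>x. x - b)"
    using vol_pos[OF T] by (simp add: avg_def scaleR_diff_right)
  moreover have "norm (elint T (\<lambda>x. x - b)) \<le> vol T * diameter T"
    by (rule norm_elint_le[OF T]) (use diam interior_subset in \<open>auto intro!: continuous_L2 continuous_intros\<close>)
  ultimately have c: "norm (avg T (\<lambda>x. x) - b) \<le> diameter T"
    using vol_pos[OF T] by (simp add: field_simps)
  have "x - anchor T = (x - b) + real DIM('a) *\<^sub>R (avg T (\<lambda>x. x) - b)"
    by (simp add: anchor_def bsum algebra_simps)
  also have "norm \<dots> \<le> norm (x - b) + real DIM('a) * norm (avg T (\<lambda>x. x) - b)"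
    by (rule order_trans[OF norm_triangle_ineq]) simp
  also have "\<dots> \<le> diameter T + real DIM('a) * diameter T"
    by (intro add_mono mult_left_mono diam x c) simp
  finally show ?thesis by (simp add: algebra_simps)
qed

lemma elint_interpolant:
  assumes T: "T \<in> \<T>" and w: "w \<in> L2 M" and g: "g \<in> L2 M"
  shows "elint T (interpolant w g) = elint T w + (1 / DIM('a)) * elint T (\<lambda>x. (x - anchor T) \<bullet> g x)"
proof -
  have id: "integrable M (\<lambda>x. x)" by (intro L2_integrable continuous_L2 continuous_on_id)
  have "elint T (interpolant w g) = elint T (\<lambda>x. avg T g \<bullet> x + offset T w g)"
    by (rule elint_cong) (rule interpolant_eq[OF T])
  also have "\<dots> = avg T g \<bullet> elint T (\<lambda>x. x) + vol T * offset T w g"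
    using id by (subst elint_add) (auto simp: elint_inner[OF id] elint_const[OF T] const_integrable)
  also have "\<dots> = vol T * (avg T g \<bullet> avg T (\<lambda>x. x) + offset T w g)"
    by (simp add: elint_eq_avg[OF T] distrib_left)
  also have "avg T g \<bullet> avg T (\<lambda>x. x) + offset T w g = avg T w + (1 / DIM('a)) * (avg T (\<lambda>x. x \<bullet> g x) - anchor T \<bullet> avg T g)"
    unfolding offset_def anchor_def by (simp add: inner_diff_left inner_diff_right inner_commute field_simps)
  also have "\<dots> = avg T w + (1 / DIM('a)) * avg T (\<lambda>x. (x - anchor T) \<bullet> g x)"
    by (simp only: avg_inner_translate[OF g])
  finally show ?thesis by (simp add: elint_eq_avg[OF T] distrib_left)
qed

text \<open>Marini's formula: subtracting this from the discrete gradient yields the equilibrated flux.\<close>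

definition flux_correction :: "('a \<Rightarrow> real) \<Rightarrow> 'a \<Rightarrow> 'a" where
  "flux_correction c x = (c x / DIM('a)) *\<^sub>R (x - anchor (elem x))"

lemma flux_correction_L2:
  assumes "c \<in> elementwise_polynomials 0 \<T>"
  shows "flux_correction c \<in> L2 M"
proof (rule elementwise_L2)
  fix T assume T: "T \<in> \<T>"
  obtain k where "\<forall>x\<in>interior T. c x = k" using assms T by (auto simp: EP0_iff)
  then show "\<exists>g. continuous_on UNIV g \<and> (\<forall>x\<in>interior T. flux_correction c x = g x)"
    by (intro exI[of _ "\<lambda>x. (k / DIM('a)) *\<^sub>R (x - anchor T)"])
      (auto simp: flux_correction_def elem_eq[OF T] intro!: continuous_intros)
qed

lemma broken_grad_elementwise:
  assumes v: "v \<in> elementwise_polynomials 1 \<T>"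
  obtains G where "\<And>T x. T \<in> \<T> \<Longrightarrow> x \<in> interior T \<Longrightarrow> broken_grad \<T> v x = G T"
proof -
  obtain G b where Gb: "\<And>T x. T \<in> \<T> \<Longrightarrow> x \<in> interior T \<Longrightarrow> v x = G T \<bullet> x + b T"
    using v unfolding EP1_iff by metis
  have "broken_grad \<T> v x = G T" if T: "T \<in> \<T>" "x \<in> interior T" for T x
    using gradient_affine_on_open[OF open_interior T(2) Gb[OF T(1)]] T by (auto simp: broken_grad_def)
  then show ?thesis by (rule that)
qed

lemma broken_grad_L2:
  assumes "v \<in> elementwise_polynomials 1 \<T>"
  shows "broken_grad \<T> v \<in> L2 M"
  by (rule broken_grad_elementwise[OF assms], rule elementwise_const_L2) blast

text \<open>The interpolant is an admissible test function in the discrete equation. As its gradient is the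
  elementwise mean of \<open>\<nabla>w\<close>, the left-hand side is the same for \<open>w\<close>; on the right-hand side the
  elementwise means of \<open>w\<close> and of its interpolant differ by the term that the flux correction absorbs.\<close>

lemma flux_identity:
  assumes w: "w \<in> H1D \<Omega> \<Gamma>D" and pos: "emeasure (hausdorff_measure (DIM('a) - 1)) (X::'a set) > 0"
    and \<Gamma>D: "\<Gamma>D \<subseteq> frontier \<Omega>"
    and uh: "u_h \<in> elementwise_polynomials 1 \<T>" and c: "c \<in> elementwise_polynomials 0 \<T>"
    and eq: "\<And>v. v \<in> CR \<Omega> \<Gamma>D \<T> \<Longrightarrow> L2_inner M (broken_grad \<T> u_h) (broken_grad \<T> v) =
      L2_inner M c (L2_proj \<Omega> \<T> v)"
  shows "L2_inner M (\<lambda>x. broken_grad \<T> u_h x - flux_correction c x) (weak_grad \<Omega> w) =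
    L2_inner M c w"
proof -
  have H: "w \<in> H1 \<Omega>" using w by (simp add: H1D_def)
  let ?g = "weak_grad \<Omega> w" and ?J = "interpolant w (weak_grad \<Omega> w)"
  note L = H1_D[OF H]
  have J: "?J \<in> CR \<Omega> \<Gamma>D \<T>" by (rule interpolant_CR[OF w pos \<Gamma>D])
  then have J1: "?J \<in> elementwise_polynomials 1 \<T>" by (simp add: CR_def)
  obtain G where G: "\<And>T x. T \<in> \<T> \<Longrightarrow> x \<in> interior T \<Longrightarrow> broken_grad \<T> u_h x = G T"
    using broken_grad_elementwise[OF uh] by metis
  obtain b where b: "\<And>T x. T \<in> \<T> \<Longrightarrow> x \<in> interior T \<Longrightarrow> c x = b T" using c unfolding EP0_iff by metis
  have gJ: "broken_grad \<T> ?J x = avg T ?g" if T: "T \<in> \<T>" "x \<in> interior T" for T x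
    using gradient_affine_on_open[OF open_interior T(2) interpolant_eq[OF T(1)]] T by (auto simp: broken_grad_def)
  have "L2_inner M (broken_grad \<T> u_h) (broken_grad \<T> ?J) =
      (\<Sum>T\<in>\<T>. elint T (\<lambda>x. broken_grad \<T> u_h x \<bullet> broken_grad \<T> ?J x))"
    by (rule L2_inner_eq_sum[OF broken_grad_L2[OF uh] broken_grad_L2[OF J1]])
  also have "\<dots> = (\<Sum>T\<in>\<T>. elint T (\<lambda>x. broken_grad \<T> u_h x \<bullet> ?g x))"
  proof (rule sum.cong[OF refl])
    fix T assume T: "T \<in> \<T>"
    have "elint T (\<lambda>x. broken_grad \<T> u_h x \<bullet> broken_grad \<T> ?J x) = elint T (\<lambda>x. G T \<bullet> avg T ?g)"
      by (rule elint_cong) (simp add: G[OF T] gJ[OF T])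
    also have "\<dots> = G T \<bullet> elint T ?g" by (simp add: elint_const[OF T] elint_eq_avg[OF T])
    also have "\<dots> = elint T (\<lambda>x. G T \<bullet> ?g x)" by (rule elint_inner[symmetric, OF L2_integrable[OF L(2)]])
    also have "\<dots> = elint T (\<lambda>x. broken_grad \<T> u_h x \<bullet> ?g x)"
      by (rule elint_cong) (simp add: G[OF T])
    finally show "elint T (\<lambda>x. broken_grad \<T> u_h x \<bullet> broken_grad \<T> ?J x) = elint T (\<lambda>x. broken_grad \<T> u_h x \<bullet> ?g x)" .
  qed
  also have "\<dots> = L2_inner M (broken_grad \<T> u_h) ?g"
    by (rule L2_inner_eq_sum[symmetric, OF broken_grad_L2[OF uh] L(2)])
  finally have left: "L2_inner M (broken_grad \<T> u_h) (broken_grad \<T> ?J) =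
      L2_inner M (broken_grad \<T> u_h) ?g" .
  have Ji: "integrable M ?J" by (rule L2_integrable[OF EP1_L2[OF J1]])
  have "L2_inner M c (L2_proj \<Omega> \<T> ?J) = L2_inner M c ?J"
    by (rule L2_inner_proj[OF c Ji])
  also have "\<dots> = (\<Sum>T\<in>\<T>. b T * elint T ?J)"
    unfolding L2_inner_def inner_real_def using integral_mult_EP0[where p=c and c=b, OF Ji b] by (simp add: mult.commute)
  also have "\<dots> = (\<Sum>T\<in>\<T>. b T * elint T w) + (\<Sum>T\<in>\<T>. elint T (\<lambda>x. flux_correction c x \<bullet> ?g x))"
    unfolding sum.distrib[symmetric]
  proof (rule sum.cong[OF refl])
    fix T assume T: "T \<in> \<T>"
    have "elint T (\<lambda>x. flux_correction c x \<bullet> ?g x) = elint T (\<lambda>x. (b T / DIM('a)) * ((x - anchor T) \<bullet> ?g x))"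
      by (rule elint_cong) (simp add: flux_correction_def elem_eq[OF T] b[OF T])
    also have "\<dots> = (b T / DIM('a)) * elint T (\<lambda>x. (x - anchor T) \<bullet> ?g x)"
      by (rule elint_cmult)
    finally show "b T * elint T ?J = b T * elint T w + elint T (\<lambda>x. flux_correction c x \<bullet> ?g x)"
      by (simp add: elint_interpolant[OF T L] distrib_left)
  qed
  also have "(\<Sum>T\<in>\<T>. b T * elint T w) = L2_inner M c w"
    unfolding L2_inner_def inner_real_def
    using integral_mult_EP0[where p=c and c=b, OF L2_integrable[OF L(1)] b] by (simp add: mult.commute)
  also have "(\<Sum>T\<in>\<T>. elint T (\<lambda>x. flux_correction c x \<bullet> ?g x)) = L2_inner M (flux_correction c) ?g"
    by (rule L2_inner_eq_sum[symmetric, OF flux_correction_L2[OF c] L(2)])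
  finally show ?thesis
    using eq[OF J] left L2_inner_diff_left[OF broken_grad_L2[OF uh] flux_correction_L2[OF c] L(2)] by simp
qed

end

section \<open>Data oscillation\<close>

context mesh
begin

lemma EP0_scaleR_L2:
  fixes f :: "'a \<Rightarrow> 'b::euclidean_space"
  assumes p: "p \<in> elementwise_polynomials 0 \<T>" and f: "f \<in> L2 M"
  shows "(\<lambda>x. p x *\<^sub>R f x) \<in> L2 M"
proof -
  have c: "\<exists>g. continuous_on UNIV g \<and> (\<forall>x\<in>interior T. p x = g x)" if T: "T \<in> \<T>" for T
  proof -
    obtain k where "\<forall>x\<in>interior T. p x = k" using p T by (auto simp: EP0_iff)
    then show ?thesis by (intro exI[of _ "\<lambda>_. k"]) auto
  qed
  obtain B where "AE x in M. norm (p x) \<le> B" using elementwise_bounded[OF c] by metis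
  then show ?thesis by (intro L2_bounded_mult[OF f elementwise_measurable[OF c]]) auto
qed

lemma meshsize_on_element: "T \<in> \<T> \<Longrightarrow> x \<in> interior T \<Longrightarrow> meshsize \<T> x = diameter T"
  by (simp add: meshsize_eq elem_eq)

lemma meshsize_EP0: "meshsize \<T> \<in> elementwise_polynomials 0 \<T>"
  using meshsize_on_element by (auto simp: EP0_iff)

lemma inverse_meshsize_EP0: "(\<lambda>x. 1 / meshsize \<T> x) \<in> elementwise_polynomials 0 \<T>"
  using meshsize_on_element by (auto simp: EP0_iff)

lemma diameter_pos: "T \<in> \<T> \<Longrightarrow> diameter T > 0"
proof -
  assume T: "T \<in> \<T>"
  obtain x e where xe: "e > 0" "cball x e \<subseteq> T"
    using interior_nonempty[OF T] by (metis equals0I mem_interior_cball)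
  have "0 < diameter (cball x e)" using xe by simp
  also have "\<dots> \<le> diameter T" by (rule diameter_subset[OF xe(2) compact_imp_bounded[OF compact_element[OF T]]])
  finally show ?thesis .
qed

lemma EP0_diff:
  assumes "p \<in> elementwise_polynomials 0 \<T>" "q \<in> elementwise_polynomials 0 \<T>"
  shows "(\<lambda>x. p x - q x) \<in> elementwise_polynomials 0 \<T>"
  unfolding EP0_iff
proof
  fix T assume T: "T \<in> \<T>"
  obtain a b where "\<forall>x\<in>interior T. p x = a" "\<forall>x\<in>interior T. q x = b" using assms T unfolding EP0_iff by blast
  then show "\<exists>c. \<forall>x\<in>interior T. p x - q x = c" by auto
qed

lemma L2_norm_sq_eq_sum:
  assumes "f \<in> L2 M"
  shows "(L2_norm M f)\<^sup>2 = (\<Sum>T\<in>\<T>. elint T (\<lambda>x. (norm (f x))\<^sup>2))"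
  unfolding L2_norm_sq by (rule integral_eq_sum_elint[OF L2_D(2)[OF assms]])

text \<open>The local mesh size is divided out, so that the Poincare inequalities of all elements have the same
  constant and can be added up.\<close>

lemma broken_Poincare:
  assumes \<phi>: "smooth \<phi>"
  shows "L2_norm M (\<lambda>x. (1 / meshsize \<T> x) *\<^sub>R (\<phi> x - L2_proj \<Omega> \<T> \<phi> x)) \<le>
    sqrt (2 ^ DIM('a)) * L2_norm M (gradient \<phi>)"
proof (rule power2_le_imp_le)
  note L = smooth_L2[OF \<phi>]
  note c = smooth_continuous[OF \<phi>] smooth_continuous_gradient[OF \<phi>]
  have d: "(\<lambda>x. \<phi> x - L2_proj \<Omega> \<T> \<phi> x) \<in> L2 M"
    by (intro L2_diff L L2_proj_L2 L2_integrable)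
  have "(L2_norm M (\<lambda>x. (1 / meshsize \<T> x) *\<^sub>R (\<phi> x - L2_proj \<Omega> \<T> \<phi> x)))\<^sup>2 =
      (\<Sum>T\<in>\<T>. elint T (\<lambda>x. (norm ((1 / meshsize \<T> x) *\<^sub>R (\<phi> x - L2_proj \<Omega> \<T> \<phi> x)))\<^sup>2))"
    by (rule L2_norm_sq_eq_sum[OF EP0_scaleR_L2[OF inverse_meshsize_EP0 d]])
  also have "\<dots> \<le> (\<Sum>T\<in>\<T>. 2 ^ DIM('a) * elint T (\<lambda>x. (norm (gradient \<phi> x))\<^sup>2))"
  proof (rule sum_mono)
    fix T assume T: "T \<in> \<T>"
    define m where "m = avg T \<phi>"
    have [measurable]: "\<phi> \<in> borel_measurable borel" "gradient \<phi> \<in> borel_measurable borel"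
      by (intro borel_measurable_continuous_onI c)+
    have m: "m = (\<integral>x. indicator T x * \<phi> x \<partial>lborel) / measure lborel T"
      unfolding m_def avg_def using elint_borel[OF T, of \<phi>] by (simp add: vol_def)
    have P: "elint T (\<lambda>x. (\<phi> x - m)\<^sup>2) \<le> 2 ^ DIM('a) * (diameter T)\<^sup>2 * elint T (\<lambda>x. (norm (gradient \<phi> x))\<^sup>2)"
      using Poincare_convex[OF convex_element[OF T] compact_element[OF T] vol_pos[OF T, unfolded vol_def] \<phi> m]
        elint_borel[OF T, of "\<lambda>x. (\<phi> x - m)\<^sup>2"] elint_borel[OF T, of "\<lambda>x. (norm (gradient \<phi> x))\<^sup>2"]
      by simp
    have "elint T (\<lambda>x. (norm ((1 / meshsize \<T> x) *\<^sub>R (\<phi> x - L2_proj \<Omega> \<T> \<phi> x)))\<^sup>2) =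
        elint T (\<lambda>x. (1 / (diameter T)\<^sup>2) * (\<phi> x - m)\<^sup>2)"
      by (rule elint_cong)
        (simp add: meshsize_on_element[OF T] L2_proj_spec(2)[OF L2_integrable[OF L(1)] T] m_def
          power_mult_distrib power_divide)
    also have "\<dots> = (1 / (diameter T)\<^sup>2) * elint T (\<lambda>x. (\<phi> x - m)\<^sup>2)" by (rule elint_cmult)
    also have "\<dots> \<le> (1 / (diameter T)\<^sup>2) * (2 ^ DIM('a) * (diameter T)\<^sup>2 * elint T (\<lambda>x. (norm (gradient \<phi> x))\<^sup>2))"
      by (rule mult_left_mono[OF P]) simp
    also have "\<dots> = 2 ^ DIM('a) * elint T (\<lambda>x. (norm (gradient \<phi> x))\<^sup>2)"
      using diameter_pos[OF T] by simp
    finally show "elint T (\<lambda>x. (norm ((1 / meshsize \<T> x) *\<^sub>R (\<phi> x - L2_proj \<Omega> \<T> \<phi> x)))\<^sup>2) \<le>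
        2 ^ DIM('a) * elint T (\<lambda>x. (norm (gradient \<phi> x))\<^sup>2)" .
  qed
  also have "\<dots> = 2 ^ DIM('a) * (L2_norm M (gradient \<phi>))\<^sup>2"
    by (simp only: L2_norm_sq_eq_sum[OF L(2)] sum_distrib_left)
  also have "\<dots> = (sqrt (2 ^ DIM('a)) * L2_norm M (gradient \<phi>))\<^sup>2"
    by (simp add: power_mult_distrib)
  finally show "(L2_norm M (\<lambda>x. (1 / meshsize \<T> x) *\<^sub>R (\<phi> x - L2_proj \<Omega> \<T> \<phi> x)))\<^sup>2 \<le>
    (sqrt (2 ^ DIM('a)) * L2_norm M (gradient \<phi>))\<^sup>2" .
qed simp

text \<open>For smooth \<open>w\<close> the elementwise mean of \<open>w\<close> may be subtracted, since \<open>f\<^sub>h - f\<close> is orthogonal to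
  elementwise constants; the bound then follows from the broken Poincare inequality and is stable
  under limits in \<open>H\<^sup>1\<close>.\<close>

lemma oscillation_pairing:
  fixes f w :: "'a \<Rightarrow> real"
  assumes f: "f \<in> L2 M" and w: "w \<in> H1D \<Omega> \<Gamma>D"
  shows "\<bar>L2_inner M (\<lambda>x. L2_proj \<Omega> \<T> f x - f x) w\<bar> \<le>
    sqrt (2 ^ DIM('a)) * L2_norm M (\<lambda>x. meshsize \<T> x * (L2_proj \<Omega> \<T> f x - f x)) *
      L2_norm M (weak_grad \<Omega> w)"
proof -
  obtain g \<phi> where g: "w \<in> H1 \<Omega>" "\<And>n. smooth (\<phi> n)"
    "L2_tendsto M \<phi> w" "L2_tendsto M (\<lambda>n. gradient (\<phi> n)) (weak_grad \<Omega> w)"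
    using w by (auto simp: H1D_def has_trace_def)
  let ?o = "\<lambda>x. L2_proj \<Omega> \<T> f x - f x" and ?K = "sqrt (2 ^ DIM('a))"
  let ?O = "L2_norm M (\<lambda>x. meshsize \<T> x * ?o x)"
  note fi = L2_integrable[OF f]
  have Pf: "L2_proj \<Omega> \<T> f \<in> L2 M" by (rule L2_proj_L2[OF fi])
  have o: "?o \<in> L2 M" by (intro L2_diff Pf f)
  have ho: "(\<lambda>x. meshsize \<T> x * ?o x) \<in> L2 M" using EP0_scaleR_L2[OF meshsize_EP0 o] by simp
  have bound: "\<bar>L2_inner M ?o (\<phi> n)\<bar> \<le> ?K * ?O * L2_norm M (gradient (\<phi> n))" for n
  proof -
    note L = smooth_L2[OF g(2)[of n]]
    let ?P = "L2_proj \<Omega> \<T> (\<phi> n)"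
    have PE: "?P \<in> elementwise_polynomials 0 \<T>" by (rule L2_proj_spec(1)[OF L2_integrable[OF L(1)]])
    have P: "?P \<in> L2 M" by (rule EP0_L2[OF PE])
    have d: "(\<lambda>x. \<phi> n x - ?P x) \<in> L2 M" by (intro L2_diff L P)
    have hd: "(\<lambda>x. (1 / meshsize \<T> x) *\<^sub>R (\<phi> n x - ?P x)) \<in> L2 M"
      by (rule EP0_scaleR_L2[OF inverse_meshsize_EP0 d])
    have "L2_inner M ?o ?P = 0"
      using L2_inner_diff_left[OF Pf f P] L2_inner_proj[OF PE fi] by (simp add: L2_inner_commute)
    then have "L2_inner M ?o (\<phi> n) = L2_inner M ?o (\<lambda>x. \<phi> n x - ?P x)"
      using L2_inner_diff_right[OF o L(1) P] by simp
    also have "\<dots> = L2_inner M (\<lambda>x. meshsize \<T> x * ?o x) (\<lambda>x. (1 / meshsize \<T> x) *\<^sub>R (\<phi> n x - ?P x))"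
      unfolding L2_inner_def
    proof (rule integral_cong_AE)
      show "(\<lambda>x. ?o x \<bullet> (\<phi> n x - ?P x)) \<in> borel_measurable M"
        by (rule borel_measurable_integrable[OF L2_integrable_inner[OF o d]])
      show "(\<lambda>x. (meshsize \<T> x * ?o x) \<bullet> ((1 / meshsize \<T> x) *\<^sub>R (\<phi> n x - ?P x))) \<in> borel_measurable M"
        by (rule borel_measurable_integrable[OF L2_integrable_inner[OF ho hd]])
      show "AE x in M. ?o x \<bullet> (\<phi> n x - ?P x) = (meshsize \<T> x * ?o x) \<bullet> ((1 / meshsize \<T> x) *\<^sub>R (\<phi> n x - ?P x))"
        using AE_in_element
      proof eventually_elim
        case (elim x)
        then obtain T where T: "T \<in> \<T>" "x \<in> interior T" by blast
        then have "meshsize \<T> x \<noteq> 0" using meshsize_on_element[OF T] diameter_pos[OF T(1)] by simp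
        then show ?case by simp
      qed
    qed
    finally have "\<bar>L2_inner M ?o (\<phi> n)\<bar> \<le> ?O * L2_norm M (\<lambda>x. (1 / meshsize \<T> x) *\<^sub>R (\<phi> n x - ?P x))"
      using L2_Cauchy_Schwarz[OF ho hd] by simp
    also have "\<dots> \<le> ?O * (?K * L2_norm M (gradient (\<phi> n)))"
      by (rule mult_left_mono[OF broken_Poincare[OF g(2)]]) simp
    finally show ?thesis by (simp add: mult_ac)
  qed
  have "(\<lambda>n. \<bar>L2_inner M ?o (\<phi> n)\<bar>) \<longlonglongrightarrow> \<bar>L2_inner M ?o w\<bar>"
    unfolding L2_inner_commute[of M ?o]
    by (intro tendsto_rabs L2_tendsto_inner g H1_D o)
  moreover have "(\<lambda>n. ?K * ?O * L2_norm M (gradient (\<phi> n))) \<longlonglongrightarrow> ?K * ?O * L2_norm M (weak_grad \<Omega> w)"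
    by (intro tendsto_mult tendsto_const L2_tendsto_norm g H1_D)
  ultimately show ?thesis using bound by (intro LIMSEQ_le) auto
qed

section \<open>Reliability\<close>

lemma norm_flux_correction_le:
  assumes c: "c \<in> elementwise_polynomials 0 \<T>"
  shows "L2_norm M (flux_correction c) \<le>
    (real DIM('a) + 1) * ((1 / DIM('a)) * L2_norm M (\<lambda>x. meshsize \<T> x * c x))"
proof -
  let ?k = "(real DIM('a) + 1) * (1 / DIM('a))"
  have hc: "(\<lambda>x. meshsize \<T> x *\<^sub>R c x) \<in> L2 M" by (rule EP0_scaleR_L2[OF meshsize_EP0 EP0_L2[OF c]])
  have "L2_norm M (flux_correction c) \<le> L2_norm M (\<lambda>x. ?k *\<^sub>R (meshsize \<T> x *\<^sub>R c x))"
  proof (rule L2_norm_mono[OF flux_correction_L2[OF c] L2_scaleR[OF hc]])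
    show "AE x in M. norm (flux_correction c x) \<le> norm (?k *\<^sub>R (meshsize \<T> x *\<^sub>R c x))"
      using AE_in_element
    proof eventually_elim
      case (elim x)
      then obtain T where T: "T \<in> \<T>" "x \<in> interior T" by blast
      have "norm (flux_correction c x) = \<bar>c x\<bar> / DIM('a) * norm (x - anchor T)"
        using T by (simp add: flux_correction_def elem_eq)
      also have "\<dots> \<le> \<bar>c x\<bar> / DIM('a) * ((DIM('a) + 1) * diameter T)"
        using norm_anchor_le[OF T(1)] T(2) interior_subset by (intro mult_left_mono) auto
      also have "\<dots> = norm (?k *\<^sub>R (meshsize \<T> x *\<^sub>R c x))"
        using meshsize_on_element[OF T] diameter_pos[OF T(1)] by (simp add: abs_mult)
      finally show ?case .
    qed
  qed
  also have "\<dots> = ?k * L2_norm M (\<lambda>x. meshsize \<T> x * c x)"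
    unfolding L2_norm_scaleR by simp
  finally show ?thesis by simp
qed

text \<open>The zero function is admissible in the supremum of the dual norm, which would otherwise be one of an
  empty set.\<close>

lemma zero_in_H1D:
  fixes v :: "'a \<Rightarrow> real"
  assumes v: "v \<in> H1D \<Omega> \<Gamma>D"
  shows "(\<lambda>x. 0) \<in> H1D \<Omega> \<Gamma>D" "L2_norm M (\<lambda>x. 0 :: real) = 0"
    "L2_norm M (weak_grad \<Omega> (\<lambda>x. 0)) = 0"
proof -
  have H: "v \<in> H1 \<Omega>" using v by (simp add: H1D_def)
  show "(\<lambda>x. 0) \<in> H1D \<Omega> \<Gamma>D" using H1D_diff[OF open_domain bounded_domain v v] by simp
  show "L2_norm M (\<lambda>x. 0 :: real) = 0" by (simp add: L2_norm_def L2_inner_def)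
  have "(\<lambda>x. 0) \<in> H1 \<Omega>" using H1_diff(1)[OF open_domain bounded_domain H H] by simp
  note m = L2_D(1)[OF H1_D(2)[OF this]]
  have "L2_norm M (weak_grad \<Omega> (\<lambda>x. 0)) = L2_norm M (\<lambda>x. 0 :: 'a)"
    by (rule L2_norm_AE_cong[OF m])
      (use H1_diff(2)[OF open_domain bounded_domain H H] in simp_all)
  then show "L2_norm M (weak_grad \<Omega> (\<lambda>x. 0)) = 0" by (simp add: L2_norm_def L2_inner_def)
qed

lemma dual_norm_square_le:
  fixes v :: "'a \<Rightarrow> real"
  assumes v: "v \<in> H1D \<Omega> \<Gamma>D" and D: "0 \<le> D"
    and \<Phi>: "\<And>w. w \<in> H1D \<Omega> \<Gamma>D \<Longrightarrow> \<bar>\<Phi> w\<bar> \<le> D * L2_norm M (weak_grad \<Omega> w)"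
  shows "(dual_norm \<Omega> \<Gamma>D \<Phi>)\<^sup>2 \<le> D\<^sup>2"
proof -
  let ?X = "{\<Phi> v | v. v \<in> H1D \<Omega> \<Gamma>D \<and>
       L2_norm M v + L2_norm M (weak_grad \<Omega> v) \<le> 1}"
  have b: "\<bar>y\<bar> \<le> D" if "y \<in> ?X" for y
  proof -
    obtain w where w: "y = \<Phi> w" "w \<in> H1D \<Omega> \<Gamma>D"
      "L2_norm M w + L2_norm M (weak_grad \<Omega> w) \<le> 1" using \<open>y \<in> ?X\<close> by blast
    have "L2_norm M (weak_grad \<Omega> w) \<le> 1"
      using w(3) L2_norm_nonneg[of "M" w] by linarith
    then have "D * L2_norm M (weak_grad \<Omega> w) \<le> D" using D by (simp add: mult_left_le)
    then show ?thesis using \<Phi>[OF w(2)] w(1) by simp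
  qed
  have z: "\<Phi> (\<lambda>x. 0) \<in> ?X"
    using zero_in_H1D[OF v] by (intro CollectI exI[of _ "\<lambda>x. 0"]) simp
  have "Sup ?X \<le> D" using z b by (intro cSup_least) (auto simp: abs_le_iff)
  moreover have "\<Phi> (\<lambda>x. 0) \<le> Sup ?X" using z b by (intro cSup_upper bdd_aboveI[of _ D]) (auto simp: abs_le_iff)
  then have "- D \<le> Sup ?X" using b[OF z] by linarith
  ultimately have "\<bar>Sup ?X\<bar> \<le> \<bar>D\<bar>" by linarith
  then show ?thesis unfolding dual_norm_def by (simp only: abs_le_square_iff)
qed

text \<open>Below, \<open>R1\<close> is the energy difference, \<open>R\<close> and \<open>B\<close> are the complementarity terms of the error and
  of the estimator, and \<open>Q\<close> bounds the distance of \<open>\<nabla>v\<close> to the equilibrated flux. Absorbing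
  \<open>\<bar>\<nabla>e\<bar>\<close> in the basic identity gives \<open>R1 + R + E\<^sup>2 / 4 \<le> X + B\<close> with \<open>X = (Q + O')\<^sup>2\<close>. The last two
  terms of the error are at most \<open>(E + A)\<^sup>2\<close> and \<open>(E + Q + O')\<^sup>2\<close>, so the error is at most
  \<open>19 X + 17 B + 2 A\<^sup>2\<close>; with \<open>X \<le> 3 A\<^sup>2 + 3 (d + 1)\<^sup>2 C\<^sup>2 + 3 O'\<^sup>2\<close> this explains the constants.\<close>

lemma reliability_estimate:
  fixes f chi u v :: "'a \<Rightarrow> real"
  assumes pos: "emeasure (hausdorff_measure (DIM('a) - 1)) (X::'a set) > 0" and \<Gamma>D: "\<Gamma>D \<subseteq> frontier \<Omega>"
    and f: "f \<in> L2 M" and chi: "chi \<in> L2 M"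
    and u: "u \<in> H1D \<Omega> \<Gamma>D" "AE x in M. chi x \<le> u x"
    and v: "v \<in> H1D \<Omega> \<Gamma>D" "AE x in M. chi x \<le> v x"
    and min: "energy \<Omega> f u \<le> energy \<Omega> f v"
    and uh: "u_h \<in> CR \<Omega> \<Gamma>D \<T>" and \<lambda>: "CR_multiplier \<Omega> \<Gamma>D \<T> f u_h lambda_h"
  shows "rho_sq \<Omega> \<Gamma>D \<T> f chi u u_h lambda_h v \<le>
    (59 * (real DIM('a) + 1)\<^sup>2) * eta_sq \<Omega> \<T> f chi u_h lambda_h v + (57 * 2 ^ DIM('a)) * osc_sq \<Omega> \<T> f"
proof -
  let ?d = "real DIM('a)"
  let ?gu = "weak_grad \<Omega> u" and ?gv = "weak_grad \<Omega> v" and ?gh = "broken_grad \<T> u_h"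
  let ?ge = "\<lambda>x. ?gv x - ?gu x" and ?e = "\<lambda>x. v x - u x"
  have uH: "u \<in> H1 \<Omega>" and vH: "v \<in> H1 \<Omega>" using u v by (auto simp: H1D_def)
  note Lu = H1_D[OF uH] and Lv = H1_D[OF vH]
  have Lge: "?ge \<in> L2 M" by (intro L2_diff Lv Lu)
  have eD: "?e \<in> H1D \<Omega> \<Gamma>D" by (rule H1D_diff[OF open_domain bounded_domain v(1) u(1)])
  have Le: "?e \<in> L2 M" by (intro L2_diff Lv Lu)
  have ge_m: "weak_grad \<Omega> ?e \<in> borel_measurable M"
    using H1_D(2) eD by (auto simp: H1D_def L2_def)
  have ge_AE: "AE x in M. weak_grad \<Omega> ?e x = ?ge x"
    by (rule H1_diff(2)[OF open_domain bounded_domain vH uH])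
  have ge_inner: "L2_inner M q (weak_grad \<Omega> ?e) = L2_inner M q ?ge" if "q \<in> L2 M" for q
    by (rule L2_inner_AE_cong) (use ge_m ge_AE L2_D(1)[OF that] L2_D(1)[OF Lge] in auto)
  have ge_norm: "L2_norm M (weak_grad \<Omega> ?e) = L2_norm M ?ge"
    by (rule L2_norm_AE_cong[OF ge_m L2_D(1)[OF Lge] ge_AE])
  have uh1: "u_h \<in> elementwise_polynomials 1 \<T>" using uh by (simp add: CR_def)
  have Lh: "?gh \<in> L2 M" by (rule broken_grad_L2[OF uh1])
  \<comment> \<open>\<open>lambda_h\<close> is prescribed up to null sets only; \<open>lam\<close> is an elementwise constant representative\<close>
  obtain w0 where w0: "w0 \<in> CR \<Omega> \<Gamma>D \<T>" "AE x in M. lambda_h x = L2_proj \<Omega> \<T> w0 x"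
    using \<lambda> by (auto simp: CR_multiplier_def)
  define lam where "lam = L2_proj \<Omega> \<T> w0"
  have lamE: "lam \<in> elementwise_polynomials 0 \<T>"
    unfolding lam_def using w0(1) by (intro L2_proj_spec(1) L2_integrable EP1_L2) (simp add: CR_def)
  have lamL: "lam \<in> L2 M" by (rule EP0_L2[OF lamE])
  have lamAE: "AE x in M. lam x = lambda_h x" using w0(2) unfolding lam_def by eventually_elim simp
  have lhm: "lambda_h \<in> borel_measurable M"
    by (rule measurable_lebesgue_on_AE_cong[OF domain_lebesgue L2_D(1)[OF lamL] lamAE])
  have lam_inner: "L2_inner M lambda_h q = L2_inner M lam q" if "q \<in> L2 M" for q
    by (rule L2_inner_AE_cong[OF lhm L2_D(1)[OF that] L2_D(1)[OF lamL] L2_D(1)[OF that]])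
      (use lamAE in auto)
  have minus_lamE: "(\<lambda>x. - lam x) \<in> elementwise_polynomials 0 \<T>"
    using lamE unfolding EP0_iff by fastforce
  have minus_lam_inner: "L2_inner M (\<lambda>x. - lambda_h x) (L2_proj \<Omega> \<T> q) = - L2_inner M lam q" if q: "q \<in> L2 M" for q
  proof -
    have "L2_inner M (\<lambda>x. - lambda_h x) (L2_proj \<Omega> \<T> q) = - L2_inner M lambda_h (L2_proj \<Omega> \<T> q)"
      by (simp add: L2_inner_def)
    also have "\<dots> = - L2_inner M lam (L2_proj \<Omega> \<T> q)" by (simp add: lam_inner[OF L2_proj_L2[OF L2_integrable[OF q]]])
    finally show ?thesis by (simp add: L2_inner_proj[OF lamE L2_integrable[OF q]])
  qed
  have lam_sign: "0 \<le> - L2_inner M lam (\<lambda>x. q x - chi x)" if "AE x in M. chi x \<le> q x" for q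
  proof -
    have "AE x in M. lam x \<le> 0" using lamAE \<lambda> by (auto simp: CR_multiplier_def elim!: eventually_elim2)
    then have "AE x in M. 0 \<le> - (lam x * (q x - chi x))"
      using that by eventually_elim (simp add: mult_nonpos_nonneg)
    then have "0 \<le> (\<integral>x. - (lam x * (q x - chi x)) \<partial>M)" by (rule integral_nonneg_AE)
    then show ?thesis by (simp add: L2_inner_def)
  qed
  let ?fh = "L2_proj \<Omega> \<T> f"
  have fhE: "?fh \<in> elementwise_polynomials 0 \<T>" by (rule L2_proj_spec(1)[OF L2_integrable[OF f]])
  have Lfh: "?fh \<in> L2 M" by (rule EP0_L2[OF fhE])
  define c where "c = (\<lambda>x. ?fh x - lam x)"
  have cE: "c \<in> elementwise_polynomials 0 \<T>" unfolding c_def by (rule EP0_diff[OF fhE lamE])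
  have Lc: "c \<in> L2 M" by (rule EP0_L2[OF cE])
  define z where "z = (\<lambda>x. ?gh x - flux_correction c x)"
  have Lr: "flux_correction c \<in> L2 M" by (rule flux_correction_L2[OF cE])
  have Lz: "z \<in> L2 M" unfolding z_def by (rule L2_diff[OF Lh Lr])
  have flux: "L2_inner M z (weak_grad \<Omega> w) = L2_inner M c w" if w: "w \<in> H1D \<Omega> \<Gamma>D" for w
    unfolding z_def
  proof (rule flux_identity[OF w pos \<Gamma>D uh1 cE])
    fix q assume q: "q \<in> CR \<Omega> \<Gamma>D \<T>"
    have Lq: "L2_proj \<Omega> \<T> q \<in> L2 M"
      using q by (intro L2_proj_L2 L2_integrable EP1_L2) (simp add: CR_def)
    have "L2_inner M lambda_h (L2_proj \<Omega> \<T> q) = L2_inner M ?fh (L2_proj \<Omega> \<T> q) - L2_inner M ?gh (broken_grad \<T> q)"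
      using \<lambda> q by (auto simp: CR_multiplier_def)
    then show "L2_inner M ?gh (broken_grad \<T> q) = L2_inner M c (L2_proj \<Omega> \<T> q)"
      unfolding c_def using L2_inner_diff_left[OF Lfh lamL Lq] lam_inner[OF Lq] by simp
  qed
  define E where "E = L2_norm M ?ge"
  define A where "A = L2_norm M (\<lambda>x. ?gv x - ?gh x)"
  define C where "C = (1 / ?d) * L2_norm M (\<lambda>x. meshsize \<T> x * c x)"
  define O' where "O' = sqrt (2 ^ DIM('a)) * L2_norm M (\<lambda>x. meshsize \<T> x * (?fh x - f x))"
  define B where "B = - L2_inner M lam (\<lambda>x. v x - chi x)"
  define R where "R = - L2_inner M lam (\<lambda>x. u x - chi x)"
  define Q where "Q = A + (?d + 1) * C"
  have nn: "0 \<le> E" "0 \<le> A" "0 \<le> C" "0 \<le> O'" "0 \<le> Q" by (auto simp: E_def A_def C_def O'_def Q_def)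
  have B0: "0 \<le> B" unfolding B_def by (rule lam_sign[OF v(2)])
  have R0: "0 \<le> R" unfolding R_def by (rule lam_sign[OF u(2)])
  have corr: "L2_norm M (flux_correction c) \<le> (?d + 1) * C"
    using norm_flux_correction_le[OF cE] by (simp add: C_def)
  have vz: "L2_norm M (\<lambda>x. ?gv x - z x) \<le> Q"
  proof -
    have "(\<lambda>x. ?gv x - z x) = (\<lambda>x. (?gv x - ?gh x) + flux_correction c x)" by (auto simp: z_def)
    then show ?thesis using L2_norm_triangle[OF L2_diff[OF Lv(2) Lh] Lr] corr by (simp add: Q_def A_def)
  qed
  define R1 where "R1 = 1 / 2 * E\<^sup>2 + (L2_inner M ?gu ?ge - L2_inner M f ?e)"
  have gv2: "(L2_norm M ?gv)\<^sup>2 = (L2_norm M ?gu)\<^sup>2 + 2 * L2_inner M ?gu ?ge + E\<^sup>2"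
  proof -
    have "E\<^sup>2 = L2_inner M ?gv ?ge - L2_inner M ?gu ?ge"
      using L2_inner_diff_left[OF Lv(2) Lu(2) Lge] by (simp add: E_def L2_inner_self)
    also have "L2_inner M ?gv ?ge = (L2_norm M ?gv)\<^sup>2 - L2_inner M ?gv ?gu"
      using L2_inner_diff_right[OF Lv(2) Lv(2) Lu(2)] by (simp add: L2_inner_self)
    also have "L2_inner M ?gv ?gu = L2_inner M ?gu ?ge + (L2_norm M ?gu)\<^sup>2"
      using L2_inner_diff_right[OF Lu(2) Lv(2) Lu(2)] by (simp add: L2_inner_self L2_inner_commute)
    finally show ?thesis by simp
  qed
  have "energy \<Omega> f v - energy \<Omega> f u = R1"
    unfolding energy_def R1_def gv2 using L2_inner_diff_right[OF f Lv(1) Lu(1)] by (simp add: field_simps)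
  then have R1_0: "0 \<le> R1" using min by simp
  have osc: "\<bar>L2_inner M (\<lambda>x. ?fh x - f x) w\<bar> \<le> O' * L2_norm M (weak_grad \<Omega> w)" if "w \<in> H1D \<Omega> \<Gamma>D" for w
    using oscillation_pairing[OF f that] by (simp add: O'_def)
  have key: "R1 + R = - 1 / 2 * E\<^sup>2 + L2_inner M (\<lambda>x. ?gv x - z x) ?ge + L2_inner M (\<lambda>x. ?fh x - f x) ?e + B"
  proof -
    have 1: "L2_inner M (\<lambda>x. ?gv x - z x) ?ge = L2_inner M ?gv ?ge - L2_inner M z ?ge"
      by (rule L2_inner_diff_left[OF Lv(2) Lz Lge])
    have 2: "E\<^sup>2 = L2_inner M ?gv ?ge - L2_inner M ?gu ?ge"
      using L2_inner_diff_left[OF Lv(2) Lu(2) Lge] by (simp add: E_def L2_inner_self)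
    have 3: "L2_inner M z ?ge = L2_inner M ?fh ?e - L2_inner M lam ?e"
      using flux[OF eD] ge_inner[OF Lz] L2_inner_diff_left[OF Lfh lamL Le] by (simp add: c_def)
    have 4: "L2_inner M (\<lambda>x. ?fh x - f x) ?e = L2_inner M ?fh ?e - L2_inner M f ?e"
      by (rule L2_inner_diff_left[OF Lfh f Le])
    have "(\<lambda>x. (v x - chi x) - (u x - chi x)) = ?e" by auto
    then have 5: "L2_inner M lam ?e = R - B"
      using L2_inner_diff_right[OF lamL L2_diff[OF Lv(1) chi] L2_diff[OF Lu(1) chi]] by (simp add: R_def B_def)
    show ?thesis unfolding R1_def using 1 2 3 4 5 by linarith
  qed
  have "L2_inner M (\<lambda>x. ?gv x - z x) ?ge \<le> Q * E"
    using L2_Cauchy_Schwarz[OF L2_diff[OF Lv(2) Lz] Lge] mult_right_mono[OF vz, of E] nn by (simp add: E_def)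
  moreover have "L2_inner M (\<lambda>x. ?fh x - f x) ?e \<le> O' * E"
    using osc[OF eD] by (simp add: ge_norm E_def)
  moreover have "(Q + O') * E \<le> 1 / 4 * E\<^sup>2 + (Q + O')\<^sup>2"
    using zero_le_power2[of "1 / 2 * E - (Q + O')"] by (simp add: power2_eq_square algebra_simps)
  ultimately have main: "R1 + R + 1 / 4 * E\<^sup>2 \<le> (Q + O')\<^sup>2 + B"
    unfolding key by (simp add: distrib_right)
  define X where "X = (Q + O')\<^sup>2"
  have E2: "E\<^sup>2 \<le> 4 * (X + B)" using main R1_0 R0 unfolding X_def[symmetric] by simp
  have uhn: "L2_norm M (\<lambda>x. ?gu x - ?gh x) \<le> E + A"
  proof -
    have "(\<lambda>x. ?gu x - ?gh x) = (\<lambda>x. (?gv x - ?gh x) - ?ge x)" by auto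
    then show ?thesis using L2_norm_triangle_diff[OF L2_diff[OF Lv(2) Lh] Lge] by (simp add: E_def A_def)
  qed
  have R3: "(L2_norm M (\<lambda>x. ?gu x - ?gh x))\<^sup>2 \<le> (E + A)\<^sup>2"
    using uhn by (intro power_mono) auto
  have uz: "L2_norm M (\<lambda>x. ?gu x - z x) \<le> E + Q"
  proof -
    have "(\<lambda>x. ?gu x - z x) = (\<lambda>x. (?gu x - ?gh x) + flux_correction c x)" by (auto simp: z_def)
    then show ?thesis
      using L2_norm_triangle[OF L2_diff[OF Lu(2) Lh] Lr] corr uhn by (simp add: Q_def)
  qed
  have R5: "(dual_norm \<Omega> \<Gamma>D (\<lambda>w. CR_multiplier_functional \<Omega> \<T> lambda_h w - multiplier \<Omega> f u w))\<^sup>2 \<le> (E + Q + O')\<^sup>2"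
  proof (rule dual_norm_square_le[OF v(1)])
    show "0 \<le> E + Q + O'" using nn by simp
    fix w assume w: "w \<in> H1D \<Omega> \<Gamma>D"
    then have wH: "w \<in> H1 \<Omega>" by (simp add: H1D_def)
    note Lw = H1_D[OF wH]
    have 1: "L2_inner M lambda_h (L2_proj \<Omega> \<T> w) = L2_inner M lam w"
      using lam_inner[OF L2_proj_L2[OF L2_integrable[OF Lw(1)]]] L2_inner_proj[OF lamE L2_integrable[OF Lw(1)]] by simp
    have 2: "L2_inner M z (weak_grad \<Omega> w) = L2_inner M ?fh w - L2_inner M lam w"
      using flux[OF w] L2_inner_diff_left[OF Lfh lamL Lw(1)] by (simp add: c_def)
    have "CR_multiplier_functional \<Omega> \<T> lambda_h w - multiplier \<Omega> f u w =
        L2_inner M (\<lambda>x. ?gu x - z x) (weak_grad \<Omega> w) + L2_inner M (\<lambda>x. ?fh x - f x) w"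
      unfolding CR_multiplier_functional_def multiplier_def 1
      using 2 L2_inner_diff_left[OF Lu(2) Lz Lw(2)] L2_inner_diff_left[OF Lfh f Lw(1)] by simp
    moreover have "\<bar>L2_inner M (\<lambda>x. ?gu x - z x) (weak_grad \<Omega> w)\<bar> \<le> (E + Q) * L2_norm M (weak_grad \<Omega> w)"
      using L2_Cauchy_Schwarz[OF L2_diff[OF Lu(2) Lz] Lw(2)] mult_right_mono[OF uz, of "L2_norm M (weak_grad \<Omega> w)"]
      by simp
    ultimately show "\<bar>CR_multiplier_functional \<Omega> \<T> lambda_h w - multiplier \<Omega> f u w\<bar> \<le> (E + Q + O') * L2_norm M (weak_grad \<Omega> w)"
      using osc[OF w] by (simp add: distrib_right)
  qed
  have rho: "rho_sq \<Omega> \<Gamma>D \<T> f chi u u_h lambda_h v \<le> R1 + R + (E + A)\<^sup>2 + (E + Q + O')\<^sup>2"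
    using R3 R5 unfolding rho_sq_def multiplier_def ge_inner[OF Lu(2)] R1_def R_def E_def[symmetric]
      minus_lam_inner[OF L2_diff[OF Lu(1) chi]] by simp
  have C_eq: "etaC_sq \<Omega> \<T> f lambda_h = C\<^sup>2"
  proof -
    have "L2_norm M (\<lambda>x. meshsize \<T> x * (?fh x - lambda_h x)) = L2_norm M (\<lambda>x. meshsize \<T> x * c x)"
    proof (rule L2_norm_AE_cong)
      have m: "meshsize \<T> \<in> borel_measurable M" by (rule L2_D(1)[OF EP0_L2[OF meshsize_EP0]])
      show "(\<lambda>x. meshsize \<T> x * (?fh x - lambda_h x)) \<in> borel_measurable M"
        using m lhm L2_D(1)[OF Lfh] by simp
      show "(\<lambda>x. meshsize \<T> x * c x) \<in> borel_measurable M" using m L2_D(1)[OF Lc] by simp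
      show "AE x in M. meshsize \<T> x * (?fh x - lambda_h x) = meshsize \<T> x * c x"
        using lamAE by eventually_elim (simp add: c_def)
    qed
    then show ?thesis by (simp add: etaC_sq_def C_def power_mult_distrib power_divide)
  qed
  have eta: "eta_sq \<Omega> \<T> f chi u_h lambda_h v = A\<^sup>2 + B + C\<^sup>2"
    unfolding eta_sq_def etaA_sq_def etaB_sq_def C_eq minus_lam_inner[OF L2_diff[OF Lv(1) chi]] A_def B_def by simp
  have O2: "O'\<^sup>2 = 2 ^ DIM('a) * osc_sq \<Omega> \<T> f"
    by (simp add: O'_def osc_sq_def power_mult_distrib)
  have sq2: "(a + b)\<^sup>2 \<le> 2 * a\<^sup>2 + 2 * b\<^sup>2" for a b :: real
    using sum_squares_bound[of a b] by (simp add: power2_sum)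
  have sq3: "(a + b + c)\<^sup>2 \<le> 3 * a\<^sup>2 + 3 * b\<^sup>2 + 3 * c\<^sup>2" for a b c :: real
    using sum_squares_bound[of a b] sum_squares_bound[of a c] sum_squares_bound[of b c]
    by (simp add: power2_sum distrib_right)
  have "(E + A)\<^sup>2 \<le> 2 * E\<^sup>2 + 2 * A\<^sup>2" by (rule sq2)
  moreover have "(E + Q + O')\<^sup>2 \<le> 2 * E\<^sup>2 + 2 * X" using sq2[of E "Q + O'"] by (simp add: add.assoc X_def)
  moreover have "R1 + R \<le> X + B" using main zero_le_power2[of E] unfolding X_def[symmetric] by linarith
  ultimately have "R1 + R + (E + A)\<^sup>2 + (E + Q + O')\<^sup>2 \<le> 19 * X + 17 * B + 2 * A\<^sup>2"
    using E2 by simp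
  moreover have "X \<le> 3 * A\<^sup>2 + 3 * ((?d + 1)\<^sup>2 * C\<^sup>2) + 3 * O'\<^sup>2"
    using sq3[of A "(?d + 1) * C" O'] by (simp add: X_def Q_def power_mult_distrib)
  moreover define k where "k = (?d + 1)\<^sup>2"
  ultimately have total: "R1 + R + (E + A)\<^sup>2 + (E + Q + O')\<^sup>2 \<le>
      59 * A\<^sup>2 + 17 * B + 57 * (k * C\<^sup>2) + 57 * O'\<^sup>2" by simp
  have k1: "1 \<le> k" by (simp add: k_def one_le_power)
  have "A\<^sup>2 \<le> k * A\<^sup>2" "B \<le> k * B" "0 \<le> k * C\<^sup>2"
    using mult_right_mono[OF k1, of "A\<^sup>2"] mult_right_mono[OF k1 B0] k1 by auto
  then have "59 * A\<^sup>2 + 17 * B + 57 * (k * C\<^sup>2) \<le> 59 * (k * A\<^sup>2 + k * B + k * C\<^sup>2)"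
    using B0 by (simp add: distrib_left)
  also have "\<dots> = 59 * k * eta_sq \<Omega> \<T> f chi u_h lambda_h v"
    unfolding eta by (simp add: distrib_left mult.assoc)
  finally show ?thesis using rho total unfolding O2 k_def by simp
qed

end

theorem theorem5p11:
  fixes \<omega>0 :: real
  assumes "\<omega>0 > 0"
  shows "\<exists>c_rel > 0. \<exists>c_osc > 0.
    \<forall>(\<Omega> :: (real ^ 'd) set) \<Gamma>D \<Gamma>N \<T> f chi u.
      lipschitz_domain \<Omega> \<longrightarrow> polyhedral \<Omega> \<longrightarrow> boundary_partition \<Omega> \<Gamma>D \<Gamma>N \<longrightarrow>
      mesh_family \<Omega> \<Gamma>D \<Gamma>N \<T> \<longrightarrow> chunkiness \<T> = \<omega>0 \<longrightarrow>
      f \<in> L2 (lebesgue_on \<Omega>) \<longrightarrow> chi \<in> H1 \<Omega> \<longrightarrow> trace_nonpos_on \<Omega> \<Gamma>D chi \<longrightarrow>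
      obstacle_solution \<Omega> \<Gamma>D f chi u \<longrightarrow>
      (\<forall>h > 0. \<forall>chi_h u_h lambda_h.
         chi_h \<in> elementwise_polynomials 0 (\<T> h) \<longrightarrow>
         CR_obstacle_solution \<Omega> \<Gamma>D (\<T> h) f chi_h u_h \<longrightarrow>
         CR_multiplier \<Omega> \<Gamma>D (\<T> h) f u_h lambda_h \<longrightarrow>
         (\<forall>v \<in> obstacle_set \<Omega> \<Gamma>D chi.
            rho_sq \<Omega> \<Gamma>D (\<T> h) f chi u u_h lambda_h v
              \<le> c_rel * eta_sq \<Omega> (\<T> h) f chi u_h lambda_h v + c_osc * osc_sq \<Omega> (\<T> h) f))"
proof -
  let ?c = "59 * (real DIM(real ^ 'd) + 1)\<^sup>2" and ?c' = "57 * 2 ^ DIM(real ^ 'd) :: real"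
  have bound: "rho_sq \<Omega> \<Gamma>D (\<T> h) f chi u u_h lambda_h v \<le>
      ?c * eta_sq \<Omega> (\<T> h) f chi u_h lambda_h v + ?c' * osc_sq \<Omega> (\<T> h) f"
    if dom: "lipschitz_domain \<Omega>" and bp: "boundary_partition \<Omega> \<Gamma>D \<Gamma>N" and mf: "mesh_family \<Omega> \<Gamma>D \<Gamma>N \<T>"
      and f: "f \<in> L2 (lebesgue_on \<Omega>)" and chi: "chi \<in> H1 \<Omega>" and u: "obstacle_solution \<Omega> \<Gamma>D f chi u"
      and h: "h > 0" and uh: "CR_obstacle_solution \<Omega> \<Gamma>D (\<T> h) f chi_h u_h"
      and \<lambda>: "CR_multiplier \<Omega> \<Gamma>D (\<T> h) f u_h lambda_h" and v: "v \<in> obstacle_set \<Omega> \<Gamma>D chi"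
    for \<Omega> \<Gamma>D \<Gamma>N :: "(real ^ 'd) set" and \<T> f chi u h chi_h u_h lambda_h v
  proof -
    interpret mesh \<Omega> "\<T> h"
      by unfold_locales (use dom mf h in \<open>auto simp: mesh_family_def\<close>)
    have pos: "emeasure (hausdorff_measure (DIM(real ^ 'd) - 1)) \<Gamma>D > 0" and \<Gamma>D: "\<Gamma>D \<subseteq> frontier \<Omega>"
      using bp by (auto simp: boundary_partition_def)
    have uK: "u \<in> obstacle_set \<Omega> \<Gamma>D chi" and min: "energy \<Omega> f u \<le> energy \<Omega> f v"
      using u v by (auto simp: obstacle_solution_def is_arg_min_linorder)
    have "u_h \<in> CR \<Omega> \<Gamma>D (\<T> h)"
      using uh by (auto simp: CR_obstacle_solution_def is_arg_min_def CR_obstacle_set_def)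
    then show ?thesis
      using uK v by (intro reliability_estimate[OF pos \<Gamma>D f H1_D(1)[OF chi] _ _ _ _ min _ \<lambda>])
        (auto simp: obstacle_set_def)
  qed
  have c: "0 < ?c" and c': "0 < ?c'" by (auto intro!: mult_pos_pos zero_less_power)
  show ?thesis
  proof (rule exI[of _ ?c], rule conjI[OF c], rule exI[of _ ?c'], rule conjI[OF c'], intro allI impI ballI)
  qed (rule bound)
qed

end
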